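(* Let $M\in GL(2n,\mathbb{R})$. (i) Assume $M$ is antisymplectic, i.e. $S:=CM\in\operatorname{Sp}(n)$ where $C=\begin{pmatrix}I&0\\0&-I\end{pmatrix}$. Then for every $\psi\in\mathcal{S}'(\mathbb{R}^n)$, $$W\psi(Mz)=W(\widehat{S}^{-1}\overline{\psi})(z),$$ where $\widehat{S}$ is either of the two elements of $\operatorname{Mp}(n)$ covering $S$. (ii) Conversely, assume that for every $\psi\in\mathcal{S}(\mathbb{R}^n)$ there exists $\psi'\in\mathcal{S}'(\mathbb{R}^n)$ such that $W\psi(Mz)=W\psi'(z)$ for all $z\in\mathbb{R}^{2n}$ (as distributions). Then $M$ is either symplectic or antisymplectic.
   Context: Fix $\hbar>0$. For $\psi\in\mathcal{S}(\mathbb{R}^n)$ the Wigner transform is $$W\psi(x,p)=\left(\tfrac{1}{2\pi\hbar}\right)^n\int_{\mathbb{R}^n}e^{-\frac{i}{\hbar}p\cdot y}\psi(x+\tfrac12 y)\overline{\psi}(x-\tfrac12 y)\,dy,\qquad z=(x,p)\in\mathbb{R}^{2n},$$ extended to $\psi\in\mathcal{S}'(\mathbb{R}^n)$ in the usual distributional sense. $J=\begin{pmatrix}0&I\\-I&0\end{pmatrix}$; $\operatorname{Sp}(n)=\{S: S^TJS=J\}$ is the symplectic group; $M$ is antisymplectic if $M^TJM=-J$. $\operatorname{Mp}(n)$ is the metaplectic group, the group of unitary operators on $L^2(\mathbb{R}^n)$ forming the double cover of $\operatorname{Sp}(n)$ via a projection $\widehat{S}\mapsto S$; each $\widehat{S}$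 covering $S$ satisfies $W\psi\circ S=W(\widehat{S}^{-1}\psi)$. *)

theory Defs
  imports "HOL-Analysis.Analysis"
begin

definition partial_dir :: "'m::finite \<Rightarrow> (real^'m \<Rightarrow> complex) \<Rightarrow> real^'m \<Rightarrow> complex" where
  "partial_dir i f x = vector_derivative (\<lambda>t. f (x + t *\<^sub>R axis i 1)) (at 0)"

fun iter_partial :: "'m::finite list \<Rightarrow> (real^'m \<Rightarrow> complex) \<Rightarrow> real^'m \<Rightarrow> complex" where
  "iter_partial [] f = f"
| "iter_partial (i # is) f = partial_dir i (iter_partial is f)"

definition schwartz :: "(real^'m::finite \<Rightarrow> complex) \<Rightarrow> bool" where
  "schwartz f \<longleftrightarrow>
     (\<forall>ks. continuous_on UNIV (iter_partial ks f) \<and>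
        (\<forall>i x. ((\<lambda>t. iter_partial ks f (x + t *\<^sub>R axis i 1))
                  has_vector_derivative iter_partial (i # ks) f x) (at 0))) \<and>
     (\<forall>ks N. bounded (range (\<lambda>x. norm x ^ N * norm (iter_partial ks f x))))"

definition schwartz_seminorm :: "nat \<Rightarrow> (real^'m::finite \<Rightarrow> complex) \<Rightarrow> real" where
  "schwartz_seminorm k f =
     (\<Sum>N\<le>k. \<Sum>ks\<in>{ks::'m list. length ks \<le> k}.
        (SUP x. norm x ^ N * norm (iter_partial ks f x)))"

text \<open>A tempered distribution: a continuous linear functional on the Schwartz space
  (only its values on Schwartz functions are meaningful).\<close>
definition tempered :: "((real^'m::finite \<Rightarrow> complex) \<Rightarrow> complex) \<Rightarrow> bool" where
  "tempered T \<longleftrightarrow>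
     (\<forall>f g. schwartz f \<longrightarrow> schwartz g \<longrightarrow> T (\<lambda>x. f x + g x) = T f + T g) \<and>
     (\<forall>c f. schwartz f \<longrightarrow> T (\<lambda>x. c * f x) = c * T f) \<and>
     (\<exists>C k. \<forall>f. schwartz f \<longrightarrow> norm (T f) \<le> C * schwartz_seminorm k f)"

definition fun_dist :: "(real^'m::finite \<Rightarrow> complex) \<Rightarrow> (real^'m \<Rightarrow> complex) \<Rightarrow> complex" where
  "fun_dist \<psi> \<phi> = integral\<^sup>L lborel (\<lambda>x. \<psi> x * \<phi> x)"

definition dist_conj :: "((real^'m::finite \<Rightarrow> complex) \<Rightarrow> complex) \<Rightarrow> (real^'m \<Rightarrow> complex) \<Rightarrow> complex" where
  "dist_conj T \<phi> = cnj (T (\<lambda>x. cnj (\<phi> x)))"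

definition pvec :: "real^'n \<Rightarrow> real^'n \<Rightarrow> real^('n::finite + 'n)" where
  "pvec x p = (\<chi> k. case k of Inl i \<Rightarrow> x $ i | Inr i \<Rightarrow> p $ i)"

definition xpart :: "real^('n::finite + 'n) \<Rightarrow> real^'n" where
  "xpart z = (\<chi> i. z $ Inl i)"

definition ppart :: "real^('n::finite + 'n) \<Rightarrow> real^'n" where
  "ppart z = (\<chi> i. z $ Inr i)"

definition Jmat :: "real^('n::finite + 'n)^('n + 'n)" where
  "Jmat = (\<chi> k l. case (k, l) of
                     (Inl a, Inr b) \<Rightarrow> (if a = b then 1 else 0)
                   | (Inr a, Inl b) \<Rightarrow> (if a = b then -1 else 0)
                   | _ \<Rightarrow> 0)"

definition Cmat :: "real^('n::finite + 'n)^('n + 'n)" where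
  "Cmat = (\<chi> k l. case (k, l) of
                     (Inl a, Inl b) \<Rightarrow> (if a = b then 1 else 0)
                   | (Inr a, Inr b) \<Rightarrow> (if a = b then -1 else 0)
                   | _ \<Rightarrow> 0)"

definition symplectic :: "real^('n::finite + 'n)^('n + 'n) \<Rightarrow> bool" where
  "symplectic S \<longleftrightarrow> transpose S ** Jmat ** S = Jmat"

definition antisymplectic :: "real^('n::finite + 'n)^('n + 'n) \<Rightarrow> bool" where
  "antisymplectic M \<longleftrightarrow> transpose M ** Jmat ** M = - Jmat"

text \<open>For a test function a on phase space, b_a(x,y) = (2 pi h)^(-n) int e^(-i p.y/h) a(x,p) dp,
  and K_a(u,v) = b_a((u+v)/2, u-v). Then <W psi, a> = (psi tensor conj psi)(K_a),
  which for psi in S agrees with the integral formula of the paper.\<close>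
definition wig_kernel :: "real \<Rightarrow> (real^('n::finite + 'n) \<Rightarrow> complex) \<Rightarrow> real^'n \<Rightarrow> real^'n \<Rightarrow> complex" where
  "wig_kernel h a u v =
     (let x = (1/2) *\<^sub>R (u + v); y = u - v in
       complex_of_real ((1 / (2 * pi * h)) ^ CARD('n)) *
       integral\<^sup>L lborel (\<lambda>p. exp (- \<i> * complex_of_real (p \<bullet> y / h)) * a (pvec x p)))"

definition wigner :: "real \<Rightarrow> ((real^'n::finite \<Rightarrow> complex) \<Rightarrow> complex)
                       \<Rightarrow> (real^('n + 'n) \<Rightarrow> complex) \<Rightarrow> complex" where
  "wigner h T a = T (\<lambda>u. dist_conj T (\<lambda>v. wig_kernel h a u v))"

definition dist_comp :: "real^('n::finite + 'n)^('n + 'n) \<Rightarrow> ((real^('n + 'n) \<Rightarrow> complex) \<Rightarrow> complex)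
                          \<Rightarrow> (real^('n + 'n) \<Rightarrow> complex) \<Rightarrow> complex" where
  "dist_comp M T a = complex_of_real (1 / \<bar>det M\<bar>) * T (\<lambda>w. a (matrix_inv M *v w))"

text \<open>Generators (de Gosson's conventions). Fourier-type operator covering J.\<close>
definition mp_J :: "real \<Rightarrow> (real^'n::finite \<Rightarrow> complex) \<Rightarrow> real^'n \<Rightarrow> complex" where
  "mp_J h \<psi> x = exp (- \<i> * complex_of_real (pi * real CARD('n) / 4)) *
      complex_of_real ((1 / (2 * pi * h)) powr (real CARD('n) / 2)) *
      integral\<^sup>L lborel (\<lambda>x'. exp (- \<i> * complex_of_real (x \<bullet> x' / h)) * \<psi> x')"

text \<open>Chirp multiplication, P symmetric; covers [[I,0],[P,I]].\<close>
definition mp_chirp :: "real \<Rightarrow> real^'n^'n \<Rightarrow> (real^'n::finite \<Rightarrow> complex) \<Rightarrow> real^'n \<Rightarrow> complex" where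
  "mp_chirp h P \<psi> x = exp (\<i> * complex_of_real (((P *v x) \<bullet> x) / (2 * h))) * \<psi> x"

text \<open>Scaling with Maslov index m (m in 0..3, m even iff det L > 0); covers [[L^-1,0],[0,L^T]].\<close>
definition mp_dil :: "real^'n^'n \<Rightarrow> nat \<Rightarrow> (real^'n::finite \<Rightarrow> complex) \<Rightarrow> real^'n \<Rightarrow> complex" where
  "mp_dil L m \<psi> x = \<i> ^ m * complex_of_real (sqrt \<bar>det L\<bar>) * \<psi> (L *v x)"

inductive_set metaplectic :: "real \<Rightarrow> ((real^'n::finite \<Rightarrow> complex) \<Rightarrow> real^'n \<Rightarrow> complex) set"
  for h :: real where
  gen_J: "mp_J h \<in> metaplectic h"
| gen_chirp: "transpose P = P \<Longrightarrow> mp_chirp h P \<in> metaplectic h"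
| gen_dil: "invertible L \<Longrightarrow> m < 4 \<Longrightarrow> (even m \<longleftrightarrow> det L > 0) \<Longrightarrow> mp_dil L m \<in> metaplectic h"
| comp: "A \<in> metaplectic h \<Longrightarrow> B \<in> metaplectic h \<Longrightarrow> A \<circ> B \<in> metaplectic h"

text \<open>Heisenberg-Weyl operators and the covering projection Mp(n) -> Sp(n):
  Sh covers S iff Sh T(z) = T(S z) Sh (symplectic covariance), tested on Schwartz functions.\<close>
definition heis :: "real \<Rightarrow> real^('n::finite + 'n) \<Rightarrow> (real^'n \<Rightarrow> complex) \<Rightarrow> real^'n \<Rightarrow> complex" where
  "heis h z \<psi> x = exp (\<i> * complex_of_real ((ppart z \<bullet> x - (ppart z \<bullet> xpart z) / 2) / h)) * \<psi> (x - xpart z)"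

definition mp_covers :: "real \<Rightarrow> ((real^'n::finite \<Rightarrow> complex) \<Rightarrow> real^'n \<Rightarrow> complex)
                         \<Rightarrow> real^('n + 'n)^('n + 'n) \<Rightarrow> bool" where
  "mp_covers h Sh S \<longleftrightarrow> (\<forall>z \<psi>. schwartz \<psi> \<longrightarrow> Sh (heis h z \<psi>) = heis h (S *v z) (Sh \<psi>))"

text \<open>Action of Sh^(-1) on a tempered distribution (extension of the unitary action on L^2):
  (Sh^(-1) T)(phi) = T(conj(Sh(conj phi))).\<close>
definition mp_inv_dist :: "((real^'n::finite \<Rightarrow> complex) \<Rightarrow> real^'n \<Rightarrow> complex)
                           \<Rightarrow> ((real^'n \<Rightarrow> complex) \<Rightarrow> complex) \<Rightarrow> (real^'n \<Rightarrow> complex) \<Rightarrow> complex" where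
  "mp_inv_dist Sh T \<phi> = T (\<lambda>x. cnj (Sh (\<lambda>y. cnj (\<phi> y)) x))"

end

theory Submission
  imports Defs "HOL-Probability.Probability"
begin

text \<open>Part (i): each generator of the metaplectic group intertwines the Weyl kernels of a symbol and
  of its linear transform; complex conjugation does so for the reflection C of the momenta. Fubini's
  theorem for tempered distributions carries the identity over to distributional Wigner functions.

  Part (ii): the Wigner function of a Gaussian state is a Gaussian with quadratic form
  G = diag (X, X\<inverse>), where X = L* L and the star denotes transposition. If its pullback by M is the
  Wigner function of some \<open>\<psi>'\<close>, the pairing of \<open>\<psi>' \<otimes> cnj \<psi>'\<close> with test functions has rank one.
  Pairing with a ground state and with its products with the coordinate functions turns this into a
  condition on the second moments of the pullback, namely R J + J R = J for R = (I + M* G M)\<inverse>,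
  that is G P G = N* J N for P = M J M* and N = M\<inverse>. As this holds for all L, P is a multiple of J;
  the case L = I gives P = N* J N and forces the factor to be 1 or -1.\<close>

section \<open>Differentiation along coordinate directions\<close>

text \<open>Two obstacles shape the development. \<open>wigner\<close> applies \<open>T\<close> to a
  function that is itself produced by the conjugate of \<open>T\<close>, so part (i) must know that
  such a function of the parameter is again Schwartz and that the two applications may be exchanged.
  And \<open>schwartz\<close> speaks of derivatives along coordinate axes only, so the chain rule
  and the symmetry of mixed derivatives have to be derived. One device serves throughout: a bounded
  family stable under coordinate multiplications and partial derivatives consists of Schwartz
  functions, and likewise for operators with seminorm bounds.

  In part (ii) the kernels of products of the ground state \<phi> and the functions
  \<open>u_i\<close> \<phi> come from a Gaussian times \<open>x_i + \<i> p_i\<close> or its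
  conjugate. The first moments of a centred Gaussian vanish, so \<psi>' annihilates every
  \<open>u_i\<close> \<phi>, because it does not annihilate \<phi>. The second moments must then
  balance the constant h/2 that reflects the noncommutativity of position and momentum. Real and
  imaginary parts of these equations form the matrix identity for R.\<close>

lemma has_vector_derivative_from_quadratic:
  fixes F :: "real \<Rightarrow> complex"
  assumes "\<And>t. norm (F t - F 0 - t *\<^sub>R D) \<le> K * t\<^sup>2"
  shows "(F has_vector_derivative D) (at 0)"
proof -
  have "((\<lambda>t. norm (F (0 + t) - F 0 - t *\<^sub>R D) / norm t) \<longlongrightarrow> 0) (at 0)"
  proof (rule Lim_null_comparison)
    show "\<forall>\<^sub>F t in at 0. norm (norm (F (0 + t) - F 0 - t *\<^sub>R D) / norm t) \<le> \<bar>K\<bar> * \<bar>t\<bar>"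
    proof (rule always_eventually, rule allI)
      fix t :: real
      have "norm (F t - F 0 - t *\<^sub>R D) \<le> \<bar>K\<bar> * \<bar>t\<bar> * \<bar>t\<bar>"
        by (rule order_trans[OF assms]) (simp add: power2_eq_square mult.assoc abs_mult_self_eq mult_right_mono)
      then show "norm (norm (F (0 + t) - F 0 - t *\<^sub>R D) / norm t) \<le> \<bar>K\<bar> * \<bar>t\<bar>"
        by (cases "t = 0") (simp_all add: divide_le_eq)
    qed
    show "((\<lambda>t. \<bar>K\<bar> * \<bar>t\<bar>) \<longlongrightarrow> 0) (at (0::real))"
      by (auto intro!: tendsto_eq_intros)
  qed
  then show ?thesis
    unfolding has_vector_derivative_def has_derivative_at
    by (simp add: bounded_linear_scaleR_left)
qed

lemma vector_derivative_bound:
  fixes g :: "real \<Rightarrow> complex"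
  assumes "\<And>s. \<bar>s\<bar> \<le> \<bar>t\<bar> \<Longrightarrow> (g has_vector_derivative g' s) (at s)"
    and "\<And>s. \<bar>s\<bar> \<le> \<bar>t\<bar> \<Longrightarrow> norm (g' s) \<le> B"
  shows "norm (g t - g 0) \<le> B * \<bar>t\<bar>"
proof -
  have "norm (g t - g 0) \<le> B * norm (t - 0)"
  proof (rule differentiable_bound[where S="{- \<bar>t\<bar>..\<bar>t\<bar>}" and f'="\<lambda>s h. h *\<^sub>R g' s"])
    fix s assume "s \<in> {- \<bar>t\<bar>..\<bar>t\<bar>}"
    then have s: "\<bar>s\<bar> \<le> \<bar>t\<bar>" by auto
    show "(g has_derivative (\<lambda>h. h *\<^sub>R g' s)) (at s within {- \<bar>t\<bar>..\<bar>t\<bar>})"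
      using assms(1)[OF s] unfolding has_vector_derivative_def by (rule has_derivative_at_withinI)
    show "onorm (\<lambda>h. h *\<^sub>R g' s) \<le> B"
      by (rule onorm_le) (use mult_left_mono[OF assms(2)[OF s] abs_ge_zero] in \<open>simp add: mult.commute\<close>)
  qed auto
  then show ?thesis by simp
qed

text \<open>Partial derivatives are given at parameter 0 only, but for every base point; moving the
  base point along the line yields the derivative at every parameter, as the mean value estimates
  require.\<close>

lemma has_vector_derivative_shift_axis:
  fixes f :: "'a::real_normed_vector \<Rightarrow> 'b::real_normed_vector"
  assumes "\<And>x. ((\<lambda>t. f (x + t *\<^sub>R e)) has_vector_derivative f' x) (at 0)"
  shows "((\<lambda>t. f (x + t *\<^sub>R e)) has_vector_derivative f' (x + s *\<^sub>R e)) (at s)"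
proof -
  have "((\<lambda>t. t - s) has_vector_derivative 1) (at s)"
    by (auto intro!: derivative_eq_intros)
  moreover have "((\<lambda>t. f (x + s *\<^sub>R e + t *\<^sub>R e)) has_vector_derivative f' (x + s *\<^sub>R e)) (at (s - s))"
    using assms[of "x + s *\<^sub>R e"] by simp
  ultimately have "((\<lambda>t. f (x + s *\<^sub>R e + t *\<^sub>R e)) \<circ> (\<lambda>t. t - s) has_vector_derivative 1 *\<^sub>R f' (x + s *\<^sub>R e)) (at s)"
    by (rule vector_diff_chain_at)
  moreover have "(\<lambda>t. f (x + s *\<^sub>R e + t *\<^sub>R e)) \<circ> (\<lambda>t. t - s) = (\<lambda>t. f (x + t *\<^sub>R e))"
    by (rule ext) (simp add: scaleR_diff_left)
  ultimately show ?thesis by simp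
qed

lemma has_vector_derivative_line: "((\<lambda>s. s *\<^sub>R c) has_vector_derivative c) (at s)"
  unfolding has_vector_derivative_def
  by (rule bounded_linear_imp_has_derivative) (rule bounded_linear_scaleR_left)

lemma vec_eq_sum_axis: "(x :: real^'m::finite) = (\<Sum>i\<in>UNIV. (x $ i) *\<^sub>R axis i 1)"
  using basis_expansion[of x] by (simp add: scalar_mult_eq_scaleR)

text \<open>Walk from y to x one coordinate at a time: a step costs at most K times the change of
  that coordinate, hence at most K times the norm of x - y. This is also how continuity is obtained
  in \<open>schwartz_coinduct\<close>.\<close>

lemma lipschitz_from_partials:
  fixes f :: "real^'m::finite \<Rightarrow> complex"
  assumes d: "\<And>i x. ((\<lambda>t. f (x + t *\<^sub>R axis i 1)) has_vector_derivative f' i x) (at 0)"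
    and b: "\<And>i x. norm (f' i x) \<le> K"
  shows "norm (f x - f y) \<le> K * real CARD('m) * norm (x - y)"
proof -
  have K0: "0 \<le> K" using order_trans[OF norm_ge_zero b] .
  have step: "norm (f (z + t *\<^sub>R axis i 1) - f z) \<le> K * \<bar>t\<bar>" for z t i
    using vector_derivative_bound[of t "\<lambda>t. f (z + t *\<^sub>R axis i 1)" "\<lambda>s. f' i (z + s *\<^sub>R axis i 1)" K]
      has_vector_derivative_shift_axis[of f "axis i 1" "f' i" z] d b by simp
  have "norm (f (y + (\<Sum>i\<in>A. (x $ i - y $ i) *\<^sub>R axis i 1)) - f y) \<le> (\<Sum>i\<in>A. K * \<bar>x $ i - y $ i\<bar>)"
    if "finite A" for A :: "'m set"
    using that
  proof induction
    case (insert j A)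
    let ?z = "y + (\<Sum>i\<in>A. (x $ i - y $ i) *\<^sub>R axis i 1)"
    have "norm (f (?z + (x $ j - y $ j) *\<^sub>R axis j 1) - f y)
        \<le> norm (f (?z + (x $ j - y $ j) *\<^sub>R axis j 1) - f ?z) + norm (f ?z - f y)"
      using norm_triangle_ineq[of "f (?z + (x $ j - y $ j) *\<^sub>R axis j 1) - f ?z" "f ?z - f y"] by simp
    also have "\<dots> \<le> K * \<bar>x $ j - y $ j\<bar> + (\<Sum>i\<in>A. K * \<bar>x $ i - y $ i\<bar>)"
      by (intro add_mono step insert.IH)
    finally show ?case using insert.hyps by (simp add: algebra_simps)
  qed simp
  from this[of UNIV] have "norm (f (y + (\<Sum>i\<in>UNIV. ((x - y) $ i) *\<^sub>R axis i 1)) - f y) \<le> (\<Sum>i\<in>UNIV. K * \<bar>(x - y) $ i\<bar>)"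
    by simp
  also have "\<dots> \<le> (\<Sum>i\<in>(UNIV::'m set). K * norm (x - y))"
    by (intro sum_mono mult_left_mono component_le_norm_cart K0)
  finally show ?thesis
    unfolding vec_eq_sum_axis[of "x - y", symmetric] by (simp add: mult_ac)
qed

text \<open>The mean value estimate, applied twice, bounds the remainder by K t^2 for all t. Such a
  global quadratic bound passes through sums, integrals and seminorms and is turned into a
  derivative only at the end, by \<open>has_vector_derivative_from_quadratic\<close>.\<close>

lemma taylor_axis:
  fixes f :: "real^'m::finite \<Rightarrow> complex"
  assumes d: "\<And>x. ((\<lambda>t. f (x + t *\<^sub>R axis i 1)) has_vector_derivative f' x) (at 0)"
    and d2: "\<And>x. ((\<lambda>t. f' (x + t *\<^sub>R axis i 1)) has_vector_derivative f'' x) (at 0)"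
    and b: "\<And>s. norm (f'' (x + s *\<^sub>R axis i 1)) \<le> K"
  shows "norm (f (x + t *\<^sub>R axis i 1) - f x - t *\<^sub>R f' x) \<le> K * t\<^sup>2"
proof -
  have K0: "0 \<le> K" using order_trans[OF norm_ge_zero b] .
  define g where "g s = f (x + s *\<^sub>R axis i 1) - s *\<^sub>R f' x" for s
  have f': "norm (f' (x + s *\<^sub>R axis i 1) - f' x) \<le> K * \<bar>s\<bar>" for s
    using vector_derivative_bound[of s "\<lambda>t. f' (x + t *\<^sub>R axis i 1)" "\<lambda>s. f'' (x + s *\<^sub>R axis i 1)" K]
      has_vector_derivative_shift_axis[of f' "axis i 1" f'' x] d2 b by simp
  have "norm (g t - g 0) \<le> (K * \<bar>t\<bar>) * \<bar>t\<bar>"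
  proof (rule vector_derivative_bound[where g=g and t=t and g'="\<lambda>s. f' (x + s *\<^sub>R axis i 1) - f' x"])
    fix s assume s: "\<bar>s\<bar> \<le> \<bar>t\<bar>"
    show "(g has_vector_derivative f' (x + s *\<^sub>R axis i 1) - f' x) (at s)"
      using has_vector_derivative_diff[OF has_vector_derivative_shift_axis[of f "axis i 1" f' x s, OF d]
          has_vector_derivative_line[of "f' x" s]]
      by (simp add: g_def[abs_def])
    show "norm (f' (x + s *\<^sub>R axis i 1) - f' x) \<le> K * \<bar>t\<bar>"
      by (rule order_trans[OF f']) (simp add: K0 s mult_left_mono)
  qed
  then show ?thesis
    by (simp add: g_def power2_eq_square algebra_simps)
qed

section \<open>Schwartz functions\<close>

lemma iter_partial_append: "iter_partial (ks @ js) f = iter_partial ks (iter_partial js f)"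
  by (induction ks) auto

lemma schwartz_iter:
  assumes "schwartz f"
  shows "schwartz (iter_partial ks f)"
proof -
  have "iter_partial js (iter_partial ks f) = iter_partial (js @ ks) f"
    "iter_partial (i # js) (iter_partial ks f) = iter_partial (i # (js @ ks)) f" for i js
    by (simp_all add: iter_partial_append)
  with assms show ?thesis unfolding schwartz_def by (simp only: simp_thms)
qed

lemma schwartz_partial: "schwartz f \<Longrightarrow> schwartz (partial_dir i f)"
  using schwartz_iter[of f "[i]"] by simp

lemma schwartz_deriv:
  "schwartz f \<Longrightarrow> ((\<lambda>t. f (x + t *\<^sub>R axis i 1)) has_vector_derivative partial_dir i f x) (at 0)"
  unfolding schwartz_def using iter_partial.simps by (auto dest: spec[of _ "[]"])

lemma schwartz_continuous: "schwartz f \<Longrightarrow> continuous_on UNIV f"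
  unfolding schwartz_def by (auto dest: spec[of _ "[]"])

lemma schwartz_measurable [measurable]: "schwartz f \<Longrightarrow> f \<in> borel_measurable borel"
  by (rule borel_measurable_continuous_onI[OF schwartz_continuous])

lemma partial_dir_eqI:
  "(\<And>x. ((\<lambda>t. f (x + t *\<^sub>R axis i 1)) has_vector_derivative f' x) (at 0)) \<Longrightarrow> partial_dir i f = f'"
  unfolding partial_dir_def by (rule ext) (rule vector_derivative_at)

lemma schwartz_bdd_above:
  "schwartz f \<Longrightarrow> bdd_above (range (\<lambda>x. norm x ^ N * norm (iter_partial ks f x)))"
  unfolding schwartz_def by (auto intro: bounded_imp_bdd_above)

lemma schwartz_SUP_le_seminorm:
  assumes "schwartz f" "N \<le> k" "length ks \<le> k"
  shows "(SUP x. norm x ^ N * norm (iter_partial ks f x)) \<le> schwartz_seminorm k (f :: real^'m::finite \<Rightarrow> complex)"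
proof -
  have fin: "finite {ks::'m list. length ks \<le> k}"
    using finite_lists_length_le[of "UNIV::'m set" k] by simp
  have nn: "0 \<le> (SUP x. norm x ^ N * norm (iter_partial ks f x))" for N ks
    by (rule cSUP_upper2[OF schwartz_bdd_above[OF assms(1)], of 0]) auto
  have "(SUP x. norm x ^ N * norm (iter_partial ks f x)) \<le>
      (\<Sum>ks\<in>{ks::'m list. length ks \<le> k}. (SUP x. norm x ^ N * norm (iter_partial ks f x)))"
    by (rule member_le_sum) (use fin nn assms in auto)
  also have "\<dots> \<le> schwartz_seminorm k f"
    unfolding schwartz_seminorm_def
    by (rule member_le_sum[of N "{..k}" "\<lambda>N. \<Sum>ks\<in>{ks::'m list. length ks \<le> k}. (SUP x. norm x ^ N * norm (iter_partial ks f x))"])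
      (use nn assms in \<open>auto intro!: sum_nonneg\<close>)
  finally show ?thesis .
qed

lemma schwartz_le_seminorm:
  assumes "schwartz f" "N \<le> k" "length ks \<le> k"
  shows "norm x ^ N * norm (iter_partial ks f x) \<le> schwartz_seminorm k f"
  by (rule order_trans[OF cSUP_upper[OF UNIV_I schwartz_bdd_above[OF assms(1)]]
        schwartz_SUP_le_seminorm[OF assms]])

lemma schwartz_seminorm_nonneg: "schwartz f \<Longrightarrow> 0 \<le> schwartz_seminorm k f"
  by (rule order_trans[OF _ schwartz_le_seminorm[of f 0 k "[]" 0]]) auto

lemma schwartz_seminorm_mono:
  assumes "schwartz (f :: real^'m::finite \<Rightarrow> complex)" "k \<le> l"
  shows "schwartz_seminorm k f \<le> schwartz_seminorm l f"
proof -
  have fin: "finite {ks::'m list. length ks \<le> k}" for k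
    using finite_lists_length_le[of "UNIV::'m set" k] by simp
  have nn: "0 \<le> (SUP x. norm x ^ N * norm (iter_partial ks f x))" for N ks
    by (rule cSUP_upper2[OF schwartz_bdd_above[OF assms(1)], of 0]) auto
  have "schwartz_seminorm k f \<le> (\<Sum>N\<le>k. \<Sum>ks\<in>{ks::'m list. length ks \<le> l}. (SUP x. norm x ^ N * norm (iter_partial ks f x)))"
    unfolding schwartz_seminorm_def
    by (intro sum_mono sum_mono2) (use fin nn assms in auto)
  also have "\<dots> \<le> schwartz_seminorm l f"
    unfolding schwartz_seminorm_def
    by (rule sum_mono2) (use nn assms in \<open>auto intro!: sum_nonneg\<close>)
  finally show ?thesis .
qed

text \<open>\<open>schwartz_seminorm\<close> is a sum of suprema, whence the factor: the number of
  powers N times the number of lists of length at most k.\<close>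

lemma schwartz_seminorm_leI:
  fixes f :: "real^'m::finite \<Rightarrow> complex"
  assumes "\<And>N ks x. N \<le> k \<Longrightarrow> length ks \<le> k \<Longrightarrow> norm x ^ N * norm (iter_partial ks f x) \<le> B"
  shows "schwartz_seminorm k f \<le> real (Suc k * card {ks::'m list. length ks \<le> k}) * B"
proof -
  have "schwartz_seminorm k f \<le> (\<Sum>N\<le>k. \<Sum>ks\<in>{ks::'m list. length ks \<le> k}. B)"
    unfolding schwartz_seminorm_def by (intro sum_mono cSUP_least) (use assms in auto)
  then show ?thesis by (simp add: algebra_simps)
qed

text \<open>The Euclidean norm is at most the sum of the absolute coordinates, so one power of the
  norm can be traded for multiplications by coordinates. Decay of every order thus reduces to
  boundedness of products with coordinates.\<close>

lemma norm_power_Suc_le_sum: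
  fixes x :: "real^'m::finite" and c :: complex
  shows "norm x ^ Suc N * norm c \<le> (\<Sum>i\<in>UNIV. norm x ^ N * norm (complex_of_real (x $ i) * c))"
proof -
  have "norm x ^ Suc N * norm c = norm x * (norm x ^ N * norm c)" by simp
  also have "\<dots> \<le> (\<Sum>i\<in>UNIV. \<bar>x $ i\<bar>) * (norm x ^ N * norm c)"
    by (rule mult_right_mono[OF norm_le_l1_cart]) simp
  also have "\<dots> = (\<Sum>i\<in>UNIV. norm x ^ N * norm (complex_of_real (x $ i) * c))"
    unfolding sum_distrib_right by (rule sum.cong) (simp_all add: norm_mult mult_ac)
  finally show ?thesis .
qed

text \<open>Coinduction: a class of bounded functions that is stable under multiplication by coordinates
  and under partial derivatives consists of Schwartz functions.\<close>

lemma schwartz_coinduct: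
  fixes f :: "real^'m::finite \<Rightarrow> complex"
  assumes Pf: "P f"
    and bdd: "\<And>f. P f \<Longrightarrow> \<exists>B. \<forall>x. norm (f x) \<le> B"
    and mul: "\<And>f i. P f \<Longrightarrow> P (\<lambda>x. complex_of_real (x $ i) * f x)"
    and der: "\<And>f i. P f \<Longrightarrow> \<exists>f'. P f' \<and>
        (\<forall>x. ((\<lambda>t. f (x + t *\<^sub>R axis i 1)) has_vector_derivative f' x) (at 0))"
  shows "schwartz f"
proof -
  have d: "P (partial_dir i g) \<and>
      (\<forall>x. ((\<lambda>t. g (x + t *\<^sub>R axis i 1)) has_vector_derivative partial_dir i g x) (at 0))" if "P g" for g i
    using der[OF that, of i] partial_dir_eqI[of g i] by metis
  have it: "P (iter_partial ks f)" for ks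
    by (induction ks) (use Pf d in auto)
  \<comment> \<open>The partial derivatives of a member are members, hence bounded, which makes the
    member Lipschitz.\<close>
  have cont: "continuous_on UNIV g" if "P g" for g
  proof -
    have "\<forall>i. \<exists>B. \<forall>x. norm (partial_dir i g x) \<le> B" using bdd d that by blast
    then obtain B where B: "\<And>i x. norm (partial_dir i g x) \<le> B i" by metis
    have B0: "0 \<le> B i" for i using order_trans[OF norm_ge_zero B] .
    have "norm (partial_dir i g x) \<le> (\<Sum>i\<in>UNIV. B i)" for i x
      using B[of i x] member_le_sum[of i UNIV B] B0 by (auto intro: order_trans)
    then have "norm (g x - g y) \<le> (\<Sum>i\<in>UNIV. B i) * real CARD('m) * norm (x - y)" for x y
      using lipschitz_from_partials[of g "\<lambda>i. partial_dir i g"] d that by blast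
    then have "((\<Sum>i\<in>UNIV. B i) * real CARD('m))-lipschitz_on UNIV g"
      by (intro lipschitz_onI) (auto simp: dist_norm sum_nonneg B0)
    then show ?thesis by (rule lipschitz_on_continuous_on)
  qed
  have decay: "\<exists>B. \<forall>x. norm x ^ N * norm (g x) \<le> B" if "P g" for g N
    using that
  proof (induction N arbitrary: g)
    case 0 then show ?case using bdd by simp
  next
    case (Suc N)
    then have "\<forall>i. \<exists>B. \<forall>x. norm x ^ N * norm (complex_of_real (x $ i) * g x) \<le> B" using mul by blast
    then obtain B where B: "\<And>i x. norm x ^ N * norm (complex_of_real (x $ i) * g x) \<le> B i" by metis
    have "norm x ^ Suc N * norm (g x) \<le> (\<Sum>i\<in>UNIV. B i)" for x
      by (rule order_trans[OF norm_power_Suc_le_sum sum_mono]) (rule B)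
    then show ?case by blast
  qed
  show ?thesis
    unfolding schwartz_def
    using it d cont decay by (auto simp: bounded_iff)
qed

section \<open>Continuous operators between Schwartz spaces\<close>

definition schwartz_op :: "((real^'k::finite \<Rightarrow> complex) \<Rightarrow> real^'m::finite \<Rightarrow> complex) \<Rightarrow> bool" where
  "schwartz_op A \<longleftrightarrow> (\<forall>f. schwartz f \<longrightarrow> schwartz (A f)) \<and>
     (\<forall>k. \<exists>C m. \<forall>f. schwartz f \<longrightarrow> schwartz_seminorm k (A f) \<le> C * schwartz_seminorm m f)"

text \<open>Since the seminorms increase with the order, two estimates have a common form: the sum
  of the absolute constants and the sum of the orders serve both.\<close>

lemma seminorm_bound_finite:
  assumes "finite I" and "\<And>i. i \<in> I \<Longrightarrow> \<exists>C m. \<forall>f. schwartz f \<longrightarrow> (\<forall>x. q i f x \<le> C * schwartz_seminorm m f)"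
  shows "\<exists>C m. \<forall>f. schwartz f \<longrightarrow> (\<forall>i\<in>I. \<forall>x. q i f x \<le> C * schwartz_seminorm m f)"
  using assms
proof (induction I)
  case (insert j I)
  obtain C m where 1: "\<forall>f. schwartz f \<longrightarrow> (\<forall>i\<in>I. \<forall>x. q i f x \<le> C * schwartz_seminorm m f)"
    using insert.IH insert.prems by auto
  obtain C' m' where 2: "\<forall>f. schwartz f \<longrightarrow> (\<forall>x. q j f x \<le> C' * schwartz_seminorm m' f)"
    using insert.prems by blast
  have "q i f x \<le> (\<bar>C\<bar> + \<bar>C'\<bar>) * schwartz_seminorm (m + m') f"
    if f: "schwartz f" and i: "i \<in> insert j I" for i f x
  proof -
    have "C * schwartz_seminorm m f \<le> (\<bar>C\<bar> + \<bar>C'\<bar>) * schwartz_seminorm (m + m') f"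
      "C' * schwartz_seminorm m' f \<le> (\<bar>C\<bar> + \<bar>C'\<bar>) * schwartz_seminorm (m + m') f"
      by (intro mult_mono schwartz_seminorm_mono schwartz_seminorm_nonneg f; simp)+
    moreover have "q i f x \<le> C * schwartz_seminorm m f \<or> q i f x \<le> C' * schwartz_seminorm m' f"
      using 1 2 f i by blast
    ultimately show ?thesis by linarith
  qed
  then show ?case by blast
qed auto

text \<open>This is \<open>schwartz_coinduct\<close> run on operators instead of functions, so that
  C and m do not depend on f. The equations in \<open>mul\<close> and \<open>der\<close> are
  demanded on Schwartz arguments only, where the differentiation rules hold.\<close>

lemma schwartz_op_coinduct:
  fixes A :: "(real^'k::finite \<Rightarrow> complex) \<Rightarrow> real^'m::finite \<Rightarrow> complex"
  assumes PA: "P A"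
    and bdd: "\<And>A. P A \<Longrightarrow> \<exists>C m. \<forall>f. schwartz f \<longrightarrow> (\<forall>x. norm (A f x) \<le> C * schwartz_seminorm m f)"
    and mul: "\<And>A i. P A \<Longrightarrow> \<exists>A'. P A' \<and> (\<forall>f. schwartz f \<longrightarrow> A' f = (\<lambda>x. complex_of_real (x $ i) * A f x))"
    and der: "\<And>A i. P A \<Longrightarrow> \<exists>A'. P A' \<and> (\<forall>f x. schwartz f \<longrightarrow>
        ((\<lambda>t. A f (x + t *\<^sub>R axis i 1)) has_vector_derivative A' f x) (at 0))"
  shows "schwartz_op A"
proof -
  have S: "schwartz (A f)" if f: "schwartz f" for f
  proof (rule schwartz_coinduct[where P="\<lambda>g. \<exists>A. P A \<and> g = A f"])
    fix g i assume "\<exists>A. P A \<and> g = A f"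
    then obtain A where A: "P A" "g = A f" by blast
    show "\<exists>B. \<forall>x. norm (g x) \<le> B" using bdd[OF A(1)] A(2) f by blast
    show "\<exists>A. P A \<and> (\<lambda>x. complex_of_real (x $ i) * g x) = A f" using mul[OF A(1), of i] A(2) f by metis
    show "\<exists>f'. (\<exists>A. P A \<and> f' = A f) \<and> (\<forall>x. ((\<lambda>t. g (x + t *\<^sub>R axis i 1)) has_vector_derivative f' x) (at 0))"
      using der[OF A(1), of i] A(2) f by blast
  qed (use PA in blast)
  have it: "\<exists>B. P B \<and> (\<forall>f. schwartz f \<longrightarrow> iter_partial ks (A f) = B f)" for ks
  proof (induction ks)
    case (Cons i ks)
    then obtain B where B: "P B" "\<forall>f. schwartz f \<longrightarrow> iter_partial ks (A f) = B f" by blast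
    obtain B' where B': "P B'" "\<forall>f x. schwartz f \<longrightarrow>
        ((\<lambda>t. B f (x + t *\<^sub>R axis i 1)) has_vector_derivative B' f x) (at 0)" using der[OF B(1)] by blast
    have "iter_partial (i # ks) (A f) = B' f" if "schwartz f" for f
      using B(2) B'(2) that by (auto intro!: partial_dir_eqI)
    then show ?case using B' by blast
  qed (use PA in auto)
  have decay: "\<exists>C m. \<forall>f. schwartz f \<longrightarrow> (\<forall>x. norm x ^ N * norm (B f x) \<le> C * schwartz_seminorm m f)" if "P B" for B N
    using that
  proof (induction N arbitrary: B)
    case 0 then show ?case using bdd by simp
  next
    case (Suc N)
    have "\<exists>C m. \<forall>f. schwartz f \<longrightarrow> (\<forall>x. norm x ^ N * norm (complex_of_real (x $ i) * B f x) \<le> C * schwartz_seminorm m f)" for i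
    proof -
      obtain A' where A': "P A'" "\<forall>f. schwartz f \<longrightarrow> A' f = (\<lambda>x. complex_of_real (x $ i) * B f x)"
        using mul[OF Suc.prems] by blast
      obtain C m where "\<forall>f. schwartz f \<longrightarrow> (\<forall>x. norm x ^ N * norm (A' f x) \<le> C * schwartz_seminorm m f)"
        using Suc.IH[OF A'(1)] by blast
      with A'(2) show ?thesis by (intro exI[of _ C] exI[of _ m]) auto
    qed
    then obtain C m where C: "\<forall>f. schwartz f \<longrightarrow> (\<forall>i\<in>UNIV. \<forall>x. norm x ^ N * norm (complex_of_real (x $ i) * B f x) \<le> C * schwartz_seminorm m f)"
      using seminorm_bound_finite[of "UNIV::'m set" "\<lambda>i f x. norm x ^ N * norm (complex_of_real (x $ i) * B f x)"] by auto
    have "norm x ^ Suc N * norm (B f x) \<le> (real CARD('m) * C) * schwartz_seminorm m f" if "schwartz f" for f x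
    proof -
      have "norm x ^ Suc N * norm (B f x) \<le> (\<Sum>i\<in>(UNIV::'m set). C * schwartz_seminorm m f)"
        by (rule order_trans[OF norm_power_Suc_le_sum sum_mono]) (use C that in blast)
      then show ?thesis by (simp add: mult_ac)
    qed
    then show ?case by blast
  qed
  have "\<exists>C m. \<forall>f. schwartz f \<longrightarrow> schwartz_seminorm k (A f) \<le> C * schwartz_seminorm m f" for k
  proof -
    have fin: "finite ({..k} \<times> {ks::'m list. length ks \<le> k})"
      using finite_lists_length_le[of "UNIV::'m set" k] by simp
    have "\<exists>C m. \<forall>f. schwartz f \<longrightarrow> (\<forall>x. norm x ^ N * norm (iter_partial ks (A f) x) \<le> C * schwartz_seminorm m f)" for N ks
    proof -
      obtain B where B: "P B" "\<forall>f. schwartz f \<longrightarrow> iter_partial ks (A f) = B f" using it by blast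
      obtain C m where "\<forall>f. schwartz f \<longrightarrow> (\<forall>x. norm x ^ N * norm (B f x) \<le> C * schwartz_seminorm m f)"
        using decay[OF B(1)] by blast
      with B(2) show ?thesis by (intro exI[of _ C] exI[of _ m]) auto
    qed
    then obtain C m where C: "\<forall>f. schwartz f \<longrightarrow> (\<forall>(N, ks)\<in>{..k} \<times> {ks::'m list. length ks \<le> k}. \<forall>x.
        norm x ^ N * norm (iter_partial ks (A f) x) \<le> C * schwartz_seminorm m f)"
      using seminorm_bound_finite[OF fin, of "\<lambda>(N, ks) f x. norm x ^ N * norm (iter_partial ks (A f) x)"]
      by (auto simp: split_beta)
    have "schwartz_seminorm k (A f) \<le> real (Suc k * card {ks::'m list. length ks \<le> k}) * (C * schwartz_seminorm m f)"
      if "schwartz f" for f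
      by (rule schwartz_seminorm_leI) (use C that in auto)
    then show ?thesis by (metis mult.assoc)
  qed
  with S show ?thesis unfolding schwartz_op_def by blast
qed

section \<open>Differential operators with polynomial coefficients (the Weyl algebra)\<close>

inductive diffop :: "((real^'m::finite \<Rightarrow> complex) \<Rightarrow> real^'m \<Rightarrow> complex) \<Rightarrow> bool" where
  iter: "diffop (iter_partial ks)"
| add: "diffop A \<Longrightarrow> diffop B \<Longrightarrow> diffop (\<lambda>f x. A f x + B f x)"
| scale: "diffop A \<Longrightarrow> diffop (\<lambda>f x. c * A f x)"
| mul: "diffop A \<Longrightarrow> diffop (\<lambda>f x. complex_of_real (x $ i) * A f x)"

lemma diffop_id: "diffop (\<lambda>f. f)"
  using diffop.iter[of "[]"] by (subst (asm) iter_partial.simps(1)[abs_def]) simp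

lemma diffop_sum: "finite I \<Longrightarrow> (\<And>i. i \<in> I \<Longrightarrow> diffop (A i)) \<Longrightarrow> diffop (\<lambda>f x. \<Sum>i\<in>I. A i f x)"
proof (induction I rule: finite_induct)
  case empty
  show ?case using diffop.scale[OF diffop_id, of 0] by simp
next
  case (insert i I)
  then show ?case using diffop.add[of "A i"] by simp
qed

lemma has_vector_derivative_coord:
  "((\<lambda>t. complex_of_real ((x + t *\<^sub>R axis j 1) $ i)) has_vector_derivative (if i = j then 1 else 0)) (at 0)"
proof -
  have "((\<lambda>t. complex_of_real (x $ i + t * (if i = j then 1 else 0))) has_vector_derivative
      complex_of_real (if i = j then 1 else 0)) (at 0)"
    by (rule has_vector_derivative_of_real) (auto intro!: derivative_eq_intros)
  then show ?thesis by (simp add: axis_def eq_commute[of j] if_distrib cong: if_cong)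
qed

text \<open>The Leibniz rule for a coordinate factor produces a Kronecker delta, after which the
  coordinates stand again to the left of the derivatives.\<close>

lemma diffop_deriv:
  "diffop A \<Longrightarrow> \<exists>A'. diffop A' \<and> (\<forall>f x. schwartz f \<longrightarrow>
      ((\<lambda>t. A f (x + t *\<^sub>R axis j 1)) has_vector_derivative A' f x) (at 0))"
proof (induction rule: diffop.induct)
  case (iter ks)
  have "diffop (iter_partial (j # ks))" by (rule diffop.iter)
  then show ?case using schwartz_deriv[OF schwartz_iter] by (metis iter_partial.simps(2))
next
  case (add A B)
  then obtain A' B' where "diffop A'" "diffop B'"
    "\<And>f x. schwartz f \<Longrightarrow> ((\<lambda>t. A f (x + t *\<^sub>R axis j 1)) has_vector_derivative A' f x) (at 0)"
    "\<And>f x. schwartz f \<Longrightarrow> ((\<lambda>t. B f (x + t *\<^sub>R axis j 1)) has_vector_derivative B' f x) (at 0)" by metis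
  then show ?case
    by (intro exI[of _ "\<lambda>f x. A' f x + B' f x"]) (auto intro: diffop.add has_vector_derivative_add)
next
  case (scale A c)
  then obtain A' where "diffop A'"
    "\<And>f x. schwartz f \<Longrightarrow> ((\<lambda>t. A f (x + t *\<^sub>R axis j 1)) has_vector_derivative A' f x) (at 0)" by metis
  then show ?case
    by (intro exI[of _ "\<lambda>f x. c * A' f x"]) (auto intro: diffop.scale has_vector_derivative_mult_right)
next
  case (mul A i)
  then obtain A' where A': "diffop A'"
    "\<And>f x. schwartz f \<Longrightarrow> ((\<lambda>t. A f (x + t *\<^sub>R axis j 1)) has_vector_derivative A' f x) (at 0)" by metis
  define c :: complex where "c = (if i = j then 1 else 0)"
  have "((\<lambda>t. complex_of_real ((x + t *\<^sub>R axis j 1) $ i) * A f (x + t *\<^sub>R axis j 1)) has_vector_derivative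
      complex_of_real (x $ i) * A' f x + c * A f x) (at 0)" if "schwartz f" for f x
    using has_vector_derivative_mult[OF has_vector_derivative_coord[of x j i] A'(2)[OF that, of x]]
    by (simp only: scaleR_zero_left add_0_right c_def)
  then show ?case
    using A'(1) mul.hyps
    by (intro exI[of _ "\<lambda>f x. complex_of_real (x $ i) * A' f x + c * A f x"])
      (auto intro!: diffop.add diffop.mul diffop.scale)
qed

lemma diffop_bound:
  "diffop A \<Longrightarrow> \<exists>C m. \<forall>f. schwartz f \<longrightarrow> (\<forall>x. norm x ^ N * norm (A f x) \<le> C * schwartz_seminorm m f)"
proof (induction arbitrary: N rule: diffop.induct)
  case (iter ks)
  have "norm x ^ N * norm (iter_partial ks f x) \<le> 1 * schwartz_seminorm (N + length ks) f" if "schwartz f" for f x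
    using schwartz_le_seminorm[OF that, of N "N + length ks" ks x] by simp
  then show ?case by blast
next
  case (add A B)
  have "\<exists>C m. \<forall>f. schwartz f \<longrightarrow> (\<forall>b\<in>UNIV. \<forall>x. norm x ^ N * norm ((if b then A else B) f x) \<le> C * schwartz_seminorm m f)"
    by (rule seminorm_bound_finite) (use add.IH in auto)
  then obtain C m where C: "\<forall>f. schwartz f \<longrightarrow> (\<forall>b\<in>UNIV. \<forall>x. norm x ^ N * norm ((if b then A else B) f x) \<le> C * schwartz_seminorm m f)"
    by blast
  have "norm x ^ N * norm (A f x + B f x) \<le> (2 * C) * schwartz_seminorm m f" if "schwartz f" for f x
  proof -
    have "norm x ^ N * norm (A f x + B f x) \<le> norm x ^ N * norm (A f x) + norm x ^ N * norm (B f x)"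
      unfolding distrib_left[symmetric] by (intro mult_left_mono norm_triangle_ineq) simp
    moreover have "norm x ^ N * norm (A f x) \<le> C * schwartz_seminorm m f" 
      and "norm x ^ N * norm (B f x) \<le> C * schwartz_seminorm m f"
      using C[rule_format, OF that UNIV_I, of x True] C[rule_format, OF that UNIV_I, of x False] by simp_all
    ultimately show ?thesis by simp
  qed
  then show ?case by blast
next
  case (scale A c)
  obtain C m where C: "\<forall>f. schwartz f \<longrightarrow> (\<forall>x. norm x ^ N * norm (A f x) \<le> C * schwartz_seminorm m f)"
    using scale.IH by blast
  have "norm x ^ N * norm (c * A f x) \<le> (norm c * C) * schwartz_seminorm m f" if "schwartz f" for f x
    using mult_left_mono[OF C[rule_format, OF that, of x] norm_ge_zero[of c]] by (simp add: norm_mult mult_ac)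
  then show ?case by blast
next
  case (mul A i)
  obtain C m where C: "\<forall>f. schwartz f \<longrightarrow> (\<forall>x. norm x ^ Suc N * norm (A f x) \<le> C * schwartz_seminorm m f)"
    using mul.IH by blast
  have "norm x ^ N * norm (complex_of_real (x $ i) * A f x) \<le> C * schwartz_seminorm m f" if "schwartz f" for f x
  proof -
    have "norm x ^ N * norm (complex_of_real (x $ i) * A f x) \<le> norm x ^ N * (norm x * norm (A f x))"
      by (intro mult_left_mono) (auto simp: norm_mult intro!: mult_right_mono component_le_norm_cart)
    also have "\<dots> \<le> C * schwartz_seminorm m f" using C that by (simp add: mult_ac)
    finally show ?thesis .
  qed
  then show ?case by blast
qed

text \<open>\<open>diffop\<close> is its own coinduction invariant. Other operators V are treated
  below with the invariant "V after a \<open>diffop\<close>", which leaves only the task of moving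
  coordinates and partial derivatives through V.\<close>

lemma diffop_schwartz_op: "diffop A \<Longrightarrow> schwartz_op A"
proof (rule schwartz_op_coinduct[where P=diffop])
  fix A :: "(real^'a \<Rightarrow> complex) \<Rightarrow> real^'a \<Rightarrow> complex" and i
  assume A: "diffop A"
  show "\<exists>C m. \<forall>f. schwartz f \<longrightarrow> (\<forall>x. norm (A f x) \<le> C * schwartz_seminorm m f)"
    using diffop_bound[OF A, of 0] by simp
  show "\<exists>A'. diffop A' \<and> (\<forall>f. schwartz f \<longrightarrow> A' f = (\<lambda>x. complex_of_real (x $ i) * A f x))"
    using diffop.mul[OF A] by blast
  show "\<exists>A'. diffop A' \<and> (\<forall>f x. schwartz f \<longrightarrow>
      ((\<lambda>t. A f (x + t *\<^sub>R axis i 1)) has_vector_derivative A' f x) (at 0))"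
    by (rule diffop_deriv[OF A])
qed

lemma diffop_schwartz: "diffop A \<Longrightarrow> schwartz f \<Longrightarrow> schwartz (A f)"
  using diffop_schwartz_op schwartz_op_def by blast

lemma schwartz_scale: "schwartz f \<Longrightarrow> schwartz (\<lambda>x. c * f x)"
  using diffop_schwartz[OF diffop.scale[OF diffop_id]] by blast

lemma schwartz_coord: "schwartz f \<Longrightarrow> schwartz (\<lambda>x. complex_of_real (x $ i) * f x)"
  using diffop_schwartz[OF diffop.mul[OF diffop_id]] by blast

lemma schwartz_bounded: "schwartz f \<Longrightarrow> \<exists>B. \<forall>x. norm (f x) \<le> B"
  using schwartz_le_seminorm[of f 0 0 "[]"] by auto

lemma schwartz_add:
  assumes "schwartz f" "schwartz g"
  shows "schwartz (\<lambda>x. f x + g x)"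
proof (rule schwartz_coinduct[where P="\<lambda>h. \<exists>f g. schwartz f \<and> schwartz g \<and> h = (\<lambda>x. f x + g x)"])
  fix h i assume "\<exists>f g. schwartz f \<and> schwartz g \<and> h = (\<lambda>x. f x + g x)"
  then obtain f g where fg: "schwartz f" "schwartz g" "h = (\<lambda>x. f x + g x)" by blast
  obtain B B' where "\<And>x. norm (f x) \<le> B" "\<And>x. norm (g x) \<le> B'"
    using fg schwartz_bounded by metis
  then have "norm (h x) \<le> B + B'" for x
    unfolding fg(3) using norm_triangle_mono by blast
  then show "\<exists>B. \<forall>x. norm (h x) \<le> B" by blast
  show "\<exists>f g. schwartz f \<and> schwartz g \<and> (\<lambda>x. complex_of_real (x $ i) * h x) = (\<lambda>x. f x + g x)"
    using schwartz_coord[OF fg(1), of i] schwartz_coord[OF fg(2), of i]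
    by (intro exI[of _ "\<lambda>x. complex_of_real (x $ i) * f x"] exI[of _ "\<lambda>x. complex_of_real (x $ i) * g x"])
      (simp add: fg(3) distrib_left)
  show "\<exists>f'. (\<exists>f g. schwartz f \<and> schwartz g \<and> f' = (\<lambda>x. f x + g x)) \<and>
      (\<forall>x. ((\<lambda>t. h (x + t *\<^sub>R axis i 1)) has_vector_derivative f' x) (at 0))"
    unfolding fg(3)
    by (intro exI[of _ "\<lambda>x. partial_dir i f x + partial_dir i g x"] exI[of _ "partial_dir i f"]
        exI[of _ "partial_dir i g"] conjI allI refl schwartz_partial has_vector_derivative_add schwartz_deriv fg(1,2))
qed (use assms in blast)

lemma schwartz_zero: "schwartz (f :: real^'m::finite \<Rightarrow> complex) \<Longrightarrow> schwartz (\<lambda>x::real^'m. 0)"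
  using schwartz_scale[of f 0] by simp

lemma schwartz_sum:
  assumes "finite I" "I \<noteq> {}" "\<And>i. i \<in> I \<Longrightarrow> schwartz (f i)"
  shows "schwartz (\<lambda>x. \<Sum>i\<in>I. f i x)"
  using assms by (induction I rule: finite_ne_induct) (auto intro: schwartz_add)

lemma schwartz_op_cnj: "schwartz_op (\<lambda>f x. cnj (f x))"
proof (rule schwartz_op_coinduct[where P="\<lambda>A. \<exists>B. diffop B \<and> A = (\<lambda>f x. cnj (B f x))"])
  fix A i assume "\<exists>B. diffop B \<and> A = (\<lambda>f (x::real^'a). cnj (B f x))"
  then obtain B where B: "diffop B" "A = (\<lambda>f x. cnj (B f x))" by blast
  show "\<exists>C m. \<forall>f. schwartz f \<longrightarrow> (\<forall>x. norm (A f x) \<le> C * schwartz_seminorm m f)"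
    using diffop_bound[OF B(1), of 0] by (simp add: B(2))
  show "\<exists>A'. (\<exists>B. diffop B \<and> A' = (\<lambda>f x. cnj (B f x))) \<and>
      (\<forall>f. schwartz f \<longrightarrow> A' f = (\<lambda>x. complex_of_real (x $ i) * A f x))"
    by (intro exI[of _ "\<lambda>f x. cnj (complex_of_real (x $ i) * B f x)"] conjI exI[of _ "\<lambda>f x. complex_of_real (x $ i) * B f x"])
      (auto simp: B(2) intro: diffop.mul B(1))
  obtain B' where "diffop B'" "\<And>f x. schwartz f \<Longrightarrow>
      ((\<lambda>t. B f (x + t *\<^sub>R axis i 1)) has_vector_derivative B' f x) (at 0)"
    using diffop_deriv[OF B(1)] by metis
  then show "\<exists>A'. (\<exists>B. diffop B \<and> A' = (\<lambda>f x. cnj (B f x))) \<and>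
      (\<forall>f x. schwartz f \<longrightarrow> ((\<lambda>t. A f (x + t *\<^sub>R axis i 1)) has_vector_derivative A' f x) (at 0))"
    unfolding B(2) by (intro exI[of _ "\<lambda>f x. cnj (B' f x)"]) (auto intro: has_vector_derivative_cnj)
qed (use diffop_id in blast)

lemma schwartz_cnj: "schwartz f \<Longrightarrow> schwartz (\<lambda>x. cnj (f x))"
  using schwartz_op_cnj unfolding schwartz_op_def by blast

section \<open>Directional derivatives and symmetry of mixed partial derivatives\<close>

lemma taylor_collect_aux:
  fixes t :: real
  shows "L * (t * c)\<^sup>2 + K * t\<^sup>2 + \<bar>t * c\<bar> * (L * N * (\<bar>t\<bar> * v)) = (L * c\<^sup>2 + K + \<bar>c\<bar> * (L * N * v)) * t\<^sup>2"
  by (cases "t \<ge> 0"; simp add: abs_mult power_mult_distrib power2_eq_square algebra_simps)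

text \<open>Only derivatives along the axes are given, so the coordinates of c are added one at a
  time, with a quadratic remainder kept at every stage.\<close>

lemma schwartz_directional:
  assumes f: "schwartz (f :: real^'m::finite \<Rightarrow> complex)"
  shows "((\<lambda>t. f (x + t *\<^sub>R c)) has_vector_derivative (\<Sum>i\<in>UNIV. (c $ i) *\<^sub>R partial_dir i f x)) (at 0)"
proof -
  have "\<exists>K. \<forall>t. norm (f (x + t *\<^sub>R (\<Sum>i\<in>A. (c $ i) *\<^sub>R axis i 1)) - f x - t *\<^sub>R (\<Sum>i\<in>A. (c $ i) *\<^sub>R partial_dir i f x)) \<le> K * t\<^sup>2"
    if "finite A" for A
    using that
  proof induction
    case (insert j A)
    then obtain K where K: "\<And>t. norm (f (x + t *\<^sub>R (\<Sum>i\<in>A. (c $ i) *\<^sub>R axis i 1)) - f x - t *\<^sub>R (\<Sum>i\<in>A. (c $ i) *\<^sub>R partial_dir i f x)) \<le> K * t\<^sup>2"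
      by blast
    let ?v = "(\<Sum>i\<in>A. (c $ i) *\<^sub>R axis i 1) :: real^'m"
    have d2: "schwartz (partial_dir j f)" by (rule schwartz_partial[OF f])
    define L where "L = schwartz_seminorm 2 f"
    have L: "norm (partial_dir i (partial_dir j f) y) \<le> L" for i y
      using schwartz_le_seminorm[OF f, of 0 2 "[i, j]" y] by (simp add: L_def)
    have lip: "norm (partial_dir j f y - partial_dir j f z) \<le> L * real CARD('m) * norm (y - z)" for y z
      by (rule lipschitz_from_partials[OF schwartz_deriv[OF d2] L])
    have tay: "norm (f (y + t *\<^sub>R axis j 1) - f y - t *\<^sub>R partial_dir j f y) \<le> L * t\<^sup>2" for y t
      by (rule taylor_axis[OF schwartz_deriv[OF f] schwartz_deriv[OF d2] L])
    have "norm (f (x + t *\<^sub>R (\<Sum>i\<in>insert j A. (c $ i) *\<^sub>R axis i 1)) - f x - t *\<^sub>R (\<Sum>i\<in>insert j A. (c $ i) *\<^sub>R partial_dir i f x))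
       \<le> (L * (c $ j)\<^sup>2 + K + \<bar>c $ j\<bar> * (L * real CARD('m) * norm ?v)) * t\<^sup>2" for t
    proof -
      let ?y = "x + t *\<^sub>R ?v"
      \<comment> \<open>Three errors: the Taylor remainder along the new axis at the displaced point
        \<open>?y\<close>, the remainder of the earlier directions, and the change of the partial
        derivative between x and \<open>?y\<close>.\<close>
      have eq: "f (x + t *\<^sub>R (\<Sum>i\<in>insert j A. (c $ i) *\<^sub>R axis i 1)) - f x - t *\<^sub>R (\<Sum>i\<in>insert j A. (c $ i) *\<^sub>R partial_dir i f x)
        = (f (?y + (t * c $ j) *\<^sub>R axis j 1) - f ?y - (t * c $ j) *\<^sub>R partial_dir j f ?y)
          + (f ?y - f x - t *\<^sub>R (\<Sum>i\<in>A. (c $ i) *\<^sub>R partial_dir i f x))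
          + (t * c $ j) *\<^sub>R (partial_dir j f ?y - partial_dir j f x)"
        using insert.hyps by (simp add: algebra_simps)
      have "norm ((f (?y + (t * c $ j) *\<^sub>R axis j 1) - f ?y - (t * c $ j) *\<^sub>R partial_dir j f ?y)
          + (f ?y - f x - t *\<^sub>R (\<Sum>i\<in>A. (c $ i) *\<^sub>R partial_dir i f x))
          + (t * c $ j) *\<^sub>R (partial_dir j f ?y - partial_dir j f x)) \<le> L * (t * c $ j)\<^sup>2 + K * t\<^sup>2 + \<bar>t * c $ j\<bar> * (L * real CARD('m) * norm (?y - x))"
        by (rule norm_triangle_mono[OF norm_triangle_mono[OF tay K]])
          (unfold norm_scaleR, rule mult_left_mono[OF lip abs_ge_zero])
      also have "\<dots> = (L * (c $ j)\<^sup>2 + K + \<bar>c $ j\<bar> * (L * real CARD('m) * norm ?v)) * t\<^sup>2"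
        unfolding add_diff_cancel_left' norm_scaleR by (fact taylor_collect_aux[of L t "c $ j" K "real CARD('m)" "norm ?v"])
      finally show ?thesis unfolding eq .
    qed
    then show ?case by blast
  qed (auto intro!: exI[of _ 0])
  from this[of UNIV] obtain K where
    K: "\<And>t. norm (f (x + t *\<^sub>R (\<Sum>i\<in>UNIV. (c $ i) *\<^sub>R axis i 1)) - f x - t *\<^sub>R (\<Sum>i\<in>UNIV. (c $ i) *\<^sub>R partial_dir i f x)) \<le> K * t\<^sup>2"
    by auto
  show ?thesis
    by (rule has_vector_derivative_from_quadratic[where K=K])
      (use K in \<open>simp only: vec_eq_sum_axis[of c, symmetric] scaleR_zero_left add_0_right\<close>)
qed

text \<open>The second difference over a square of side t is symmetric in i and j. Divided by t^2 it
  approximates each of the two mixed derivatives with an error of order t, controlled by the third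
  derivatives.\<close>

lemma schwartz_partial_commute:
  assumes f: "schwartz (f :: real^'m::finite \<Rightarrow> complex)"
  shows "partial_dir i (partial_dir j f) = partial_dir j (partial_dir i f)"
proof
  fix x
  define \<Delta> where "\<Delta> i j t = f (x + t *\<^sub>R axis i 1 + t *\<^sub>R axis j 1) - f (x + t *\<^sub>R axis i 1) - f (x + t *\<^sub>R axis j 1) + f x"
    for i j and t :: real
  have main: "\<exists>K. \<forall>t. norm (\<Delta> i j t - (t * t) *\<^sub>R partial_dir i (partial_dir j f) x) \<le> K * \<bar>t\<bar> ^ 3" for i j
  proof -
    note f1 = schwartz_partial[OF f, of j]
    note f2 = schwartz_partial[OF f1, of i]
    define L where "L = schwartz_seminorm 3 f"
    have L: "norm (partial_dir k (partial_dir i (partial_dir j f)) y) \<le> L" for k y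
      using schwartz_le_seminorm[OF f, of 0 3 "[k, i, j]" y] by (simp add: L_def)
    have L0: "0 \<le> L" using order_trans[OF norm_ge_zero L] .
    let ?D = "partial_dir i (partial_dir j f)"
    have lip: "norm (?D (x + s *\<^sub>R axis j 1) - ?D x) \<le> L * real CARD('m) * \<bar>s\<bar>" for s
      using lipschitz_from_partials[OF schwartz_deriv[OF f2] L, of "x + s *\<^sub>R axis j 1" x] by simp
    have tay: "norm (partial_dir j f (y + t *\<^sub>R axis i 1) - partial_dir j f y - t *\<^sub>R ?D y) \<le> L * t\<^sup>2" for y t
      by (rule taylor_axis[OF schwartz_deriv[OF f1] schwartz_deriv[OF f2] L])
    have "norm (\<Delta> i j t - (t * t) *\<^sub>R ?D x) \<le> (L + L * real CARD('m)) * \<bar>t\<bar> ^ 3" for t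
    proof -
      \<comment> \<open>The increment of \<open>g\<close> from 0 to t is the second difference minus
        its main term, so a bound on the derivative of \<open>g\<close> in s is enough.\<close>
      define g where "g s = f (x + t *\<^sub>R axis i 1 + s *\<^sub>R axis j 1) - f (x + s *\<^sub>R axis j 1) - s *\<^sub>R (t *\<^sub>R ?D x)" for s
      have "norm (g t - g 0) \<le> (L * t\<^sup>2 + \<bar>t\<bar> * (L * real CARD('m) * \<bar>t\<bar>)) * \<bar>t\<bar>"
      proof (rule vector_derivative_bound[where g=g and t=t and
            g'="\<lambda>s. partial_dir j f (x + t *\<^sub>R axis i 1 + s *\<^sub>R axis j 1) - partial_dir j f (x + s *\<^sub>R axis j 1) - t *\<^sub>R ?D x"])
        fix s assume s: "\<bar>s\<bar> \<le> \<bar>t\<bar>"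
        let ?y = "x + s *\<^sub>R axis j 1"
        show "(g has_vector_derivative partial_dir j f (x + t *\<^sub>R axis i 1 + s *\<^sub>R axis j 1) - partial_dir j f ?y - t *\<^sub>R ?D x) (at s)"
          unfolding g_def
          by (rule has_vector_derivative_diff[OF has_vector_derivative_diff[OF
              has_vector_derivative_shift_axis[OF schwartz_deriv[OF f], of "x + t *\<^sub>R axis i 1" j s]
              has_vector_derivative_shift_axis[OF schwartz_deriv[OF f], of x j s]]
              has_vector_derivative_line[of "t *\<^sub>R ?D x" s]])
        have eq: "partial_dir j f (x + t *\<^sub>R axis i 1 + s *\<^sub>R axis j 1) - partial_dir j f ?y - t *\<^sub>R ?D x
          = (partial_dir j f (?y + t *\<^sub>R axis i 1) - partial_dir j f ?y - t *\<^sub>R ?D ?y) + t *\<^sub>R (?D ?y - ?D x)"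
          by (simp add: scaleR_diff_right add_ac)
        have "norm ((partial_dir j f (?y + t *\<^sub>R axis i 1) - partial_dir j f ?y - t *\<^sub>R ?D ?y) + t *\<^sub>R (?D ?y - ?D x)) \<le> L * t\<^sup>2 + \<bar>t\<bar> * (L * real CARD('m) * \<bar>s\<bar>)"
          by (rule norm_triangle_mono[OF tay]) (unfold norm_scaleR, rule mult_left_mono[OF lip abs_ge_zero])
        also have "\<dots> \<le> L * t\<^sup>2 + \<bar>t\<bar> * (L * real CARD('m) * \<bar>t\<bar>)"
          using s L0 by (intro add_left_mono mult_left_mono) auto
        finally show "norm (partial_dir j f (x + t *\<^sub>R axis i 1 + s *\<^sub>R axis j 1) - partial_dir j f ?y - t *\<^sub>R ?D x) \<le> \<dots>" unfolding eq .
      qed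
      also have "\<dots> = (L + L * real CARD('m)) * \<bar>t\<bar> ^ 3"
        by (cases "t \<ge> 0"; simp add: power2_eq_square power3_eq_cube algebra_simps)
      also have "g t - g 0 = \<Delta> i j t - (t * t) *\<^sub>R ?D x" by (simp add: g_def \<Delta>_def)
      finally show ?thesis .
    qed
    then show ?thesis by blast
  qed
  obtain K K' where K: "\<And>t. norm (\<Delta> i j t - (t * t) *\<^sub>R partial_dir i (partial_dir j f) x) \<le> K * \<bar>t\<bar> ^ 3"
    and K': "\<And>t. norm (\<Delta> j i t - (t * t) *\<^sub>R partial_dir j (partial_dir i f) x) \<le> K' * \<bar>t\<bar> ^ 3"
    using main[of i j] main[of j i] by blast
  let ?d = "partial_dir i (partial_dir j f) x - partial_dir j (partial_dir i f) x"
  have sym: "\<Delta> i j t = \<Delta> j i t" for t by (simp add: \<Delta>_def algebra_simps)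
  have bd: "norm ?d \<le> (K + K') * t" if t: "0 < t" for t
  proof -
    have "norm ((t * t) *\<^sub>R ?d) = norm ((\<Delta> j i t - (t * t) *\<^sub>R partial_dir j (partial_dir i f) x) - (\<Delta> i j t - (t * t) *\<^sub>R partial_dir i (partial_dir j f) x))"
      by (simp add: sym algebra_simps)
    also have "\<dots> \<le> K' * \<bar>t\<bar> ^ 3 + K * \<bar>t\<bar> ^ 3"
      by (rule order_trans[OF norm_triangle_ineq4 add_mono[OF K' K]])
    finally have "(t * t) * norm ?d \<le> (t * t) * ((K + K') * t)"
      using t unfolding norm_scaleR by (simp add: power3_eq_cube distrib_left distrib_right mult_ac add_ac)
    then show ?thesis using t by (simp add: mult_le_cancel_left)
  qed
  have "((\<lambda>t. (K + K') * t) \<longlongrightarrow> 0) (at_right (0::real))"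
    by (auto intro!: tendsto_eq_intros)
  moreover have "\<forall>\<^sub>F t in at_right (0::real). norm ?d \<le> (K + K') * t"
    using bd by (auto simp: eventually_at_right_field intro!: exI[of _ 1])
  ultimately have "norm ?d \<le> 0"
    by (rule tendsto_lowerbound) simp
  then show "partial_dir i (partial_dir j f) x = partial_dir j (partial_dir i f) x" by simp
qed

lemma iter_partial_commute:
  "schwartz f \<Longrightarrow> iter_partial ks (partial_dir i f) = partial_dir i (iter_partial ks f)"
  by (induction ks) (auto simp: schwartz_partial_commute[OF schwartz_iter])

lemma iter_partial_lincomb:
  assumes "schwartz f" "schwartz g"
  shows "iter_partial ks (\<lambda>x. c * f x + d * g x) = (\<lambda>x. c * iter_partial ks f x + d * iter_partial ks g x)"
proof (induction ks)
  case (Cons i ks)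
  show ?case
    unfolding iter_partial.simps Cons
    by (rule partial_dir_eqI) (intro has_vector_derivative_add has_vector_derivative_mult_right
      schwartz_deriv schwartz_iter assms)
qed simp

subsection \<open>Substitutions and products\<close>

lemma diffop_partial:
  "diffop A \<Longrightarrow> \<exists>A'. diffop A' \<and> (\<forall>f. schwartz f \<longrightarrow> partial_dir j (A f) = A' f)"
  using diffop_deriv[of A j] partial_dir_eqI by metis

text \<open>Injectivity preserves decay: with a left inverse g of l, each coordinate of x is an
  affine function of l x + b, so multiplying by it amounts to a \<open>diffop\<close> in the inner
  variable. The dimensions may differ, which covers restriction to a slice and to the
  diagonal.\<close>

lemma schwartz_op_affine:
  fixes l :: "real^'m::finite \<Rightarrow> real^'k::finite"
  assumes "linear l" "inj l"
  shows "schwartz_op (\<lambda>f x. f (l x + b))"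
proof -
  obtain g where g: "linear g" "g \<circ> l = id"
    using linear_injective_left_inverse[OF assms] by blast
  have "schwartz_op (\<lambda>f x. (\<lambda>f. f) f (l x + b))"
  proof (rule schwartz_op_coinduct[where P="\<lambda>A. \<exists>B. diffop B \<and> A = (\<lambda>f x. B f (l x + b))"])
    fix A i assume "\<exists>B. diffop B \<and> A = (\<lambda>f x. B f (l x + b))"
    then obtain B where B: "diffop B" "A = (\<lambda>f x. B f (l x + b))" by blast
    show "\<exists>C m. \<forall>f. schwartz f \<longrightarrow> (\<forall>x. norm (A f x) \<le> C * schwartz_seminorm m f)"
      using diffop_bound[OF B(1), of 0] unfolding B(2) by fastforce
    have coord: "x $ i = - g b $ i + (\<Sum>j\<in>UNIV. g (axis j 1) $ i * (l x + b) $ j)" for x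
    proof -
      have "(\<Sum>j\<in>UNIV. g (axis j 1) $ i * (l x + b) $ j) = (\<Sum>j\<in>UNIV. ((l x + b) $ j) *\<^sub>R g (axis j 1)) $ i"
        by (simp add: sum_component mult.commute)
      also have "(\<Sum>j\<in>UNIV. ((l x + b) $ j) *\<^sub>R g (axis j 1)) = g (\<Sum>j\<in>UNIV. ((l x + b) $ j) *\<^sub>R axis j 1)"
        by (simp add: linear_sum[OF g(1)] linear_scale[OF g(1)])
      also have "\<dots> = g (l x + b)" by (subst vec_eq_sum_axis[symmetric]) simp
      also have "\<dots> = x + g b" using linear_add[OF g(1), of "l x" b] g(2) by (metis comp_apply id_apply)
      finally show ?thesis by simp
    qed
    define B' where "B' = (\<lambda>f y. complex_of_real (- g b $ i) * B f y +
        (\<Sum>j\<in>UNIV. complex_of_real (g (axis j 1) $ i) * (complex_of_real (y $ j) * B f y)))"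
    have "diffop B'"
      unfolding B'_def by (intro diffop.add diffop.scale diffop_sum diffop.mul B(1)) simp
    moreover have "B' f (l x + b) = complex_of_real (x $ i) * A f x" for f x
      unfolding B'_def B(2) coord[of x] by (simp add: distrib_left distrib_right left_diff_distrib sum_distrib_right mult.assoc)
    ultimately show "\<exists>A'. (\<exists>B. diffop B \<and> A' = (\<lambda>f x. B f (l x + b))) \<and>
        (\<forall>f. schwartz f \<longrightarrow> A' f = (\<lambda>x. complex_of_real (x $ i) * A f x))"
      by (intro exI[of _ "\<lambda>f x. B' f (l x + b)"]) auto
    obtain D where D: "\<And>j. diffop (D j)" "\<And>j f. schwartz f \<Longrightarrow> partial_dir j (B f) = D j f"
      using diffop_partial[OF B(1)] by metis
    define B'' where "B'' = (\<lambda>f y. (\<Sum>j\<in>UNIV. complex_of_real (l (axis i 1) $ j) * D j f y))"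
    have "diffop B''"
      unfolding B''_def by (intro diffop_sum diffop.scale D(1)) simp
    moreover have "((\<lambda>t. A f (x + t *\<^sub>R axis i 1)) has_vector_derivative B'' f (l x + b)) (at 0)" if f: "schwartz f" for f x
    proof -
      have "A f (x + t *\<^sub>R axis i 1) = B f (l x + b + t *\<^sub>R l (axis i 1))" for t
        unfolding B(2) by (simp add: linear_add[OF assms(1)] linear_scale[OF assms(1)] add_ac)
      then show ?thesis
        using schwartz_directional[OF diffop_schwartz[OF B(1) f], of "l x + b" "l (axis i 1)"]
        by (simp add: B''_def D(2)[OF f] scaleR_conv_of_real)
    qed
    ultimately show "\<exists>A'. (\<exists>B. diffop B \<and> A' = (\<lambda>f x. B f (l x + b))) \<and> (\<forall>f x. schwartz f \<longrightarrow>
        ((\<lambda>t. A f (x + t *\<^sub>R axis i 1)) has_vector_derivative A' f x) (at 0))"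
      by (intro exI[of _ "\<lambda>f x. B'' f (l x + b)"]) auto
  qed (use diffop_id in blast)
  then show ?thesis .
qed

lemma schwartz_affine:
  fixes l :: "real^'m::finite \<Rightarrow> real^'k::finite"
  shows "linear l \<Longrightarrow> inj l \<Longrightarrow> schwartz f \<Longrightarrow> schwartz (\<lambda>x. f (l x + b))"
  using schwartz_op_affine[of l b] unfolding schwartz_op_def by blast

lemma schwartz_linear:
  fixes l :: "real^'m::finite \<Rightarrow> real^'k::finite"
  shows "linear l \<Longrightarrow> inj l \<Longrightarrow> schwartz f \<Longrightarrow> schwartz (\<lambda>x. f (l x))"
  using schwartz_affine[of l f 0] by simp

lemma inj_matrix_vector: "invertible A \<Longrightarrow> inj (\<lambda>x. A *v (x :: real^'m::finite))" for A :: "real^'m^'m"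
  by (simp add: invertible_left_inverse matrix_left_invertible_injective)

lemma schwartz_op_matrix: "invertible A \<Longrightarrow> schwartz_op (\<lambda>f x. f (A *v (x :: real^'m::finite)))" for A :: "real^'m^'m"
  using schwartz_op_affine[of "\<lambda>x. A *v x" 0] inj_matrix_vector[of A] by simp

text \<open>The derivatives of q are affine, so differentiating the unimodular factor only brings
  down a polynomial of degree one, which the \<open>diffop\<close> absorbs. Linear characters,
  chirps and the Fourier kernel in both variables are instances.\<close>

lemma schwartz_op_chirp:
  fixes q :: "real^'m::finite \<Rightarrow> real"
  assumes q: "\<And>x i. ((\<lambda>t. q (x + t *\<^sub>R axis i 1)) has_real_derivative \<kappa> i + (\<Sum>j\<in>UNIV. \<Lambda> i j * x $ j)) (at 0)"
  shows "schwartz_op (\<lambda>f x. exp (\<i> * complex_of_real (q x)) * f x)"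
proof -
  define e where "e x = exp (\<i> * complex_of_real (q x))" for x
  have ne: "norm (e x) = 1" for x by (simp add: e_def)
  have "schwartz_op (\<lambda>f x. e x * (\<lambda>f. f) f x)"
  proof (rule schwartz_op_coinduct[where P="\<lambda>A. \<exists>B. diffop B \<and> A = (\<lambda>f x. e x * B f x)"])
    fix A i assume "\<exists>B. diffop B \<and> A = (\<lambda>f x. e x * B f x)"
    then obtain B where B: "diffop B" "A = (\<lambda>f x. e x * B f x)" by blast
    show "\<exists>C m. \<forall>f. schwartz f \<longrightarrow> (\<forall>x. norm (A f x) \<le> C * schwartz_seminorm m f)"
      using diffop_bound[OF B(1), of 0] by (simp add: B(2) norm_mult ne)
    show "\<exists>A'. (\<exists>B. diffop B \<and> A' = (\<lambda>f x. e x * B f x)) \<and>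
        (\<forall>f. schwartz f \<longrightarrow> A' f = (\<lambda>x. complex_of_real (x $ i) * A f x))"
      using diffop.mul[OF B(1), of i]
      by (intro exI[of _ "\<lambda>f x. e x * (complex_of_real (x $ i) * B f x)"]) (auto simp: B(2) mult_ac)
    obtain D where D: "diffop D"
      "\<And>f x. schwartz f \<Longrightarrow> ((\<lambda>t. B f (x + t *\<^sub>R axis i 1)) has_vector_derivative D f x) (at 0)"
      using diffop_deriv[OF B(1)] by metis
    define B' where "B' = (\<lambda>f y. D f y + (\<i> * complex_of_real (\<kappa> i)) * B f y + \<i> * (\<Sum>j\<in>UNIV. complex_of_real (\<Lambda> i j) * (complex_of_real (y $ j) * B f y)))"
    have "diffop B'"
      unfolding B'_def by (intro diffop.add diffop.scale diffop_sum diffop.mul B(1) D(1)) simp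
    moreover have "((\<lambda>t. A f (x + t *\<^sub>R axis i 1)) has_vector_derivative e x * B' f x) (at 0)" if f: "schwartz f" for f x
    proof -
      define s where "s = \<kappa> i + (\<Sum>j\<in>UNIV. \<Lambda> i j * x $ j)"
      have "((\<lambda>t. \<i> * complex_of_real (q (x + t *\<^sub>R axis i 1))) has_vector_derivative \<i> * complex_of_real s) (at 0)"
        using q[of x i] unfolding s_def
        by (intro has_vector_derivative_mult_right has_vector_derivative_of_real)
          (simp add: has_real_derivative_iff_has_vector_derivative)
      then have "(exp \<circ> (\<lambda>t. \<i> * complex_of_real (q (x + t *\<^sub>R axis i 1))) has_vector_derivative
          (\<i> * complex_of_real s) * exp (\<i> * complex_of_real (q (x + 0 *\<^sub>R axis i 1)))) (at 0)"
        by (rule field_vector_diff_chain_at) (rule DERIV_exp)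
      then have "((\<lambda>t. e (x + t *\<^sub>R axis i 1)) has_vector_derivative \<i> * complex_of_real s * e x) (at 0)"
        by (simp add: o_def e_def)
      from has_vector_derivative_mult[OF this D(2)[OF f, of x]]
      have "((\<lambda>t. A f (x + t *\<^sub>R axis i 1)) has_vector_derivative e x * D f x + \<i> * complex_of_real s * e x * B f x) (at 0)"
        by (simp add: B(2))
      moreover have "e x * D f x + \<i> * complex_of_real s * e x * B f x = e x * B' f x"
        by (simp add: B'_def s_def sum_distrib_right sum_distrib_left algebra_simps)
      ultimately show ?thesis by simp
    qed
    ultimately show "\<exists>A'. (\<exists>B. diffop B \<and> A' = (\<lambda>f x. e x * B f x)) \<and> (\<forall>f x. schwartz f \<longrightarrow>
        ((\<lambda>t. A f (x + t *\<^sub>R axis i 1)) has_vector_derivative A' f x) (at 0))"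
      by (intro exI[of _ "\<lambda>f x. e x * B' f x"]) auto
  qed (use diffop_id in blast)
  then show ?thesis by (simp add: e_def)
qed

subsection \<open>Phase space coordinates\<close>

lemma pvec_nth [simp]: "pvec x p $ Inl i = x $ i" "pvec x p $ Inr i = p $ i"
  by (simp_all add: pvec_def)

lemma xpart_nth [simp]: "xpart z $ i = z $ Inl i" by (simp add: xpart_def)
lemma ppart_nth [simp]: "ppart z $ i = z $ Inr i" by (simp add: ppart_def)

lemma vec_sum_eq_iff: "(z :: real^('n::finite + 'n)) = w \<longleftrightarrow> (\<forall>i. z $ Inl i = w $ Inl i) \<and> (\<forall>i. z $ Inr i = w $ Inr i)"
  by (metis sum.exhaust vec_eq_iff)

lemma xpart_pvec [simp]: "xpart (pvec x p) = x" by (simp add: vec_eq_iff)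
lemma ppart_pvec [simp]: "ppart (pvec x p) = p" by (simp add: vec_eq_iff)
lemma pvec_parts [simp]: "pvec (xpart z) (ppart z) = z" by (simp add: vec_sum_eq_iff)

lemma pvec_eq_iff [simp]: "pvec x p = pvec x' p' \<longleftrightarrow> x = x' \<and> p = p'"
  by (auto simp: vec_sum_eq_iff vec_eq_iff)

lemma pvec_add: "pvec x p + pvec x' p' = pvec (x + x') (p + p')" by (simp add: vec_sum_eq_iff)
lemma pvec_scaleR: "c *\<^sub>R pvec x p = pvec (c *\<^sub>R x) (c *\<^sub>R p)" by (simp add: vec_sum_eq_iff)
lemma axis_Inl: "axis (Inl i) 1 = pvec (axis i 1) 0" by (simp add: vec_sum_eq_iff axis_def)
lemma axis_Inr: "axis (Inr i) 1 = pvec 0 (axis i 1)" by (simp add: vec_sum_eq_iff axis_def)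

lemma pvec_axis_Inl: "pvec u v + t *\<^sub>R axis (Inl i) 1 = pvec (u + t *\<^sub>R axis i 1) v"
  by (simp add: axis_Inl pvec_scaleR pvec_add)
lemma pvec_axis_Inr: "pvec u v + t *\<^sub>R axis (Inr i) 1 = pvec u (v + t *\<^sub>R axis i 1)"
  by (simp add: axis_Inr pvec_scaleR pvec_add)

lemma parts_add: "xpart (z + w) = xpart z + xpart w" "ppart (z + w) = ppart z + ppart w"
  by (simp_all add: vec_eq_iff)
lemma parts_diff: "xpart (z - w) = xpart z - xpart w" "ppart (z - w) = ppart z - ppart w"
  by (simp_all add: vec_eq_iff)
lemma parts_scaleR: "xpart (c *\<^sub>R z) = c *\<^sub>R xpart z" "ppart (c *\<^sub>R z) = c *\<^sub>R ppart z"
  by (simp_all add: vec_eq_iff)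
lemma parts_axis: "xpart (axis (Inl i) 1) = axis i 1" "ppart (axis (Inl i) 1) = 0"
  "xpart (axis (Inr i) 1) = 0" "ppart (axis (Inr i) 1) = axis i 1"
  by (simp_all add: axis_Inl axis_Inr)

lemma sum_UNIV_sum: "(\<Sum>k\<in>(UNIV::('n::finite + 'n) set). f k) = (\<Sum>i\<in>UNIV. f (Inl i)) + (\<Sum>i\<in>UNIV. f (Inr i))"
  unfolding UNIV_Plus_UNIV[symmetric] by (subst sum.Plus) auto

lemma inner_pvec: "pvec a b \<bullet> pvec c d = a \<bullet> c + b \<bullet> d"
  by (simp add: inner_vec_def sum_UNIV_sum)

lemma inner_parts: "z \<bullet> w = xpart z \<bullet> xpart w + ppart z \<bullet> ppart w"
  by (simp add: inner_vec_def sum_UNIV_sum)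

lemma norm_le_norm_pvec: "norm u \<le> norm (pvec u v)" "norm v \<le> norm (pvec u v)"
  by (simp_all add: norm_eq_sqrt_inner inner_pvec)

lemma schwartz_tensor:
  fixes f g :: "real^'n::finite \<Rightarrow> complex"
  assumes "schwartz f" "schwartz g"
  shows "schwartz (\<lambda>z. f (xpart z) * g (ppart z))"
proof (rule schwartz_coinduct[where P="\<lambda>h. \<exists>f g. schwartz f \<and> schwartz g \<and> h = (\<lambda>z. f (xpart z) * g (ppart z))"])
  fix h :: "real^('n + 'n) \<Rightarrow> complex" and k :: "'n + 'n" assume "\<exists>f g. schwartz f \<and> schwartz g \<and> h = (\<lambda>z. f (xpart z) * g (ppart z))"
  then obtain f g where fg: "schwartz f" "schwartz g" "h = (\<lambda>z. f (xpart z) * g (ppart z))" by blast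
  obtain B B' where B: "\<And>x. norm (f x) \<le> B" "\<And>x. norm (g x) \<le> B'"
    using fg schwartz_bounded by metis
  have "norm (h x) \<le> B * B'" for x
    unfolding fg(3) norm_mult by (intro mult_mono B norm_ge_zero order_trans[OF norm_ge_zero B(1)])
  then show "\<exists>B. \<forall>x. norm (h x) \<le> B" by blast
  show "\<exists>f g. schwartz f \<and> schwartz g \<and> (\<lambda>x. complex_of_real (x $ k) * h x) = (\<lambda>z. f (xpart z) * g (ppart z))"
  proof (cases k)
    case (Inl i)
    show ?thesis
      by (rule exI[of _ "\<lambda>x. complex_of_real (x $ i) * f x"], rule exI[of _ g])
        (use schwartz_coord[OF fg(1), of i] fg(2) in \<open>simp add: fg(3) Inl mult.assoc\<close>)
  next
    case (Inr i)
    show ?thesis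
      by (rule exI[of _ f], rule exI[of _ "\<lambda>x. complex_of_real (x $ i) * g x"])
        (use schwartz_coord[OF fg(2), of i] fg(1) in \<open>simp add: fg(3) Inr mult_ac\<close>)
  qed
  show "\<exists>f'. (\<exists>f g. schwartz f \<and> schwartz g \<and> f' = (\<lambda>z. f (xpart z) * g (ppart z))) \<and>
      (\<forall>x. ((\<lambda>t. h (x + t *\<^sub>R axis k 1)) has_vector_derivative f' x) (at 0))"
  proof (cases k)
    case (Inl i)
    have "((\<lambda>t. h (x + t *\<^sub>R axis k 1)) has_vector_derivative partial_dir i f (xpart x) * g (ppart x)) (at 0)" for x
      using has_vector_derivative_mult_left[OF schwartz_deriv[OF fg(1), of "xpart x" i], of "g (ppart x)"]
      by (simp add: fg(3) Inl parts_add parts_scaleR parts_axis)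
    with schwartz_partial[OF fg(1)] fg(2) show ?thesis by blast
  next
    case (Inr i)
    have "((\<lambda>t. h (x + t *\<^sub>R axis k 1)) has_vector_derivative f (xpart x) * partial_dir i g (ppart x)) (at 0)" for x
      using has_vector_derivative_mult_right[OF schwartz_deriv[OF fg(2), of "ppart x" i], of "f (xpart x)"]
      by (simp add: fg(3) Inr parts_add parts_scaleR parts_axis)
    with schwartz_partial[OF fg(2)] fg(1) show ?thesis by blast
  qed
qed (use assms in blast)

text \<open>A product of two functions is the restriction of their tensor product to the
  diagonal.\<close>

lemma schwartz_mult:
  assumes "schwartz f" "schwartz g"
  shows "schwartz (\<lambda>x. f x * g x)"
proof -
  have "linear (\<lambda>x::real^'a. pvec x x)"
    by (rule linearI) (simp_all add: pvec_add pvec_scaleR)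
  moreover have "inj (\<lambda>x::real^'a. pvec x x)" by (rule injI) simp
  ultimately show ?thesis
    using schwartz_linear[OF _ _ schwartz_tensor[OF assms], of "\<lambda>x. pvec x x"] by simp
qed

section \<open>Polynomials times Gaussians\<close>

inductive gauss_poly :: "real \<Rightarrow> (real^'m::finite \<Rightarrow> complex) \<Rightarrow> bool" for c where
  base: "gauss_poly c (\<lambda>x. complex_of_real (exp (- c * (x \<bullet> x))))"
| add: "gauss_poly c f \<Longrightarrow> gauss_poly c g \<Longrightarrow> gauss_poly c (\<lambda>x. f x + g x)"
| scale: "gauss_poly c f \<Longrightarrow> gauss_poly c (\<lambda>x. b * f x)"
| mul: "gauss_poly c f \<Longrightarrow> gauss_poly c (\<lambda>x. complex_of_real (x $ i) * f x)"

lemma power_times_gauss_bounded: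
  assumes "c > (0::real)"
  shows "\<exists>B. \<forall>r\<ge>0. r ^ N * exp (- c * r\<^sup>2) \<le> B"
proof -
  \<comment> \<open>With y = c r^2 the bound (1 + y/m)^m \<le> exp y is available, and K is chosen
    so that 1 + r^2 \<le> K (1 + y/m). Taking m = N + 1 keeps m positive when N = 0.\<close>
  define m where "m = Suc N"
  define K where "K = max 1 (real m / c)"
  have "r ^ N * exp (- c * r\<^sup>2) \<le> K ^ m" if "r \<ge> 0" for r
  proof -
    define y where "y = c * r\<^sup>2"
    have y0: "0 \<le> y" using assms by (simp add: y_def)
    have "r \<le> 1 + r\<^sup>2" using zero_le_power2[of "r - 1/2"] by (simp add: power2_eq_square algebra_simps)
    moreover have "1 + r\<^sup>2 \<le> K * (1 + y / m)"
    proof -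
      have "r\<^sup>2 = (real m / c) * (y / m)" using assms by (simp add: y_def m_def)
      also have "\<dots> \<le> K * (y / m)" using y0 by (intro mult_right_mono) (auto simp: K_def)
      finally show ?thesis by (simp add: K_def distrib_left)
    qed
    moreover have "1 \<le> 1 + r\<^sup>2" by simp
    ultimately have "r ^ N \<le> (1 + r\<^sup>2) ^ m" 
      by (intro order_trans[OF power_mono[of r "1 + r\<^sup>2" N] power_increasing]) (use that in \<open>auto simp: m_def\<close>)
    also have "\<dots> \<le> (K * (1 + y / m)) ^ m"
      by (rule power_mono[OF \<open>1 + r\<^sup>2 \<le> K * (1 + y / m)\<close>]) simp
    also have "\<dots> = K ^ m * (1 + y / m) ^ m" by (rule power_mult_distrib)
    also have "\<dots> \<le> K ^ m * exp y"
      by (intro mult_left_mono exp_ge_one_plus_x_over_n_power_n) (use y0 in \<open>auto simp: m_def K_def\<close>)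
    finally have "r ^ N * exp (- y) \<le> K ^ m * exp y * exp (- y)" by (intro mult_right_mono) auto
    then show ?thesis by (simp add: y_def mult.assoc flip: exp_add)
  qed
  then show ?thesis by blast
qed

lemma gauss_poly_schwartz:
  assumes c: "c > 0" and "gauss_poly c f"
  shows "schwartz f"
proof (rule schwartz_coinduct[where P="gauss_poly c"])
  fix f :: "real^'a \<Rightarrow> complex" and j assume "gauss_poly c f"
  then have "\<exists>B. \<forall>x. norm x ^ N * norm (f x) \<le> B" for N
  proof (induction arbitrary: N)
    case base
    obtain B where "\<And>r. r \<ge> 0 \<Longrightarrow> r ^ N * exp (- c * r\<^sup>2) \<le> B" using power_times_gauss_bounded[OF c] by blast
    from this[OF norm_ge_zero] show ?case by (auto simp: dot_square_norm)
  next
    case (add f g)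
    obtain B B' where B: "\<And>x. norm x ^ N * norm (f x) \<le> B" "\<And>x. norm x ^ N * norm (g x) \<le> B'"
      using add.IH by metis
    have "norm x ^ N * norm (f x + g x) \<le> B + B'" for x
    proof -
      have "norm x ^ N * norm (f x + g x) \<le> norm x ^ N * norm (f x) + norm x ^ N * norm (g x)"
        unfolding distrib_left[symmetric] by (intro mult_left_mono norm_triangle_ineq) simp
      with B[of x] show ?thesis by linarith
    qed
    then show ?case by blast
  next
    case (scale f b)
    obtain B where "\<And>x. norm x ^ N * norm (f x) \<le> B" using scale.IH by metis
    from mult_left_mono[OF this norm_ge_zero[of b]] show ?case
      by (intro exI[of _ "norm b * B"]) (simp add: norm_mult mult_ac)
  next
    case (mul f i)
    obtain B where B: "\<And>x. norm x ^ Suc N * norm (f x) \<le> B" using mul.IH by metis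
    have "norm x ^ N * norm (complex_of_real (x $ i) * f x) \<le> B" for x
    proof -
      have "norm x ^ N * norm (complex_of_real (x $ i) * f x) \<le> norm x ^ N * (norm x * norm (f x))"
        by (intro mult_left_mono) (auto simp: norm_mult intro!: mult_right_mono component_le_norm_cart)
      also have "\<dots> \<le> B" using B[of x] by (simp add: mult_ac)
      finally show ?thesis .
    qed
    then show ?case by blast
  qed
  from this[of 0] show "\<exists>B. \<forall>x. norm (f x) \<le> B" by simp
next
  fix f :: "real^'a \<Rightarrow> complex" and j assume "gauss_poly c f"
  then show "\<exists>f'. gauss_poly c f' \<and> (\<forall>x. ((\<lambda>t. f (x + t *\<^sub>R axis j 1)) has_vector_derivative f' x) (at 0))"
  proof induction
    case base
    let ?g = "\<lambda>x::real^'a. complex_of_real (exp (- c * (x \<bullet> x)))"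
    have "((\<lambda>t. ?g (x + t *\<^sub>R axis j 1)) has_vector_derivative complex_of_real (- 2 * c) * (complex_of_real (x $ j) * ?g x)) (at 0)" for x
    proof -
      have eq: "(x + t *\<^sub>R axis j 1) \<bullet> (x + t *\<^sub>R axis j 1) = x \<bullet> x + 2 * t * x $ j + t * t" for t
        by (simp add: inner_add_left inner_add_right inner_axis inner_commute[of "axis j 1"] algebra_simps)
      have "((\<lambda>t. exp (- c * (x \<bullet> x + 2 * t * x $ j + t * t))) has_real_derivative exp (- c * (x \<bullet> x)) * (- 2 * c * x $ j)) (at 0)"
        by (auto intro!: derivative_eq_intros)
      then have "((\<lambda>t. complex_of_real (exp (- c * (x \<bullet> x + 2 * t * x $ j + t * t)))) has_vector_derivative complex_of_real (exp (- c * (x \<bullet> x)) * (- 2 * c * x $ j))) (at 0)"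
        by (intro has_vector_derivative_of_real) (simp add: has_real_derivative_iff_has_vector_derivative)
      then show ?thesis by (simp add: eq mult_ac)
    qed
    moreover have "gauss_poly c (\<lambda>x. complex_of_real (- 2 * c) * (complex_of_real (x $ j) * ?g x))"
      by (intro gauss_poly.scale gauss_poly.mul gauss_poly.base)
    ultimately show ?case by blast
  next
    case (add f g)
    then obtain f' g' where "gauss_poly c f'" "gauss_poly c g'"
      "\<And>x. ((\<lambda>t. f (x + t *\<^sub>R axis j 1)) has_vector_derivative f' x) (at 0)"
      "\<And>x. ((\<lambda>t. g (x + t *\<^sub>R axis j 1)) has_vector_derivative g' x) (at 0)" by metis
    then show ?case
      by (intro exI[of _ "\<lambda>x. f' x + g' x"] conjI allI gauss_poly.add has_vector_derivative_add)
  next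
    case (scale f b)
    then obtain f' where "gauss_poly c f'"
      "\<And>x. ((\<lambda>t. f (x + t *\<^sub>R axis j 1)) has_vector_derivative f' x) (at 0)" by metis
    then show ?case
      by (intro exI[of _ "\<lambda>x. b * f' x"] conjI allI gauss_poly.scale has_vector_derivative_mult_right)
  next
    case (mul f i)
    then obtain f' where f': "gauss_poly c f'"
      "\<And>x. ((\<lambda>t. f (x + t *\<^sub>R axis j 1)) has_vector_derivative f' x) (at 0)" by metis
    define d :: complex where "d = (if i = j then 1 else 0)"
    have "((\<lambda>t. complex_of_real ((x + t *\<^sub>R axis j 1) $ i) * f (x + t *\<^sub>R axis j 1)) has_vector_derivative
        complex_of_real (x $ i) * f' x + d * f x) (at 0)" for x
      using has_vector_derivative_mult[OF has_vector_derivative_coord[of x j i] f'(2)[of x]]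
      by (simp only: scaleR_zero_left add_0_right d_def)
    with f'(1) mul.hyps show ?case
      by (intro exI[of _ "\<lambda>x. complex_of_real (x $ i) * f' x + d * f x"] conjI allI
          gauss_poly.add gauss_poly.mul gauss_poly.scale)
  qed
qed (use assms in \<open>auto intro: gauss_poly.mul\<close>)

lemma schwartz_gauss: "c > 0 \<Longrightarrow> schwartz (\<lambda>x. complex_of_real (exp (- c * (x \<bullet> x))))"
  by (rule gauss_poly_schwartz[OF _ gauss_poly.base])

section \<open>Tempered distributions with parameters\<close>

lemma tempered_add: "tempered T \<Longrightarrow> schwartz f \<Longrightarrow> schwartz g \<Longrightarrow> T (\<lambda>x. f x + g x) = T f + T g"
  unfolding tempered_def by blast

lemma tempered_scale: "tempered T \<Longrightarrow> schwartz f \<Longrightarrow> T (\<lambda>x. c * f x) = c * T f"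
  unfolding tempered_def by blast

lemma tempered_diff: "tempered T \<Longrightarrow> schwartz f \<Longrightarrow> schwartz g \<Longrightarrow> T (\<lambda>x. f x - g x) = T f - T g"
  using tempered_add[of T f "\<lambda>x. (-1) * g x"] tempered_scale[of T g "-1"] schwartz_scale[of g "-1"] by simp

lemma tempered_zero:
  assumes "tempered T"
  shows "T (\<lambda>x::real^'m::finite. 0) = 0"
  using tempered_scale[OF assms schwartz_gauss[of 1], of 0] by simp

lemma tempered_sum:
  assumes "tempered T" "finite I" "\<And>i. i \<in> I \<Longrightarrow> schwartz (f i)"
  shows "T (\<lambda>x. \<Sum>i\<in>I. c i * f i x) = (\<Sum>i\<in>I. c i * T (f i))"
  using assms(2,3)
proof (induction I rule: finite_induct)
  case (insert i I)
  have "schwartz (\<lambda>x. \<Sum>i\<in>I. c i * f i x)"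
    by (cases "I = {}") (use insert.hyps insert.prems schwartz_zero[OF insert.prems[of i]] in \<open>auto intro!: schwartz_sum schwartz_scale\<close>)
  then show ?case
    using insert by (simp add: tempered_add[OF assms(1)] tempered_scale[OF assms(1)] schwartz_scale)
qed (simp add: tempered_zero[OF assms(1)])

lemma tempered_bound:
  assumes "tempered T"
  obtains C k where "C \<ge> 0" "\<And>f. schwartz f \<Longrightarrow> norm (T f) \<le> C * schwartz_seminorm k f"
proof -
  obtain C k where C: "\<And>f. schwartz f \<Longrightarrow> norm (T f) \<le> C * schwartz_seminorm k f"
    using assms unfolding tempered_def by blast
  have "norm (T f) \<le> \<bar>C\<bar> * schwartz_seminorm k f" if "schwartz f" for f
    by (rule order_trans[OF C[OF that] mult_right_mono]) (auto intro: schwartz_seminorm_nonneg that)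
  then show ?thesis using that[of "\<bar>C\<bar>" k] by simp
qed

lemma schwartz_op_bound:
  assumes "schwartz_op A"
  obtains C m where "C \<ge> 0" "\<And>f. schwartz f \<Longrightarrow> schwartz_seminorm k (A f) \<le> C * schwartz_seminorm m f"
proof -
  obtain C m where C: "\<And>f. schwartz f \<Longrightarrow> schwartz_seminorm k (A f) \<le> C * schwartz_seminorm m f"
    using assms unfolding schwartz_op_def by blast
  have "schwartz_seminorm k (A f) \<le> \<bar>C\<bar> * schwartz_seminorm m f" if "schwartz f" for f
    by (rule order_trans[OF C[OF that] mult_right_mono]) (auto intro: schwartz_seminorm_nonneg that)
  then show ?thesis using that[of "\<bar>C\<bar>" m] by simp
qed

lemma schwartz_op_schwartz: "schwartz_op A \<Longrightarrow> schwartz f \<Longrightarrow> schwartz (A f)"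
  unfolding schwartz_op_def by blast

lemma tempered_comp:
  assumes T: "tempered T" and A: "schwartz_op A"
    and lin: "\<And>f g. schwartz f \<Longrightarrow> schwartz g \<Longrightarrow> A (\<lambda>x. f x + g x) = (\<lambda>x. A f x + A g x)"
      "\<And>c f. schwartz f \<Longrightarrow> A (\<lambda>x. c * f x) = (\<lambda>x. c * A f x)"
  shows "tempered (\<lambda>f. T (A f))"
proof -
  obtain C k where C: "C \<ge> 0" "\<And>f. schwartz f \<Longrightarrow> norm (T f) \<le> C * schwartz_seminorm k f"
    by (rule tempered_bound[OF T]) blast
  obtain D m where D: "D \<ge> 0" "\<And>f. schwartz f \<Longrightarrow> schwartz_seminorm k (A f) \<le> D * schwartz_seminorm m f"
    by (rule schwartz_op_bound[OF A, of k]) blast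
  have "norm (T (A f)) \<le> (C * D) * schwartz_seminorm m f" if f: "schwartz f" for f
    using order_trans[OF C(2)[OF schwartz_op_schwartz[OF A f]] mult_left_mono[OF D(2)[OF f] C(1)]]
    by (simp add: mult.assoc)
  then show ?thesis
    unfolding tempered_def
    using lin tempered_add[OF T] tempered_scale[OF T] schwartz_op_schwartz[OF A] by auto
qed

lemma tempered_point: "tempered (\<lambda>f. f x)"
proof -
  have "norm (f x) \<le> 1 * schwartz_seminorm 0 f" if "schwartz f" for f
    using schwartz_le_seminorm[OF that, of 0 0 "[]" x] by simp
  then show ?thesis unfolding tempered_def by blast
qed

lemma tempered_dist_conj:
  assumes T: "tempered T"
  shows "tempered (dist_conj T)"
proof -
  obtain C k where C: "C \<ge> 0" "\<And>f. schwartz f \<Longrightarrow> norm (T f) \<le> C * schwartz_seminorm k f"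
    by (rule tempered_bound[OF T]) blast
  obtain D m where D: "D \<ge> 0" "\<And>f::real^'a \<Rightarrow> complex. schwartz f \<Longrightarrow> schwartz_seminorm k (\<lambda>x. cnj (f x)) \<le> D * schwartz_seminorm m f"
    by (rule schwartz_op_bound[OF schwartz_op_cnj, of k]) blast
  have "norm (T (\<lambda>x. cnj (f x))) \<le> (C * D) * schwartz_seminorm m f" if f: "schwartz f" for f
    using order_trans[OF C(2)[OF schwartz_cnj[OF f]] mult_left_mono[OF D(2)[OF f] C(1)]]
    by (simp add: mult.assoc)
  then show ?thesis
    unfolding tempered_def dist_conj_def
    using tempered_add[OF T schwartz_cnj schwartz_cnj] tempered_scale[OF T schwartz_cnj] by auto
qed

lemma iter_partial_slice:
  fixes g :: "real^('n::finite + 'n) \<Rightarrow> complex"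
  shows "iter_partial ks (\<lambda>v. g (pvec u v)) = (\<lambda>v. iter_partial (map Inr ks) g (pvec u v))"
proof (induction ks)
  case (Cons i ks)
  show ?case
    unfolding iter_partial.simps Cons by (rule ext) (simp add: partial_dir_def pvec_axis_Inr)
qed simp

lemma schwartz_slice:
  assumes "schwartz g"
  shows "schwartz (\<lambda>v. g (pvec u v))"
proof -
  have "linear (\<lambda>v. pvec 0 v)" by (rule linearI) (simp_all add: pvec_add pvec_scaleR)
  moreover have "inj (\<lambda>v. pvec 0 v)" by (rule injI) simp
  ultimately show ?thesis
    using schwartz_affine[OF _ _ assms, of "\<lambda>v. pvec 0 v" "pvec u 0"] by (simp add: pvec_add)
qed

lemma schwartz_swap:
  assumes "schwartz g"
  shows "schwartz (\<lambda>z. g (pvec (ppart z) (xpart z)))"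
proof -
  have "linear (\<lambda>z. pvec (ppart z) (xpart z))"
    by (rule linearI) (simp_all add: parts_add parts_scaleR pvec_add pvec_scaleR)
  moreover have "inj (\<lambda>z. pvec (ppart z) (xpart z))"
    by (rule injI) (metis pvec_eq_iff pvec_parts)
  ultimately show ?thesis by (rule schwartz_linear[OF _ _ assms])
qed

lemma schwartz_slice': "schwartz g \<Longrightarrow> schwartz (\<lambda>u. g (pvec u v))"
  using schwartz_slice[OF schwartz_swap, of g v] by simp

definition seminorm_const :: "'m::finite itself \<Rightarrow> nat \<Rightarrow> real" where
  "seminorm_const _ k = real (Suc k * card {ks::'m list. length ks \<le> k})"

lemma seminorm_const_nonneg: "0 \<le> seminorm_const TYPE('m::finite) k"
  by (simp add: seminorm_const_def)

text \<open>The bound is uniform in u, because the norm of v never exceeds the norm of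
  \<open>pvec u v\<close>.\<close>

lemma schwartz_seminorm_slice:
  fixes g :: "real^('n::finite + 'n) \<Rightarrow> complex"
  assumes "schwartz g"
  shows "schwartz_seminorm k (\<lambda>v. g (pvec u v)) \<le> seminorm_const TYPE('n) k * schwartz_seminorm k g"
  unfolding seminorm_const_def
proof (rule schwartz_seminorm_leI)
  fix N and ks :: "'n list" and v :: "real^'n" assume "N \<le> k" "length ks \<le> k"
  have "norm v ^ N * norm (iter_partial (map Inr ks) g (pvec u v)) \<le> norm (pvec u v) ^ N * norm (iter_partial (map Inr ks) g (pvec u v))"
    by (intro mult_right_mono power_mono norm_le_norm_pvec) auto
  also have "\<dots> \<le> schwartz_seminorm k g"
    using assms \<open>N \<le> k\<close> \<open>length ks \<le> k\<close> by (intro schwartz_le_seminorm) auto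
  finally show "norm v ^ N * norm (iter_partial ks (\<lambda>v. g (pvec u v)) v) \<le> schwartz_seminorm k g"
    by (simp add: iter_partial_slice)
qed

text \<open>Differentiation under T. The Taylor remainder in u, seen as a function of v, is O(t^2)
  in the seminorm that controls T: its derivatives in v are Taylor remainders of derivatives of g,
  and two further derivatives of g bound those.\<close>

lemma has_vector_derivative_tempered_slice:
  fixes g :: "real^('n::finite + 'n) \<Rightarrow> complex"
  assumes T: "tempered T" and g: "schwartz g"
  shows "((\<lambda>t. T (\<lambda>v. g (pvec (u + t *\<^sub>R axis i 1) v))) has_vector_derivative
     T (\<lambda>v. partial_dir (Inl i) g (pvec u v))) (at 0)"
proof -
  obtain C k where C: "C \<ge> 0" "\<And>f. schwartz f \<Longrightarrow> norm (T f) \<le> C * schwartz_seminorm k f"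
    by (rule tempered_bound[OF T]) blast
  define L where "L = schwartz_seminorm (k + 2) g"
  define d where "d = partial_dir (Inl i) g"
  have d: "schwartz d" unfolding d_def by (rule schwartz_partial[OF g])
  \<comment> \<open>The factors 1 and -1 present the remainder as two nested linear combinations,
    the shape on which \<open>iter_partial_lincomb\<close> and the linearity of T act.\<close>
  define q where "q t v = 1 * (1 * g (pvec (u + t *\<^sub>R axis i 1) v) + (-1) * g (pvec u v)) + (- complex_of_real t) * d (pvec u v)" for t v
  have S1: "schwartz (\<lambda>v. g (pvec w v))" for w by (rule schwartz_slice[OF g])
  have S2: "schwartz (\<lambda>v. d (pvec w v))" for w by (rule schwartz_slice[OF d])
  have S3: "schwartz (\<lambda>v. 1 * g (pvec (u + t *\<^sub>R axis i 1) v) + (-1) * g (pvec u v))" for t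
    by (intro schwartz_add schwartz_scale S1)
  have Sq: "schwartz (q t)" for t
    unfolding q_def by (intro schwartz_add schwartz_scale S1 S2)
  have Tq: "T (q t) = T (\<lambda>v. g (pvec (u + t *\<^sub>R axis i 1) v)) - T (\<lambda>v. g (pvec (u + 0 *\<^sub>R axis i 1) v)) - t *\<^sub>R T (\<lambda>v. d (pvec u v))" for t
  proof -
    have "T (q t) = T (\<lambda>v. 1 * (1 * g (pvec (u + t *\<^sub>R axis i 1) v) + (-1) * g (pvec u v))) + T (\<lambda>v. (- complex_of_real t) * d (pvec u v))"
      unfolding q_def by (rule tempered_add[OF T schwartz_scale[OF S3] schwartz_scale[OF S2]])
    also have "T (\<lambda>v. (- complex_of_real t) * d (pvec u v)) = (- complex_of_real t) * T (\<lambda>v. d (pvec u v))"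
      by (rule tempered_scale[OF T S2])
    also have "T (\<lambda>v. 1 * (1 * g (pvec (u + t *\<^sub>R axis i 1) v) + (-1) * g (pvec u v))) = 1 * T (\<lambda>v. 1 * g (pvec (u + t *\<^sub>R axis i 1) v) + (-1) * g (pvec u v))"
      by (rule tempered_scale[OF T S3])
    also have "T (\<lambda>v. 1 * g (pvec (u + t *\<^sub>R axis i 1) v) + (-1) * g (pvec u v)) =
        T (\<lambda>v. 1 * g (pvec (u + t *\<^sub>R axis i 1) v)) + T (\<lambda>v. (-1) * g (pvec u v))"
      by (rule tempered_add[OF T schwartz_scale[OF S1] schwartz_scale[OF S1]])
    also have "T (\<lambda>v. (-1) * g (pvec u v)) = (-1) * T (\<lambda>v. g (pvec u v))"
      by (rule tempered_scale[OF T S1])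
    finally show ?thesis by (simp add: scaleR_conv_of_real)
  qed
  have bd: "norm v ^ N * norm (iter_partial ks (q t) v) \<le> L * t\<^sup>2" if "N \<le> k" "length ks \<le> k" for N ks v t
  proof -
    define G where "G = iter_partial (map Inr ks) g"
    have G: "schwartz G" unfolding G_def by (rule schwartz_iter[OF g])
    have dG: "iter_partial (map Inr ks) d = partial_dir (Inl i) G"
      unfolding G_def d_def by (rule iter_partial_commute[OF g])
    \<comment> \<open>The weight depends on v alone while the Taylor step moves u, so it is carried
      along as a constant.\<close>
    let ?r = "complex_of_real (norm v ^ N)"
    have "iter_partial ks (q t) v = 1 * (1 * iter_partial ks (\<lambda>v. g (pvec (u + t *\<^sub>R axis i 1) v)) v + (-1) * iter_partial ks (\<lambda>v. g (pvec u v)) v)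
        + (- complex_of_real t) * iter_partial ks (\<lambda>v. d (pvec u v)) v"
      unfolding q_def iter_partial_lincomb[OF S3 S2] iter_partial_lincomb[OF S1 S1] ..
    also have "\<dots> = G (pvec u v + t *\<^sub>R axis (Inl i) 1) - G (pvec u v) - t *\<^sub>R partial_dir (Inl i) G (pvec u v)"
      unfolding iter_partial_slice dG pvec_axis_Inl by (simp add: G_def scaleR_conv_of_real[where 'a=complex])
    finally have eq: "?r * iter_partial ks (q t) v = ?r * G (pvec u v + t *\<^sub>R axis (Inl i) 1) - ?r * G (pvec u v) - t *\<^sub>R (?r * partial_dir (Inl i) G (pvec u v))"
      by (simp add: right_diff_distrib mult_scaleR_right)
    have "norm (?r * G (pvec u v + t *\<^sub>R axis (Inl i) 1) - ?r * G (pvec u v) - t *\<^sub>R (?r * partial_dir (Inl i) G (pvec u v))) \<le> L * t\<^sup>2"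
    proof (rule taylor_axis[where f="\<lambda>z. ?r * G z" and f'="\<lambda>z. ?r * partial_dir (Inl i) G z" and f''="\<lambda>z. ?r * partial_dir (Inl i) (partial_dir (Inl i) G) z"])
      fix s
      let ?w = "pvec u v + s *\<^sub>R axis (Inl i) 1"
      have "norm (?r * partial_dir (Inl i) (partial_dir (Inl i) G) ?w) \<le> norm ?w ^ N * norm (iter_partial (Inl i # Inl i # map Inr ks) g ?w)"
        unfolding norm_mult G_def iter_partial.simps
        by (rule mult_right_mono) (auto simp: pvec_axis_Inl norm_power intro!: power_mono norm_le_norm_pvec)
      also have "\<dots> \<le> L" unfolding L_def by (rule schwartz_le_seminorm[OF g]) (use that in auto)
      finally show "norm (?r * partial_dir (Inl i) (partial_dir (Inl i) G) ?w) \<le> L" .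
    qed (intro has_vector_derivative_mult_right schwartz_deriv schwartz_partial G)+
    then have "norm (?r * iter_partial ks (q t) v) \<le> L * t\<^sup>2" unfolding eq .
    then show ?thesis by (simp add: norm_mult norm_power)
  qed
  have "norm (T (q t)) \<le> (C * (seminorm_const TYPE('n) k * L)) * t\<^sup>2" for t
  proof -
    have "schwartz_seminorm k (q t) \<le> seminorm_const TYPE('n) k * (L * t\<^sup>2)"
      unfolding seminorm_const_def by (rule schwartz_seminorm_leI) (rule bd)
    from order_trans[OF C(2)[OF Sq] mult_left_mono[OF this C(1)]] show ?thesis by (simp add: mult.assoc)
  qed
  then show ?thesis unfolding Tq d_def by (rule has_vector_derivative_from_quadratic)
qed

text \<open>Pairing away half of the variables leaves a Schwartz function of the other half: a
  factor \<open>u $ i\<close> is constant for T, a derivative in \<open>u $ i\<close> passes under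
  T, and the seminorms of the slices are bounded uniformly in u.\<close>

lemma schwartz_op_tempered_slice:
  fixes T :: "(real^'n::finite \<Rightarrow> complex) \<Rightarrow> complex"
  assumes T: "tempered T"
  shows "schwartz_op (\<lambda>g u. T (\<lambda>v. g (pvec u v)))"
proof -
  have "schwartz_op (\<lambda>g u. T (\<lambda>v. (\<lambda>f. f) g (pvec u v)))"
  proof (rule schwartz_op_coinduct[where P="\<lambda>A. \<exists>B. diffop B \<and> A = (\<lambda>g u. T (\<lambda>v. B g (pvec u v)))"])
    fix A and i :: 'n assume "\<exists>B. diffop B \<and> A = (\<lambda>g u. T (\<lambda>v. B g (pvec u v)))"
    then obtain B where B: "diffop B" "A = (\<lambda>g u. T (\<lambda>v. B g (pvec u v)))" by blast
    have SB: "schwartz (B f)" if "schwartz f" for f by (rule diffop_schwartz[OF B(1) that])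
    obtain C k where C: "C \<ge> 0" "\<And>f. schwartz f \<Longrightarrow> norm (T f) \<le> C * schwartz_seminorm k f"
      by (rule tempered_bound[OF T]) blast
    obtain D m where D: "D \<ge> 0" "\<And>f. schwartz f \<Longrightarrow> schwartz_seminorm k (B f) \<le> D * schwartz_seminorm m f"
      by (rule schwartz_op_bound[OF diffop_schwartz_op[OF B(1)], of k]) blast
    have "norm (A f x) \<le> (C * (seminorm_const TYPE('n) k * D)) * schwartz_seminorm m f" if f: "schwartz f" for f x
    proof -
      have "norm (A f x) \<le> C * schwartz_seminorm k (\<lambda>v. B f (pvec x v))"
        unfolding B(2) by (rule C(2)[OF schwartz_slice[OF SB[OF f]]])
      also have "\<dots> \<le> C * (seminorm_const TYPE('n) k * schwartz_seminorm k (B f))"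
        by (intro mult_left_mono schwartz_seminorm_slice SB f C)
      also have "\<dots> \<le> C * (seminorm_const TYPE('n) k * (D * schwartz_seminorm m f))"
        by (intro mult_left_mono D(2) f C seminorm_const_nonneg)
      finally show ?thesis by (simp add: mult.assoc)
    qed
    then show "\<exists>C m. \<forall>f. schwartz f \<longrightarrow> (\<forall>x. norm (A f x) \<le> C * schwartz_seminorm m f)" by blast
    have "(\<lambda>u. T (\<lambda>v. complex_of_real (pvec u v $ Inl i) * B f (pvec u v))) = (\<lambda>u. complex_of_real (u $ i) * A f u)" if "schwartz f" for f
      unfolding B(2) by (rule ext) (simp add: tempered_scale[OF T schwartz_slice[OF SB[OF that]]])
    then show "\<exists>A'. (\<exists>B. diffop B \<and> A' = (\<lambda>g u. T (\<lambda>v. B g (pvec u v)))) \<and>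
        (\<forall>f. schwartz f \<longrightarrow> A' f = (\<lambda>x. complex_of_real (x $ i) * A f x))"
      using diffop.mul[OF B(1), of "Inl i"]
      by (intro exI[of _ "\<lambda>g u. T (\<lambda>v. complex_of_real (pvec u v $ Inl i) * B g (pvec u v))"] conjI
          exI[of _ "\<lambda>g z. complex_of_real (z $ Inl i) * B g z"]) auto
    obtain B' where B': "diffop B'" "\<And>f. schwartz f \<Longrightarrow> partial_dir (Inl i) (B f) = B' f"
      using diffop_partial[OF B(1)] by metis
    have "((\<lambda>t. A f (x + t *\<^sub>R axis i 1)) has_vector_derivative T (\<lambda>v. B' f (pvec x v))) (at 0)" if f: "schwartz f" for f x
      using has_vector_derivative_tempered_slice[OF T SB[OF f], of x i] unfolding B(2) B'(2)[OF f] .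
    then show "\<exists>A'. (\<exists>B. diffop B \<and> A' = (\<lambda>g u. T (\<lambda>v. B g (pvec u v)))) \<and> (\<forall>f x. schwartz f \<longrightarrow>
        ((\<lambda>t. A f (x + t *\<^sub>R axis i 1)) has_vector_derivative A' f x) (at 0))"
      using B'(1) by blast
  qed (use diffop_id in blast)
  then show ?thesis .
qed

lemma schwartz_tempered_slice: "tempered T \<Longrightarrow> schwartz g \<Longrightarrow> schwartz (\<lambda>u. T (\<lambda>v. g (pvec u v)))"
  using schwartz_op_tempered_slice unfolding schwartz_op_def by blast

lemma iter_partial_tempered_slice:
  fixes g :: "real^('n::finite + 'n) \<Rightarrow> complex"
  assumes "tempered T" "schwartz g"
  shows "iter_partial ks (\<lambda>u. T (\<lambda>v. g (pvec u v))) = (\<lambda>u. T (\<lambda>v. iter_partial (map Inl ks) g (pvec u v)))"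
proof (induction ks)
  case (Cons i ks)
  show ?case
    unfolding iter_partial.simps Cons list.map
    by (rule partial_dir_eqI) (rule has_vector_derivative_tempered_slice[OF assms(1) schwartz_iter[OF assms(2)]])
qed simp

text \<open>The functional is the tensor product of T and U, represented as an iterated
  pairing.\<close>

lemma tempered_iterated:
  assumes "tempered T" "tempered U"
  shows "tempered (\<lambda>g. T (\<lambda>u. U (\<lambda>v. g (pvec u v))))"
  by (rule tempered_comp[OF assms(1) schwartz_op_tempered_slice[OF assms(2)]])
    (simp_all add: tempered_add[OF assms(2) schwartz_slice schwartz_slice] tempered_scale[OF assms(2) schwartz_slice])

section \<open>Integration over Euclidean space\<close>

lemma measurable_coord [measurable]: "(\<lambda>x::real^'m::finite. x $ i) \<in> borel_measurable borel"
  by (intro borel_measurable_continuous_onI continuous_intros)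

text \<open>Lebesgue measure on \<open>real^'m\<close> is the image of a product measure indexed by
  \<open>Basis\<close>, whose elements are the vectors \<open>axis i 1\<close>; reindexing along
  this bijection separates the integral.\<close>

lemma lborel_prod_coord:
  fixes f :: "'m::finite \<Rightarrow> real \<Rightarrow> 'b::{real_normed_field,banach,second_countable_topology}"
  assumes int: "\<And>i. integrable lborel (f i)"
  shows integrable_prod_coord: "integrable lborel (\<lambda>x::real^'m. \<Prod>i\<in>UNIV. f i (x $ i))"
    and integral_prod_coord: "(\<integral>x. (\<Prod>i\<in>UNIV. f i (x $ i)) \<partial>(lborel :: (real^'m) measure)) = (\<Prod>i\<in>UNIV. \<integral>t. f i t \<partial>lborel)"
proof -
  interpret product_sigma_finite "\<lambda>_::real^'m. lborel::real measure" ..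
  let ?ax = "\<lambda>i::'m. axis i (1::real)"
  have inj: "inj ?ax" by (rule injI) (simp add: axis_eq_axis)
  have Bas: "(Basis :: (real^'m) set) = ?ax ` UNIV" by (auto simp: Basis_vec_def)
  define F where "F b = f (inv ?ax b)" for b
  have F: "F (?ax i) = f i" for i unfolding F_def by (simp add: inv_f_f[OF inj])
  let ?M = "\<Pi>\<^sub>M b\<in>(Basis :: (real^'m) set). (lborel :: real measure)"
  let ?T = "\<lambda>g. \<Sum>b\<in>(Basis :: (real^'m) set). g b *\<^sub>R b"
  have [measurable]: "f i \<in> borel_measurable borel" for i
    using borel_measurable_integrable[OF int[of i]] by simp
  have T[measurable]: "?T \<in> measurable ?M borel" by measurable
  have co: "?T g $ i = g (?ax i)" for g i
  proof -
    have "?T g \<bullet> ?ax i = g (?ax i)" by (rule inner_sum_left_Basis) (simp add: Bas)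
    then show ?thesis by (simp add: inner_axis)
  qed
  have eq: "(\<Prod>i\<in>UNIV. f i (?T g $ i)) = (\<Prod>b\<in>Basis. F b (g b))" for g
  proof -
    have "(\<Prod>i\<in>UNIV. f i (?T g $ i)) = (\<Prod>i\<in>UNIV. F (?ax i) (g (?ax i)))"
      by (simp only: co F)
    also have "\<dots> = (\<Prod>b\<in>Basis. F b (g b))"
      unfolding Bas by (subst prod.reindex[OF inj]) simp
    finally show ?thesis .
  qed
  have pf: "(\<lambda>x::real^'m. \<Prod>i\<in>UNIV. f i (x $ i)) \<in> borel_measurable borel" by measurable
  have intF: "integrable lborel (F b)" for b unfolding F_def by (rule int)
  have "integrable ?M (\<lambda>g. \<Prod>b\<in>Basis. F b (g b))"
    by (rule product_integrable_prod) (auto intro: intF)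
  then show "integrable lborel (\<lambda>x::real^'m. \<Prod>i\<in>UNIV. f i (x $ i))"
    unfolding lborel_eq[where 'a="real^'m"] integrable_distr_eq[OF T pf] eq .
  have "(\<integral>x. (\<Prod>i\<in>UNIV. f i (x $ i)) \<partial>(lborel :: (real^'m) measure)) = (\<integral>g. (\<Prod>b\<in>Basis. F b (g b)) \<partial>?M)"
    unfolding lborel_eq[where 'a="real^'m"] integral_distr[OF T pf] eq ..
  also have "\<dots> = (\<Prod>b\<in>(Basis :: (real^'m) set). integral\<^sup>L lborel (F b))"
    by (rule product_integral_prod) (auto intro: intF)
  also have "\<dots> = (\<Prod>i\<in>UNIV. \<integral>t. f i t \<partial>lborel)"
    unfolding Bas by (subst prod.reindex[OF inj]) (simp add: F)
  finally show "(\<integral>x. (\<Prod>i\<in>UNIV. f i (x $ i)) \<partial>(lborel :: (real^'m) measure)) = (\<Prod>i\<in>UNIV. \<integral>t. f i t \<partial>lborel)" .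
qed

lemma lborel_integral_affine:
  fixes f :: "'a::euclidean_space \<Rightarrow> complex"
  assumes "c \<noteq> 0" and f: "f \<in> borel_measurable borel"
  shows "(\<integral>x. f x \<partial>lborel) = \<bar>c\<bar> ^ DIM('a) *\<^sub>R (\<integral>x. f (t + c *\<^sub>R x) \<partial>lborel)"
proof -
  have [measurable]: "(\<lambda>x. t + c *\<^sub>R x) \<in> borel_measurable borel" by measurable
  note f[measurable]
  have "(\<integral>x. f x \<partial>lborel) = (\<integral>x. f x \<partial>density (distr lborel borel (\<lambda>x. t + c *\<^sub>R x)) (\<lambda>_. ennreal (\<bar>c\<bar> ^ DIM('a))))"
    using lborel_affine[OF assms(1), of t] by simp
  also have "\<dots> = (\<integral>x. \<bar>c\<bar> ^ DIM('a) *\<^sub>R f x \<partial>distr lborel borel (\<lambda>x. t + c *\<^sub>R x))"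
    by (rule integral_density) auto
  also have "\<dots> = (\<integral>x. \<bar>c\<bar> ^ DIM('a) *\<^sub>R f (t + c *\<^sub>R x) \<partial>lborel)"
    by (rule integral_distr) auto
  finally show ?thesis by simp
qed

lemma lborel_integral_translate:
  fixes f :: "'a::euclidean_space \<Rightarrow> complex"
  shows "f \<in> borel_measurable borel \<Longrightarrow> (\<integral>x. f (t + x) \<partial>lborel) = (\<integral>x. f x \<partial>lborel)"
  using lborel_integral_affine[of 1 f t] by simp

lemma lborel_integral_reflect:
  fixes f :: "'a::euclidean_space \<Rightarrow> complex"
  shows "f \<in> borel_measurable borel \<Longrightarrow> (\<integral>x. f (t - x) \<partial>lborel) = (\<integral>x. f x \<partial>lborel)"
  using lborel_integral_affine[of "-1" f t] by simp

text \<open>An integrable function whose reciprocal is a polynomial. Multiplication by the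
  reciprocal is a \<open>diffop\<close>, so every Schwartz function is bounded by a seminorm times
  \<open>weight\<close>. The product form reduces integrability to one variable.\<close>

definition weight :: "real^'m::finite \<Rightarrow> real" where
  "weight x = (\<Prod>i\<in>UNIV. inverse (1 + (x $ i)\<^sup>2))"

lemma weight_pos: "0 < weight x"
  unfolding weight_def by (rule prod_pos) (simp add: add_pos_nonneg)

lemma weight_measurable [measurable]: "weight \<in> borel_measurable borel"
  unfolding weight_def[abs_def] by measurable

lemma integrable_weight: "integrable lborel weight"
proof -
  have "integrable lborel (\<lambda>t::real. inverse (1 + t\<^sup>2))"
    using integrable_inverse_1_plus_square by (simp add: set_integrable_def)
  then show ?thesis unfolding weight_def[abs_def] by (rule integrable_prod_coord)
qed

lemma diffop_weight:
  assumes "finite I"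
  shows "diffop (\<lambda>f x. complex_of_real (\<Prod>i\<in>I. 1 + (x $ i)\<^sup>2) * f x)"
  using assms
proof induction
  case empty
  show ?case using diffop_id by simp
next
  case (insert i I)
  have "(\<lambda>f x. complex_of_real (\<Prod>i\<in>insert i I. 1 + (x $ i)\<^sup>2) * f x) =
    (\<lambda>f x. complex_of_real (\<Prod>i\<in>I. 1 + (x $ i)\<^sup>2) * f x +
      complex_of_real (x $ i) * (complex_of_real (x $ i) * (complex_of_real (\<Prod>i\<in>I. 1 + (x $ i)\<^sup>2) * f x)))"
    using insert.hyps by (intro ext) (simp add: algebra_simps power2_eq_square)
  then show ?case using insert.IH by (simp only:) (intro diffop.add diffop.mul)
qed

lemma weight_inverse: "weight x * (\<Prod>i\<in>UNIV. 1 + (x $ i)\<^sup>2) = 1"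
proof -
  have "1 + (x $ i)\<^sup>2 \<noteq> 0" for i by (metis add_pos_nonneg less_irrefl zero_le_power2 zero_less_one)
  then show ?thesis unfolding weight_def prod.distrib[symmetric] by simp
qed

lemma schwartz_le_weight:
  obtains C m where "C \<ge> 0"
    "\<And>f x. schwartz (f :: real^'m::finite \<Rightarrow> complex) \<Longrightarrow> norm (f x) \<le> C * schwartz_seminorm m f * weight x"
proof -
  obtain C m where C: "\<And>f (x::real^'m). schwartz f \<Longrightarrow> norm x ^ 0 * norm (complex_of_real (\<Prod>i\<in>UNIV. 1 + (x $ i)\<^sup>2) * f x) \<le> C * schwartz_seminorm m f"
    using diffop_bound[OF diffop_weight[OF finite_class.finite_UNIV], of 0] by blast
  have "norm (f x) \<le> \<bar>C\<bar> * schwartz_seminorm m f * weight x" if f: "schwartz f" for f :: "real^'m \<Rightarrow> complex" and x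
  proof -
    let ?w = "\<Prod>i\<in>UNIV. 1 + (x $ i)\<^sup>2"
    have w: "0 \<le> ?w" by (rule prod_nonneg) simp
    have "norm (f x) = weight x * norm (complex_of_real ?w * f x)"
      unfolding norm_mult norm_of_real abs_of_nonneg[OF w] mult.assoc[symmetric] weight_inverse by simp
    also have "\<dots> \<le> weight x * (\<bar>C\<bar> * schwartz_seminorm m f)"
      using C[OF f, of x] schwartz_seminorm_nonneg[OF f, of m] weight_pos[of x]
      by (intro mult_left_mono order_trans[OF _ mult_right_mono[of C "\<bar>C\<bar>"]]) auto
    finally show ?thesis by (simp add: mult_ac)
  qed
  then show ?thesis using that[of "\<bar>C\<bar>" m] by simp
qed

lemma integrable_bounded_mult_schwartz:
  fixes f :: "real^'m::finite \<Rightarrow> complex"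
  assumes [measurable]: "e \<in> borel_measurable borel" and e: "\<And>x. norm (e x) \<le> B" and f: "schwartz f"
  shows "integrable lborel (\<lambda>x. e x * f x)"
proof -
  obtain C m where C: "C \<ge> 0" "\<And>f x. schwartz (f :: real^'m \<Rightarrow> complex) \<Longrightarrow> norm (f x) \<le> C * schwartz_seminorm m f * weight x"
    using schwartz_le_weight by blast
  have [measurable]: "f \<in> borel_measurable borel" using f by (rule schwartz_measurable)
  have B: "0 \<le> B" using order_trans[OF norm_ge_zero e] .
  show ?thesis
  proof (rule Bochner_Integration.integrable_bound)
    show "integrable lborel (\<lambda>x::real^'m. B * (C * schwartz_seminorm m f * weight x))"
      using integrable_weight[where 'a='m] by simp
    show "AE x in lborel. norm (e x * f x) \<le> norm (B * (C * schwartz_seminorm m f * weight x))"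
    proof (rule AE_I2)
      fix x
      have "norm (e x * f x) \<le> B * (C * schwartz_seminorm m f * weight x)"
        unfolding norm_mult by (intro mult_mono e C f B) auto
      then show "norm (e x * f x) \<le> norm (B * (C * schwartz_seminorm m f * weight x))" by simp
    qed
  qed measurable
qed

lemma schwartz_integrable: "schwartz f \<Longrightarrow> integrable lborel f"
  using integrable_bounded_mult_schwartz[of "\<lambda>x. 1" 1 f] by simp

lemma tempered_bounded_integral:
  fixes e :: "real^'m::finite \<Rightarrow> complex"
  assumes [measurable]: "e \<in> borel_measurable borel" and e: "\<And>x. norm (e x) \<le> B"
  shows "tempered (\<lambda>f. \<integral>x. e x * f x \<partial>lborel)"
proof -
  obtain C m where C: "C \<ge> 0" "\<And>f x. schwartz (f :: real^'m \<Rightarrow> complex) \<Longrightarrow> norm (f x) \<le> C * schwartz_seminorm m f * weight x"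
    using schwartz_le_weight by blast
  have B: "0 \<le> B" using order_trans[OF norm_ge_zero e] .
  have int: "integrable lborel (\<lambda>x. e x * f x)" if "schwartz f" for f
    by (rule integrable_bounded_mult_schwartz[OF assms that])
  let ?K = "B * C * (\<integral>x. weight x \<partial>(lborel :: (real^'m) measure))"
  have "norm (\<integral>x. e x * f x \<partial>lborel) \<le> ?K * schwartz_seminorm m f" if f: "schwartz f" for f
  proof -
    have "norm (\<integral>x. e x * f x \<partial>lborel) \<le> (\<integral>x. B * (C * schwartz_seminorm m f * weight x) \<partial>(lborel :: (real^'m) measure))"
    proof (rule Bochner_Integration.integral_norm_bound_integral)
      fix x
      show "norm (e x * f x) \<le> B * (C * schwartz_seminorm m f * weight x)"
        unfolding norm_mult by (intro mult_mono e C f B) auto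
    qed (use int[OF f] integrable_weight[where 'a='m] in auto)
    then show ?thesis by (simp add: mult_ac)
  qed
  then show ?thesis
    unfolding tempered_def using int
    by (auto simp: distrib_left mult.left_commute[of _ "_::complex"])
qed

lemma tempered_integral: "tempered (\<lambda>f. \<integral>x. f x \<partial>lborel)"
  using tempered_bounded_integral[of "\<lambda>x. 1" 1] by simp

lemma tempered_fun_dist:
  assumes "schwartz f"
  shows "tempered (fun_dist f)"
proof -
  obtain B where "\<And>x. norm (f x) \<le> B" using schwartz_bounded[OF assms] by blast
  then show ?thesis
    using tempered_bounded_integral[OF schwartz_measurable[OF assms]] unfolding fun_dist_def[abs_def] by blast
qed

section \<open>Interchanging tempered distributions\<close>

text \<open>A function of a simple function takes finitely many values, so its integral is a finite
  sum, and linear functionals commute with finite sums.\<close>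

lemma integral_simple_composition:
  fixes g :: "'b \<Rightarrow> complex"
  assumes fin: "finite_measure \<mu>" and s: "simple_function \<mu> s"
  shows "(\<integral>w. g (s w) \<partial>\<mu>) = (\<Sum>v\<in>s ` space \<mu>. complex_of_real (measure \<mu> {w \<in> space \<mu>. s w = v}) * g v)"
    and "integrable \<mu> (\<lambda>w. g (s w))"
proof -
  interpret finite_measure \<mu> by fact
  have fs: "finite (s ` space \<mu>)" using s by (rule simple_functionD)
  have ms: "{w \<in> space \<mu>. s w = v} \<in> sets \<mu>" for v
    using simple_functionD(2)[OF s, of "{v}"] by (simp add: vimage_def Int_def conj_commute)
  have eq: "g (s w) = (\<Sum>v\<in>s ` space \<mu>. indicator {w \<in> space \<mu>. s w = v} w *\<^sub>R g v)" if "w \<in> space \<mu>" for w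
  proof -
    have "(\<Sum>v\<in>s ` space \<mu>. indicator {w \<in> space \<mu>. s w = v} w *\<^sub>R g v) = (\<Sum>v\<in>s ` space \<mu>. if s w = v then g v else 0)"
      by (rule sum.cong) (use that in \<open>auto simp: indicator_def\<close>)
    also have "\<dots> = g (s w)" using fs that by (subst sum.delta') auto
    finally show ?thesis by simp
  qed
  have int: "integrable \<mu> (\<lambda>w. indicator {w \<in> space \<mu>. s w = v} w *\<^sub>R g v)" for v
    by (rule integrable_scaleR_left) (use ms in \<open>simp add: integrable_indicator_iff emeasure_finite less_top[symmetric]\<close>)
  show "integrable \<mu> (\<lambda>w. g (s w))"
    by (subst Bochner_Integration.integrable_cong[OF refl eq]) (use int in auto)
  have "(\<integral>w. g (s w) \<partial>\<mu>) = (\<integral>w. (\<Sum>v\<in>s ` space \<mu>. indicator {w \<in> space \<mu>. s w = v} w *\<^sub>R g v) \<partial>\<mu>)"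
    by (rule Bochner_Integration.integral_cong[OF refl eq])
  also have "\<dots> = (\<Sum>v\<in>s ` space \<mu>. (\<integral>w. indicator {w \<in> space \<mu>. s w = v} w *\<^sub>R g v \<partial>\<mu>))"
    by (rule Bochner_Integration.integral_sum) (rule int)
  also have "\<dots> = (\<Sum>v\<in>s ` space \<mu>. complex_of_real (measure \<mu> {w \<in> space \<mu>. s w = v}) * g v)"
    by (rule sum.cong[OF refl]) (use ms in \<open>simp add: scaleR_conv_of_real Int_absorb2 sets.sets_into_space\<close>)
  finally show "(\<integral>w. g (s w) \<partial>\<mu>) = \<dots>" .
qed

lemma integrable_finite_measure_bounded:
  fixes f :: "'a \<Rightarrow> complex"
  assumes "finite_measure \<mu>" "f \<in> borel_measurable \<mu>" "\<And>x. norm (f x) \<le> B"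
  shows "integrable \<mu> f"
  by (rule finite_measure.integrable_const_bound[OF assms(1) _ assms(2)]) (use assms(3) in auto)

lemma tempered_finite_measure:
  fixes \<mu> :: "(real^'n::finite) measure"
  assumes fin: "finite_measure \<mu>" and sets: "sets \<mu> = sets borel"
  shows "tempered (\<lambda>f. \<integral>w. f w \<partial>\<mu>)"
proof -
  interpret finite_measure \<mu> by fact
  have b: "norm (f w) \<le> schwartz_seminorm 0 f" if "schwartz f" for f and w :: "real^'n"
    using schwartz_le_seminorm[OF that, of 0 0 "[]" w] by simp
  have int: "integrable \<mu> f" if "schwartz f" for f
    using schwartz_measurable[OF that] b[OF that]
    by (intro integrable_finite_measure_bounded[OF fin]) (auto simp: measurable_cong_sets[OF sets refl])
  have "norm (\<integral>w. f w \<partial>\<mu>) \<le> measure \<mu> (space \<mu>) * schwartz_seminorm 0 f" if "schwartz f" for f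
  proof -
    have "norm (\<integral>w. f w \<partial>\<mu>) \<le> (\<integral>w. schwartz_seminorm 0 f \<partial>\<mu>)"
      by (rule Bochner_Integration.integral_norm_bound_integral) (use int b that in auto)
    then show ?thesis by simp
  qed
  then show ?thesis unfolding tempered_def using int by auto
qed

lemma tempered_minus:
  assumes "tempered T" "tempered U"
  shows "tempered (\<lambda>f. T f - U f)"
proof -
  obtain C k where C: "C \<ge> 0" "\<And>f. schwartz f \<Longrightarrow> norm (T f) \<le> C * schwartz_seminorm k f"
    by (rule tempered_bound[OF assms(1)]) blast
  obtain D m where D: "D \<ge> 0" "\<And>f. schwartz f \<Longrightarrow> norm (U f) \<le> D * schwartz_seminorm m f"
    by (rule tempered_bound[OF assms(2)]) blast
  have "norm (T f - U f) \<le> (C + D) * schwartz_seminorm (k + m) f" if f: "schwartz f" for f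
  proof -
    have "C * schwartz_seminorm k f \<le> C * schwartz_seminorm (k + m) f"
      "D * schwartz_seminorm m f \<le> D * schwartz_seminorm (k + m) f"
      by (intro mult_left_mono schwartz_seminorm_mono f C D; simp)+
    with norm_triangle_ineq4[of "T f" "U f"] C(2)[OF f] D(2)[OF f] show ?thesis by (simp add: distrib_right)
  qed
  then show ?thesis
    unfolding tempered_def
    using tempered_add[OF assms(1)] tempered_add[OF assms(2)] tempered_scale[OF assms(1)] tempered_scale[OF assms(2)]
    by (auto simp: right_diff_distrib)
qed

text \<open>Replacing w by simple functions \<open>s i w\<close> that converge to w turns the
  integral into finite sums, which commute with B by linearity. The sums converge in the seminorm
  that controls B because the derivatives of G are Lipschitz in w; dominated convergence over the
  finite measure handles both limits.\<close>

lemma tempered_finite_measure_interchange: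
  fixes \<mu> :: "(real^'n::finite) measure"
  assumes fin: "finite_measure \<mu>" and sets: "sets \<mu> = sets borel"
    and B: "tempered B" and G: "schwartz G"
  shows "B (\<lambda>x. \<integral>w. G (pvec w x) \<partial>\<mu>) = (\<integral>w. B (\<lambda>x. G (pvec w x)) \<partial>\<mu>)"
proof -
  interpret finite_measure \<mu> by fact
  have meas: "f \<in> borel_measurable \<mu>" if "f \<in> borel_measurable borel" for f :: "real^'n \<Rightarrow> 'c::topological_space"
    using that by (simp add: measurable_cong_sets[OF sets refl])
  have sp: "space \<mu> = UNIV" using sets_eq_imp_space_eq[OF sets] by simp
  obtain s where s: "\<And>i. simple_function \<mu> (s i)" "\<And>w. (\<lambda>i. s i w) \<longlonglongrightarrow> w"
    using borel_measurable_implies_sequence_metric[OF meas[OF measurable_ident_sets[OF refl]], of 0]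
    unfolding sp by auto
  have sm: "s i \<in> borel_measurable \<mu>" for i
    using s(1) by (rule borel_measurable_simple_function)
  \<comment> \<open>The variables are exchanged so that the integration variable comes second, as
    the lemmas on slices expect.\<close>
  define g where "g z = G (pvec (ppart z) (xpart z))" for z
  have g: "schwartz g" unfolding g_def by (rule schwartz_swap[OF G])
  have gG: "g (pvec x w) = G (pvec w x)" for x w by (simp add: g_def)
  \<comment> \<open>The approximation error as a functional of the integrand. It is tempered for
    each i, so partial derivatives in x pass under it.\<close>
  define E where "E i f = (\<integral>w. f (s i w) - f w \<partial>\<mu>)" for i and f :: "real^'n \<Rightarrow> complex"
  define H where "H v = B (\<lambda>x. G (pvec v x))" for v
  have H: "schwartz H" unfolding H_def by (rule schwartz_tempered_slice[OF B G])
  have int: "integrable \<mu> f" if f: "schwartz f" for f :: "real^'n \<Rightarrow> complex"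
  proof -
    obtain b where "\<And>x. norm (f x) \<le> b" using schwartz_bounded[OF f] by blast
    then show ?thesis by (rule integrable_finite_measure_bounded[OF fin meas[OF schwartz_measurable[OF f]]])
  qed
  have ints: "integrable \<mu> (\<lambda>w. f (s i w))" for f :: "real^'n \<Rightarrow> complex" and i
    by (rule integral_simple_composition(2)[OF fin s(1)])
  have Eeq: "E i f = (\<integral>w. f (s i w) \<partial>\<mu>) - (\<integral>w. f w \<partial>\<mu>)" if "schwartz f" for i f
    unfolding E_def by (rule Bochner_Integration.integral_diff[OF ints int[OF that]])
  have E: "tempered (E i)" for i
  proof -
    have "norm (E i f) \<le> (2 * measure \<mu> (space \<mu>)) * schwartz_seminorm 0 f" if f: "schwartz f" for f
    proof -
      have b: "norm (f w) \<le> schwartz_seminorm 0 f" for w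
        using schwartz_le_seminorm[OF f, of 0 0 "[]" w] by simp
      have b2: "norm (f (s i w) - f w) \<le> schwartz_seminorm 0 f + schwartz_seminorm 0 f" for w
        by (rule order_trans[OF norm_triangle_ineq4 add_mono[OF b b]])
      have "norm (E i f) \<le> (\<integral>w. schwartz_seminorm 0 f + schwartz_seminorm 0 f \<partial>\<mu>)"
        unfolding E_def
        by (rule Bochner_Integration.integral_norm_bound_integral)
          (use int[OF f] ints b2 in auto)
      then show ?thesis by simp
    qed
    moreover have "E i (\<lambda>x. f x + h x) = E i f + E i h" if "schwartz f" "schwartz h" for f h
      using int[OF that(1)] int[OF that(2)] ints[of f i] ints[of h i]
      by (simp add: Eeq that schwartz_add)
    moreover have "E i (\<lambda>x. c * f x) = c * E i f" if "schwartz f" for f c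
      by (simp add: Eeq that schwartz_scale right_diff_distrib)
    ultimately show ?thesis unfolding tempered_def by blast
  qed
  define P where "P x = (\<integral>w. G (pvec w x) \<partial>\<mu>)" for x
  define R where "R i x = (\<integral>w. G (pvec (s i w) x) \<partial>\<mu>)" for i x
  have P: "schwartz P"
    using schwartz_tempered_slice[OF tempered_finite_measure[OF fin sets] g] by (simp add: P_def[abs_def] gG)
  have EG: "E i (\<lambda>w. g (pvec x w)) = R i x - P x" for i x
    using Eeq[OF schwartz_slice[OF g]] by (simp add: R_def P_def gG)
  have SE: "schwartz (\<lambda>x. E i (\<lambda>w. g (pvec x w)))" for i by (rule schwartz_tempered_slice[OF E g])
  have R: "schwartz (R i)" for i
    using schwartz_add[OF SE[of i] P] by (simp add: EG)
  have BR: "B (R i) = (\<integral>w. H (s i w) \<partial>\<mu>)" for i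
  proof -
    have f: "finite (s i ` space \<mu>)" using s(1) by (rule simple_functionD)
    have "R i = (\<lambda>x. \<Sum>v\<in>s i ` space \<mu>. complex_of_real (measure \<mu> {w \<in> space \<mu>. s i w = v}) * G (pvec v x))"
      unfolding R_def by (rule ext) (rule integral_simple_composition(1)[OF fin s(1), of "\<lambda>v. G (pvec v x)" for x])
    then have "B (R i) = (\<Sum>v\<in>s i ` space \<mu>. complex_of_real (measure \<mu> {w \<in> space \<mu>. s i w = v}) * H v)"
      unfolding H_def using tempered_sum[OF B f schwartz_slice[OF G]] by simp
    then show ?thesis using integral_simple_composition(1)[OF fin s(1), of H i] by simp
  qed
  have lim1: "(\<lambda>i. B (R i)) \<longlonglongrightarrow> (\<integral>w. H w \<partial>\<mu>)"
  proof -
    obtain b where b: "\<And>x. norm (H x) \<le> b" using schwartz_bounded[OF H] by blast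
    have "(\<lambda>i. \<integral>w. H (s i w) \<partial>\<mu>) \<longlonglongrightarrow> (\<integral>w. H w \<partial>\<mu>)"
    proof (rule integral_dominated_convergence[where w="\<lambda>_. b"])
      show "AE w in \<mu>. (\<lambda>i. H (s i w)) \<longlonglongrightarrow> H w"
        using schwartz_continuous[OF H] s(2)
        by (auto intro!: continuous_on_tendsto_compose[where s=UNIV and f=H])
    qed (use b ints int[OF H] in \<open>auto intro: borel_measurable_integrable\<close>)
    then show ?thesis by (simp add: BR)
  qed
  obtain C k where C: "C \<ge> 0" "\<And>f. schwartz f \<Longrightarrow> norm (B f) \<le> C * schwartz_seminorm k f"
    by (rule tempered_bound[OF B]) blast
  define L where "L = schwartz_seminorm (k + 1) g"
  have L0: "0 \<le> L" unfolding L_def by (rule schwartz_seminorm_nonneg[OF g])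
  \<comment> \<open>The first bound dominates uniformly in i, the second tends to 0 pointwise. The
    order k + 1 in \<open>L\<close> leaves one derivative for the Lipschitz estimate.\<close>
  define \<delta> where "\<delta> i w = min (2 * L) (L * real CARD('n) * norm (s i w - w))" for i w
  have \<delta>0: "0 \<le> \<delta> i w" for i w using L0 by (simp add: \<delta>_def)
  have \<delta>2: "norm (\<delta> i w) \<le> 2 * L" for i w using \<delta>0[of i w] by (simp add: \<delta>_def)
  have m\<delta>: "\<delta> i \<in> borel_measurable \<mu>" for i
  proof -
    note sm[measurable]
    have [measurable]: "(\<lambda>w. w) \<in> borel_measurable \<mu>" by (rule meas) simp
    show ?thesis unfolding \<delta>_def by measurable
  qed
  have int\<delta>: "integrable \<mu> (\<delta> i)" for i
    by (rule integrable_const_bound[where B="2 * L"]) (use \<delta>2 m\<delta> in auto)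
  have bd: "norm x ^ N * norm (iter_partial ks (\<lambda>x. E i (\<lambda>w. g (pvec x w))) x) \<le> (\<integral>w. \<delta> i w \<partial>\<mu>)"
    if Nk: "N \<le> k" "length ks \<le> k" for N ks x i
  proof -
    define g2 where "g2 = iter_partial (map Inl ks) g"
    have g2: "schwartz g2" unfolding g2_def by (rule schwartz_iter[OF g])
    let ?r = "complex_of_real (norm x ^ N)"
    have b1: "norm (?r * partial_dir (Inr j) g2 (pvec x w)) \<le> L" for j w
    proof -
      have "norm (?r * partial_dir (Inr j) g2 (pvec x w)) \<le> norm (pvec x w) ^ N * norm (iter_partial (Inr j # map Inl ks) g (pvec x w))"
        unfolding norm_mult g2_def iter_partial.simps
        by (rule mult_right_mono) (auto simp: norm_power intro!: power_mono norm_le_norm_pvec)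
      also have "\<dots> \<le> L" unfolding L_def by (rule schwartz_le_seminorm[OF g]) (use Nk in auto)
      finally show ?thesis .
    qed
    have b0: "norm (?r * g2 (pvec x w)) \<le> L" for w
    proof -
      have "norm (?r * g2 (pvec x w)) \<le> norm (pvec x w) ^ N * norm (iter_partial (map Inl ks) g (pvec x w))"
        unfolding norm_mult g2_def
        by (rule mult_right_mono) (auto simp: norm_power intro!: power_mono norm_le_norm_pvec)
      also have "\<dots> \<le> L" unfolding L_def by (rule schwartz_le_seminorm[OF g]) (use Nk in auto)
      finally show ?thesis .
    qed
    have lip: "norm (?r * g2 (pvec x w) - ?r * g2 (pvec x w')) \<le> L * real CARD('n) * norm (w - w')" for w w'
    proof (rule lipschitz_from_partials[where f="\<lambda>w. ?r * g2 (pvec x w)" and f'="\<lambda>j w. ?r * partial_dir (Inr j) g2 (pvec x w)", OF _ b1])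
      fix j w
      show "((\<lambda>t. ?r * g2 (pvec x (w + t *\<^sub>R axis j 1))) has_vector_derivative ?r * partial_dir (Inr j) g2 (pvec x w)) (at 0)"
        using schwartz_deriv[OF g2, of "pvec x w" "Inr j"] unfolding pvec_axis_Inr
        by (rule has_vector_derivative_mult_right)
    qed
    have "norm (?r * g2 (pvec x (s i w)) - ?r * g2 (pvec x w)) \<le> \<delta> i w" for w
      unfolding \<delta>_def
      using lip[of "s i w" w] norm_triangle_ineq4[of "?r * g2 (pvec x (s i w))" "?r * g2 (pvec x w)"] b0[of "s i w"] b0[of w]
      by simp
    then have dom: "norm (?r * (g2 (pvec x (s i w)) - g2 (pvec x w))) \<le> \<delta> i w" for w
      by (simp only: right_diff_distrib)
    have "norm x ^ N * norm (iter_partial ks (\<lambda>x. E i (\<lambda>w. g (pvec x w))) x) = norm (?r * E i (\<lambda>w. g2 (pvec x w)))"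
      unfolding iter_partial_tempered_slice[OF E g] g2_def by (simp add: norm_mult norm_power)
    also have "?r * E i (\<lambda>w. g2 (pvec x w)) = (\<integral>w. ?r * (g2 (pvec x (s i w)) - g2 (pvec x w)) \<partial>\<mu>)"
      unfolding E_def by simp
    also have "norm \<dots> \<le> (\<integral>w. \<delta> i w \<partial>\<mu>)"
      by (rule Bochner_Integration.integral_norm_bound_integral)
        (use dom int\<delta> ints[of "\<lambda>w. g2 (pvec x w)" i] int[OF schwartz_slice[OF g2]] in auto)
    finally show ?thesis .
  qed
  have lim\<delta>: "(\<lambda>i. \<integral>w. \<delta> i w \<partial>\<mu>) \<longlonglongrightarrow> (\<integral>w. 0 \<partial>\<mu>)"
  proof (rule integral_dominated_convergence[where w="\<lambda>_. 2 * L"])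
    show "AE w in \<mu>. (\<lambda>i. \<delta> i w) \<longlonglongrightarrow> 0"
    proof (rule AE_I2)
      fix w
      have "(\<lambda>i. L * real CARD('n) * norm (s i w - w)) \<longlonglongrightarrow> 0"
        using tendsto_mult_right_zero[OF tendsto_norm_zero[OF LIM_zero[OF s(2)[of w]]]] .
      then show "(\<lambda>i. \<delta> i w) \<longlonglongrightarrow> 0"
        by (rule Lim_null_comparison[rotated]) (use L0 in \<open>simp add: \<delta>_def\<close>)
    qed
  qed (use m\<delta> \<delta>2 in auto)
  have "(\<lambda>i. B (R i) - B P) \<longlonglongrightarrow> 0"
  proof (rule Lim_null_comparison)
    show "\<forall>\<^sub>F i in sequentially. norm (B (R i) - B P) \<le> C * (seminorm_const TYPE('n) k * (\<integral>w. \<delta> i w \<partial>\<mu>))"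
    proof (rule always_eventually, rule allI)
      fix i
      have "B (R i) - B P = B (\<lambda>x. E i (\<lambda>w. g (pvec x w)))"
        using tempered_diff[OF B R P] by (simp add: EG)
      moreover have "schwartz_seminorm k (\<lambda>x. E i (\<lambda>w. g (pvec x w))) \<le> seminorm_const TYPE('n) k * (\<integral>w. \<delta> i w \<partial>\<mu>)"
        unfolding seminorm_const_def by (rule schwartz_seminorm_leI) (rule bd)
      ultimately show "norm (B (R i) - B P) \<le> C * (seminorm_const TYPE('n) k * (\<integral>w. \<delta> i w \<partial>\<mu>))"
        using order_trans[OF C(2)[OF SE] mult_left_mono[OF _ C(1)]] by simp
    qed
    show "(\<lambda>i. C * (seminorm_const TYPE('n) k * (\<integral>w. \<delta> i w \<partial>\<mu>))) \<longlonglongrightarrow> 0"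
      using tendsto_mult_right_zero[OF tendsto_mult_right_zero] lim\<delta> by simp
  qed
  then have "(\<lambda>i. B (R i)) \<longlonglongrightarrow> B P" by (rule LIM_zero_cancel)
  with lim1 have "(\<integral>w. H w \<partial>\<mu>) = B P" by (rule LIMSEQ_unique)
  then show ?thesis by (simp add: H_def P_def[abs_def])
qed

text \<open>Lebesgue measure is infinite, so \<open>weight\<close> is moved into the measure, and
  its polynomial reciprocal, taken in the variables w only, into the integrand, which stays
  Schwartz.\<close>

lemma tempered_lborel_interchange:
  fixes G :: "real^('n::finite + 'n) \<Rightarrow> complex"
  assumes B: "tempered B" and G: "schwartz G"
  shows "B (\<lambda>x. \<integral>w. G (pvec w x) \<partial>lborel) = (\<integral>w. B (\<lambda>x. G (pvec w x)) \<partial>lborel)"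
proof -
  define \<mu> where "\<mu> = density lborel (\<lambda>w::real^'n. ennreal (weight w))"
  define I :: "('n + 'n) set" where "I = Inl ` UNIV"
  define F where "F z = complex_of_real (\<Prod>i\<in>I. 1 + (z $ i)\<^sup>2) * G z" for z
  have F: "schwartz F"
    unfolding F_def by (rule diffop_schwartz[OF diffop_weight G]) (simp add: I_def)
  have Fw: "weight w *\<^sub>R F (pvec w x) = G (pvec w x)" for w x
  proof -
    have "(\<Prod>i\<in>I. 1 + (pvec w x $ i)\<^sup>2) = (\<Prod>i\<in>UNIV. 1 + (w $ i)\<^sup>2)"
      unfolding I_def by (subst prod.reindex) auto
    then have "weight w *\<^sub>R F (pvec w x) = complex_of_real (weight w * (\<Prod>i\<in>UNIV. 1 + (w $ i)\<^sup>2)) * G (pvec w x)"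
      unfolding F_def by (simp add: scaleR_conv_of_real mult.assoc)
    then show ?thesis unfolding weight_inverse by simp
  qed
  have sets: "sets \<mu> = sets borel" by (simp add: \<mu>_def)
  have "emeasure \<mu> (space \<mu>) = (\<integral>\<^sup>+w. ennreal (weight w) \<partial>(lborel :: (real^'n) measure))"
    unfolding \<mu>_def by (simp add: emeasure_density)
  also have "\<dots> < \<infinity>"
    using integrable_weight[where 'a='n] weight_pos less_imp_le[OF weight_pos]
    by (simp add: integrable_iff_bounded abs_of_nonneg[OF less_imp_le[OF weight_pos]])
  finally have fin: "finite_measure \<mu>" by (intro finite_measureI) auto
  have dens: "(\<integral>w. f w \<partial>\<mu>) = (\<integral>w. weight w *\<^sub>R f w \<partial>lborel)" if "schwartz f" for f
    unfolding \<mu>_def using schwartz_measurable[OF that] less_imp_le[OF weight_pos]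
    by (intro integral_density) auto
  have "B (\<lambda>x. \<integral>w. F (pvec w x) \<partial>\<mu>) = (\<integral>w. B (\<lambda>x. F (pvec w x)) \<partial>\<mu>)"
    by (rule tempered_finite_measure_interchange[OF fin sets B F])
  moreover have "(\<integral>w. F (pvec w x) \<partial>\<mu>) = (\<integral>w. G (pvec w x) \<partial>lborel)" for x
    by (simp only: dens[OF schwartz_slice'[OF F]] Fw)
  moreover have "(\<integral>w. B (\<lambda>x. F (pvec w x)) \<partial>\<mu>) = (\<integral>w. B (\<lambda>x. G (pvec w x)) \<partial>lborel)"
  proof -
    have "weight w *\<^sub>R B (\<lambda>x. F (pvec w x)) = B (\<lambda>x. G (pvec w x))" for w
      using tempered_scale[OF B schwartz_slice[OF F], of "complex_of_real (weight w)" w] Fw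
      by (simp add: scaleR_conv_of_real)
    then show ?thesis by (simp only: dens[OF schwartz_tempered_slice[OF B F]])
  qed
  ultimately show ?thesis by simp
qed

section \<open>Gaussian functions and their Fourier transforms\<close>

definition gauss :: "real \<Rightarrow> real^'m::finite \<Rightarrow> complex" where
  "gauss c x = complex_of_real (exp (- c * (x \<bullet> x)))"

lemma schwartz_gauss': "c > 0 \<Longrightarrow> schwartz (gauss c)"
  unfolding gauss_def[abs_def] by (rule schwartz_gauss)

lemma gauss_zero [simp]: "gauss c 0 = 1" by (simp add: gauss_def)
lemma gauss_nonzero: "gauss c x \<noteq> 0" by (simp add: gauss_def)
lemma gauss_scaleR: "gauss c (r *\<^sub>R x) = gauss (c * r\<^sup>2) x"
  by (simp add: gauss_def power2_eq_square mult.assoc)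
lemma gauss_mult: "gauss c x * gauss d x = gauss (c + d) x"
  by (simp add: gauss_def left_diff_distrib flip: exp_add of_real_mult)
lemma gauss_pvec: "gauss c z = gauss c (xpart z) * gauss c (ppart z)"
  unfolding gauss_def inner_parts[of z z] by (simp add: distrib_left exp_add[symmetric] flip: of_real_mult)

text \<open>A rescaled form of the characteristic function of the standard normal distribution: the
  dilation by 1 / sqrt (2 a) turns exp (- a x^2) into exp (- x^2 / 2).\<close>

lemma gauss_ft_1d:
  assumes "a > (0::real)"
  shows "(\<integral>x. exp (- \<i> * complex_of_real (s * x)) * complex_of_real (exp (- a * x\<^sup>2)) \<partial>lborel)
    = complex_of_real (sqrt (pi / a) * exp (- s\<^sup>2 / (4 * a)))"
proof -
  have std: "(\<integral>x. std_normal_density x *\<^sub>R exp (\<i> * complex_of_real (t * x)) \<partial>lborel) = complex_of_real (exp (- t\<^sup>2 / 2))" for t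
  proof -
    have "complex_of_real (exp (- t\<^sup>2 / 2)) = (\<integral>x. exp (\<i> * complex_of_real (t * x)) \<partial>std_normal_distribution)"
      using fun_cong[OF char_std_normal_distribution, of t] by (simp add: char_def)
    also have "\<dots> = (\<integral>x. std_normal_density x *\<^sub>R exp (\<i> * complex_of_real (t * x)) \<partial>lborel)"
      by (rule integral_density) (auto simp: normal_density_nonneg)
    finally show ?thesis by simp
  qed
  define c where "c = 1 / sqrt (2 * a)"
  have c: "c > 0" "c\<^sup>2 = 1 / (2 * a)" using assms by (simp_all add: c_def power_divide)
  let ?f = "\<lambda>x. exp (- \<i> * complex_of_real (s * x)) * complex_of_real (exp (- a * x\<^sup>2))"
  have f: "?f (0 + c * x) = complex_of_real (sqrt (2 * pi)) * (std_normal_density x *\<^sub>R exp (\<i> * complex_of_real ((- s * c) * x)))" for x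
    using c(2) assms by (simp add: std_normal_density_def power_mult_distrib scaleR_conv_of_real mult_ac)
  have "(\<integral>x. ?f x \<partial>lborel) = \<bar>c\<bar> *\<^sub>R (\<integral>x. ?f (0 + c * x) \<partial>lborel)"
    by (rule lborel_integral_real_affine) (use c in simp)
  also have "\<dots> = \<bar>c\<bar> *\<^sub>R (complex_of_real (sqrt (2 * pi)) * complex_of_real (exp (- (- s * c)\<^sup>2 / 2)))"
    unfolding f by (subst integral_mult_right_zero) (simp only: std)
  also have "\<dots> = complex_of_real (c * sqrt (2 * pi) * exp (- (s\<^sup>2 * c\<^sup>2) / 2))"
    using c(1) by (simp add: scaleR_conv_of_real power_mult_distrib)
  also have "c * sqrt (2 * pi) = sqrt (pi / a)"
    using assms by (simp add: c_def real_sqrt_divide real_sqrt_mult)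
  also have "- (s\<^sup>2 * c\<^sup>2) / 2 = - s\<^sup>2 / (4 * a)" by (simp add: c(2))
  finally show ?thesis .
qed

lemma integrable_gauss_1d:
  assumes "a > (0::real)"
  shows "integrable lborel (\<lambda>x::real. exp (- \<i> * complex_of_real (s * x)) * complex_of_real (exp (- a * x\<^sup>2)))"
proof (rule Bochner_Integration.integrable_bound)
  define \<sigma> where "\<sigma> = sqrt (1 / (2 * a))"
  have \<sigma>: "\<sigma> > 0" "\<sigma>\<^sup>2 = 1 / (2 * a)" using assms by (simp_all add: \<sigma>_def)
  show "integrable lborel (\<lambda>x. sqrt (2 * pi * \<sigma>\<^sup>2) * normal_density 0 \<sigma> x)"
    using integrable_normal_density[OF \<sigma>(1), of 0] by simp
  have "sqrt (2 * pi * \<sigma>\<^sup>2) * normal_density 0 \<sigma> x = exp (- a * x\<^sup>2)" for x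
    using assms by (simp add: normal_density_def \<sigma>(2))
  then show "AE x in lborel. norm (exp (- \<i> * complex_of_real (s * x)) * complex_of_real (exp (- a * x\<^sup>2)))
      \<le> norm (sqrt (2 * pi * \<sigma>\<^sup>2) * normal_density 0 \<sigma> x)"
    by (simp add: norm_mult)
qed measurable

lemma gauss_ft:
  fixes p :: "real^'m::finite"
  assumes "a > 0"
  shows "(\<integral>y. exp (- \<i> * complex_of_real (p \<bullet> y)) * gauss a y \<partial>lborel)
    = complex_of_real (sqrt (pi / a) ^ CARD('m)) * gauss (1 / (4 * a)) p"
proof -
  define f where "f i t = exp (- \<i> * complex_of_real (p $ i * t)) * complex_of_real (exp (- a * t\<^sup>2))" for i t
  have int: "integrable lborel (f i)" for i unfolding f_def by (rule integrable_gauss_1d[OF assms])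
  have "exp (- \<i> * complex_of_real (p \<bullet> y)) * gauss a y = (\<Prod>i\<in>UNIV. f i (y $ i))" for y :: "real^'m"
  proof -
    have "exp (- \<i> * complex_of_real (p \<bullet> y)) = (\<Prod>i\<in>UNIV. exp (- \<i> * complex_of_real (p $ i * y $ i)))"
      by (simp add: inner_vec_def sum_distrib_left flip: exp_sum sum_negf)
    moreover have "exp (- a * (y \<bullet> y)) = (\<Prod>i\<in>UNIV. exp (- a * (y $ i)\<^sup>2))"
      by (simp add: inner_vec_def sum_distrib_left power2_eq_square flip: exp_sum sum_negf)
    ultimately show ?thesis unfolding f_def prod.distrib gauss_def by simp
  qed
  then have "(\<integral>y. exp (- \<i> * complex_of_real (p \<bullet> y)) * gauss a y \<partial>lborel) = (\<Prod>i\<in>UNIV. \<integral>t. f i t \<partial>lborel)"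
    using integral_prod_coord[OF int] by simp
  also have "\<dots> = (\<Prod>i\<in>UNIV. complex_of_real (sqrt (pi / a)) * complex_of_real (exp (- (p $ i)\<^sup>2 / (4 * a))))"
    unfolding f_def gauss_ft_1d[OF assms] by simp
  also have "\<dots> = complex_of_real (sqrt (pi / a) ^ CARD('m)) * complex_of_real (exp (\<Sum>i\<in>UNIV. - (p $ i)\<^sup>2 / (4 * a)))"
    unfolding prod.distrib by (simp add: exp_sum)
  also have "(\<Sum>i\<in>UNIV. - (p $ i)\<^sup>2 / (4 * a)) = - (1 / (4 * a)) * (p \<bullet> p)"
    by (simp add: inner_vec_def sum_divide_distrib sum_negf power2_eq_square)
  finally show ?thesis unfolding gauss_def .
qed

lemma gauss_integral:
  assumes "a > 0"
  shows "(\<integral>y. gauss a (y::real^'m::finite) \<partial>lborel) = complex_of_real (sqrt (pi / a) ^ CARD('m))"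
  using gauss_ft[OF assms, of "0::real^'m"] by simp

text \<open>As j grows, F is evaluated ever closer to 0, with a multiple of the norm of k as
  majorant. This takes the place of an approximate identity, both in \<open>tempered_fubini\<close>
  and in the inversion formula.\<close>

lemma gauss_scaling_limit:
  fixes F :: "real^'m::finite \<Rightarrow> complex"
  assumes F: "continuous_on UNIV F" "\<And>x. norm (F x) \<le> B" and k: "schwartz k"
  shows "(\<lambda>j::nat. \<integral>y. k y * F ((1 / real (Suc j)) *\<^sub>R y) \<partial>lborel) \<longlonglongrightarrow> F 0 * (\<integral>y. k y \<partial>lborel)"
proof -
  have [measurable]: "k \<in> borel_measurable borel" by (rule schwartz_measurable[OF k])
  have [measurable]: "F \<in> borel_measurable borel" by (rule borel_measurable_continuous_onI[OF F(1)])
  have "(\<lambda>j::nat. \<integral>y. k y * F ((1 / real (Suc j)) *\<^sub>R y) \<partial>lborel) \<longlonglongrightarrow> (\<integral>y. k y * F 0 \<partial>lborel)"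
  proof (rule integral_dominated_convergence[where w="\<lambda>y. norm (k y) * B"])
    show "integrable lborel (\<lambda>y. norm (k y) * B)" using schwartz_integrable[OF k] by simp
    show "AE y in lborel. (\<lambda>j. k y * F ((1 / real (Suc j)) *\<^sub>R y)) \<longlonglongrightarrow> k y * F 0"
    proof (rule AE_I2)
      fix y :: "real^'m"
      have "(\<lambda>j. (1 / real (Suc j)) *\<^sub>R y) \<longlonglongrightarrow> 0 *\<^sub>R y"
        by (rule tendsto_scaleR[OF LIMSEQ_Suc[OF lim_1_over_n[where 'a=real]] tendsto_const])
      then have "(\<lambda>j. (1 / real (Suc j)) *\<^sub>R y) \<longlonglongrightarrow> 0" by simp
      then show "(\<lambda>j. k y * F ((1 / real (Suc j)) *\<^sub>R y)) \<longlonglongrightarrow> k y * F 0"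
        using F(1) by (intro tendsto_mult tendsto_const continuous_on_tendsto_compose[where s=UNIV and f=F]) auto
    qed
    show "AE y in lborel. norm (k y * F ((1 / real (Suc j)) *\<^sub>R y)) \<le> norm (k y) * B" for j
      by (auto simp: norm_mult intro!: mult_left_mono F(2))
  qed measurable
  then show ?thesis by (simp add: mult.commute)
qed

section \<open>Fubini's theorem for tempered distributions\<close>

lemma schwartz_op_swap:
  "schwartz_op (\<lambda>g z. g (pvec (ppart z) (xpart z)))"
proof -
  have "linear (\<lambda>z. pvec (ppart z) (xpart z))"
    by (rule linearI) (simp_all add: parts_add parts_scaleR pvec_add pvec_scaleR)
  moreover have "inj (\<lambda>z. pvec (ppart z) (xpart z))"
    by (rule injI) (metis pvec_eq_iff pvec_parts)
  ultimately show ?thesis using schwartz_op_affine[of "\<lambda>z. pvec (ppart z) (xpart z)" 0] by simp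
qed

text \<open>The difference D of the two iterated distributions vanishes on tensor products, hence on the
  convolutions of g with Gaussians; these approximate g.\<close>

theorem tempered_fubini:
  fixes g :: "real^('n::finite + 'n) \<Rightarrow> complex"
  assumes T: "tempered T" and U: "tempered U" and g: "schwartz g"
  shows "T (\<lambda>u. U (\<lambda>v. g (pvec u v))) = U (\<lambda>v. T (\<lambda>u. g (pvec u v)))"
proof -
  define D where "D g = T (\<lambda>u. U (\<lambda>v. g (pvec u v))) - U (\<lambda>v. T (\<lambda>u. g (pvec u v)))"
    for g :: "real^('n + 'n) \<Rightarrow> complex"
  have "tempered (\<lambda>g. U (\<lambda>u. T (\<lambda>v. (\<lambda>z. g (pvec (ppart z) (xpart z))) (pvec u v))))"
    by (rule tempered_comp[OF tempered_iterated[OF U T] schwartz_op_swap]) simp_all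
  then have D: "tempered D"
    unfolding D_def using tempered_minus[OF tempered_iterated[OF T U]] by simp
  have tensor: "D (\<lambda>z. f (xpart z) * k (ppart z)) = 0" if "schwartz f" "schwartz k" for f k
  proof -
    have "T (\<lambda>u. U (\<lambda>v. f u * k v)) = T (\<lambda>u. U k * f u)"
      using tempered_scale[OF U that(2)] by (simp add: mult.commute)
    also have "\<dots> = U k * T f" by (rule tempered_scale[OF T that(1)])
    also have "\<dots> = U (\<lambda>v. T f * k v)" using tempered_scale[OF U that(2)] by (simp add: mult.commute)
    also have "(\<lambda>v. T f * k v) = (\<lambda>v. T (\<lambda>u. k v * f u))"
      by (rule ext) (subst tempered_scale[OF T that(1)], rule mult.commute)
    finally show ?thesis by (simp add: D_def mult.commute)
  qed
  \<comment> \<open>A translated Gaussian on phase space is a tensor product of translated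
    Gaussians.\<close>
  have shift: "D (\<lambda>x. gauss c (x - w)) = 0" if "c > 0" for c w
  proof -
    have s: "schwartz (\<lambda>u. gauss c (u - b))" for b :: "real^'n"
      using schwartz_affine[OF linear_id inj_on_id schwartz_gauss'[OF that], of "- b"] by simp
    show ?thesis
      using tensor[OF s[of "xpart w"] s[of "ppart w"]] by (simp add: gauss_pvec[of c "_ - w"] parts_diff)
  qed
  \<comment> \<open>\<open>h 0\<close> is the value \<open>D g\<close> that has to vanish;
    \<open>int0\<close> will say that h integrates to 0 against every centred Gaussian.\<close>
  define h where "h y = D (\<lambda>x. g (x - y))" for y
  have lin: "linear (\<lambda>z. pvec (xpart z) (ppart z - xpart z))" "inj (\<lambda>z. pvec (xpart z) (ppart z - xpart z))"
    by (auto intro!: linearI injI simp: parts_add parts_scaleR pvec_add pvec_scaleR scaleR_diff_right)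
      (metis pvec_parts)
  have tens: "schwartz (\<lambda>z. f (xpart z) * k (ppart z - xpart z))"
    if "schwartz f" "schwartz k" for f k :: "real^('n + 'n) \<Rightarrow> complex"
    using schwartz_linear[OF lin schwartz_tensor[OF that]] by simp
  \<comment> \<open>The convolution of g with a Gaussian is written in two ways. With the
    integration variable as argument of g, D sees translated Gaussians and gives 0; after the
    reflection it sees translates of g and gives h.\<close>
  have int0: "(\<integral>y. gauss c y * h y \<partial>lborel) = 0" if c: "c > 0" for c
  proof -
    have "D (\<lambda>x. \<integral>w. g w * gauss c (x - w) \<partial>lborel) = (\<integral>w. D (\<lambda>x. g w * gauss c (x - w)) \<partial>lborel)"
      using tempered_lborel_interchange[OF D tens[OF g schwartz_gauss'[OF c]]] by simp
    moreover have "D (\<lambda>x. g w * gauss c (x - w)) = 0" for w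
      using tempered_scale[OF D schwartz_affine[OF linear_id inj_on_id schwartz_gauss'[OF c], of "- w"], of "g w"]
        shift[OF c, of w] by simp
    ultimately have 1: "D (\<lambda>x. \<integral>w. g w * gauss c (x - w) \<partial>lborel) = 0" by simp
    have "(\<integral>w. g w * gauss c (x - w) \<partial>lborel) = (\<integral>y. gauss c y * g (x - y) \<partial>lborel)" for x
    proof -
      note schwartz_measurable[OF g, measurable]
      have [measurable]: "gauss c \<in> borel_measurable (borel :: (real^('n + 'n)) measure)"
        by (rule schwartz_measurable[OF schwartz_gauss'[OF c]])
      have "(\<lambda>w. g w * gauss c (x - w)) \<in> borel_measurable borel" by measurable
      from lborel_integral_reflect[OF this, of x] show ?thesis by (simp add: mult.commute)
    qed
    then have "D (\<lambda>x. \<integral>y. gauss c y * g (x - y) \<partial>lborel) = 0" using 1 by simp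
    moreover have "D (\<lambda>x. \<integral>y. gauss c y * g (x - y) \<partial>lborel) = (\<integral>y. D (\<lambda>x. gauss c y * g (x - y)) \<partial>lborel)"
      using tempered_lborel_interchange[OF D tens[OF schwartz_gauss'[OF c] g]] by simp
    moreover have "D (\<lambda>x. gauss c y * g (x - y)) = gauss c y * h y" for y
      unfolding h_def
      using tempered_scale[OF D schwartz_affine[OF linear_id inj_on_id g, of "- y"]] by simp
    ultimately show ?thesis by simp
  qed
  \<comment> \<open>The Gaussian factor makes h a Schwartz function, hence continuous and bounded,
    and leaves its value at 0 unchanged.\<close>
  define F where "F y = gauss 1 y * h y" for y
  have "schwartz (\<lambda>y. D (\<lambda>x. gauss 1 y * g (x - y)))"
    using schwartz_tempered_slice[OF D tens[OF schwartz_gauss'[of 1] g]] by simp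
  moreover have "D (\<lambda>x. gauss 1 y * g (x - y)) = F y" for y
    unfolding h_def F_def
    using tempered_scale[OF D schwartz_affine[OF linear_id inj_on_id g, of "- y"]] by simp
  ultimately have F: "schwartz F" by simp
  obtain B where B: "\<And>x. norm (F x) \<le> B" using schwartz_bounded[OF F] by blast
  \<comment> \<open>After the dilation by j + 1 the two Gaussians merge into one with coefficient (j
    + 1)^2 + 1, to which \<open>int0\<close> applies.\<close>
  have z: "(\<integral>y. gauss 1 y * F ((1 / real (Suc j)) *\<^sub>R y) \<partial>lborel) = 0" for j
  proof -
    note schwartz_measurable[OF F, measurable]
    have [measurable]: "gauss 1 \<in> borel_measurable (borel :: (real^('n + 'n)) measure)"
      by (rule schwartz_measurable[OF schwartz_gauss']) simp
    let ?c = "real (Suc j)"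
    have m: "(\<lambda>y. gauss 1 y * F ((1 / ?c) *\<^sub>R y)) \<in> borel_measurable borel" by measurable
    have "gauss 1 (?c *\<^sub>R y) * F y = gauss (?c\<^sup>2 + 1) y * h y" for y
      by (simp add: F_def gauss_scaleR gauss_mult flip: mult.assoc)
    then have "(\<integral>y. gauss 1 (?c *\<^sub>R y) * F y \<partial>lborel) = 0"
      using int0[of "?c\<^sup>2 + 1"] by (simp add: add_pos_nonneg)
    then show ?thesis
      using lborel_integral_affine[OF _ m, of ?c 0] by simp
  qed
  have "(\<lambda>j. 0) \<longlonglongrightarrow> F 0 * (\<integral>y. gauss 1 (y :: real^('n + 'n)) \<partial>lborel)"
    using gauss_scaling_limit[OF schwartz_continuous[OF F] B schwartz_gauss'[of 1]] z by simp
  then have "F 0 * (\<integral>y. gauss 1 (y :: real^('n + 'n)) \<partial>lborel) = 0"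
    by (simp add: LIMSEQ_const_iff)
  then have "D g = 0" unfolding gauss_integral[OF zero_less_one] by (simp add: F_def h_def)
  then show ?thesis by (simp add: D_def)
qed

section \<open>The Fourier transform\<close>

text \<open>Left unnormalised, so that the constants of \<open>wig_kernel\<close> and
  \<open>mp_J\<close> appear as separate factors.\<close>

definition ft :: "real \<Rightarrow> (real^'m::finite \<Rightarrow> complex) \<Rightarrow> real^'m \<Rightarrow> complex" where
  "ft h f y = (\<integral>p. exp (- \<i> * complex_of_real (p \<bullet> y / h)) * f p \<partial>lborel)"

lemma ft_kernel_measurable [measurable]:
  "(\<lambda>p::real^'m::finite. exp (- \<i> * complex_of_real (p \<bullet> y / h))) \<in> borel_measurable borel"
  unfolding divide_inverse by (intro borel_measurable_continuous_onI continuous_intros)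

lemma ft_kernel_norm [simp]: "norm (exp (- \<i> * complex_of_real r)) = 1"
proof -
  have "- \<i> * complex_of_real r = \<i> * complex_of_real (- r)" by simp
  then show ?thesis using norm_exp_i_times by metis
qed

lemma integrable_ft: "schwartz f \<Longrightarrow> integrable lborel (\<lambda>p. exp (- \<i> * complex_of_real (p \<bullet> y / h)) * f p)"
  by (rule integrable_bounded_mult_schwartz[OF ft_kernel_measurable, of _ _ 1]) simp_all

lemma tempered_ft: "tempered (\<lambda>f. ft h f y)"
  unfolding ft_def by (rule tempered_bounded_integral[OF ft_kernel_measurable, of _ _ 1]) simp

lemma ft_bound:
  obtains C m where "C \<ge> 0" "\<And>f (y::real^'m::finite). schwartz f \<Longrightarrow> norm (ft h f y) \<le> C * schwartz_seminorm m f"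
proof -
  obtain C m where C: "C \<ge> 0" "\<And>f x. schwartz (f :: real^'m \<Rightarrow> complex) \<Longrightarrow> norm (f x) \<le> C * schwartz_seminorm m f * weight x"
    using schwartz_le_weight by blast
  let ?I = "\<integral>x. weight x \<partial>(lborel :: (real^'m) measure)"
  have "norm (ft h f y) \<le> (C * ?I) * schwartz_seminorm m f" if f: "schwartz f" for f and y :: "real^'m"
  proof -
    have "norm (ft h f y) \<le> (\<integral>x. C * schwartz_seminorm m f * weight x \<partial>(lborel :: (real^'m) measure))"
      unfolding ft_def
      by (rule Bochner_Integration.integral_norm_bound_integral)
        (use C(2)[OF f] integrable_ft[OF f] integrable_weight[where 'a='m] in \<open>auto simp: norm_mult\<close>)
    then show ?thesis by (simp add: mult_ac)
  qed
  moreover have "0 \<le> ?I" by (rule Bochner_Integration.integral_nonneg) (simp add: less_imp_le[OF weight_pos])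
  ultimately show ?thesis using that[of "C * ?I" m] C(1) by simp
qed

text \<open>Expanding a phase exp (\<i> \<theta>) to first order costs at most \<theta>^2, so the
  remainder is dominated by t^2 times the integrable function \<open>f2\<close>.\<close>

lemma ft_deriv:
  assumes f: "schwartz f"
  shows "((\<lambda>t. ft h f (y + t *\<^sub>R axis j 1)) has_vector_derivative
     ft h (\<lambda>p. (- \<i> * complex_of_real (1 / h)) * (complex_of_real (p $ j) * f p)) y) (at 0)"
proof -
  let ?e = "\<lambda>y p. exp (- \<i> * complex_of_real (p \<bullet> y / h))"
  define f1 where "f1 p = (- \<i> * complex_of_real (1 / h)) * (complex_of_real (p $ j) * f p)" for p
  have f1: "schwartz f1" unfolding f1_def by (intro schwartz_scale schwartz_coord f)
  define f2 where "f2 p = complex_of_real (1 / h\<^sup>2) * (complex_of_real (p $ j) * (complex_of_real (p $ j) * f p))" for p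
  have f2: "schwartz f2" unfolding f2_def by (intro schwartz_scale schwartz_coord f)
  have f2n: "norm (f2 p) = (p $ j / h)\<^sup>2 * norm (f p)" for p
    by (simp add: f2_def norm_mult norm_divide power2_eq_square)
  have "norm (ft h f (y + t *\<^sub>R axis j 1) - ft h f (y + 0 *\<^sub>R axis j 1) - t *\<^sub>R ft h f1 y) \<le> (\<integral>p. norm (f2 p) \<partial>lborel) * t\<^sup>2" for t
  proof -
    have pt: "norm (?e (y + t *\<^sub>R axis j 1) p * f p - ?e y p * f p - t *\<^sub>R (?e y p * f1 p)) \<le> norm (f2 p) * t\<^sup>2" for p
    proof -
      define \<theta> where "\<theta> = - (t * p $ j / h)"
      have ex: "?e (y + t *\<^sub>R axis j 1) p = ?e y p * exp (\<i> * complex_of_real \<theta>)"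
        by (simp add: \<theta>_def inner_add_right inner_axis add_divide_distrib distrib_left exp_add[symmetric] algebra_simps)
      have "?e (y + t *\<^sub>R axis j 1) p * f p - ?e y p * f p - t *\<^sub>R (?e y p * f1 p)
        = ?e y p * f p * (exp (\<i> * complex_of_real \<theta>) - (1 + \<i> * complex_of_real \<theta>))"
        unfolding ex f1_def by (simp add: \<theta>_def scaleR_conv_of_real algebra_simps)
      then have "norm (?e (y + t *\<^sub>R axis j 1) p * f p - ?e y p * f p - t *\<^sub>R (?e y p * f1 p))
         = norm (f p) * norm (exp (\<i> * complex_of_real \<theta>) - (1 + \<i> * complex_of_real \<theta>))"
        by (simp only: norm_mult ft_kernel_norm mult_1_left)
      also have "\<dots> \<le> norm (f p) * \<theta>\<^sup>2"
      proof (rule mult_left_mono)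
        have "norm (exp (\<i> * complex_of_real \<theta>) - (1 + \<i> * complex_of_real \<theta>)) \<le> \<bar>\<theta>\<bar> ^ Suc 1 / fact (Suc 1)"
          using iexp_approx1[of \<theta> 1] by simp
        also have "\<dots> \<le> \<theta>\<^sup>2" by (simp add: power2_eq_square)
        finally show "norm (exp (\<i> * complex_of_real \<theta>) - (1 + \<i> * complex_of_real \<theta>)) \<le> \<theta>\<^sup>2" .
      qed simp
      also have "\<dots> = norm (f2 p) * t\<^sup>2" unfolding f2n by (simp add: \<theta>_def power_divide power_mult_distrib)
      finally show ?thesis .
    qed
    have "norm (ft h f (y + t *\<^sub>R axis j 1) - ft h f y - t *\<^sub>R ft h f1 y)
        = norm (\<integral>p. ?e (y + t *\<^sub>R axis j 1) p * f p - ?e y p * f p - t *\<^sub>R (?e y p * f1 p) \<partial>lborel)"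
      unfolding ft_def using integrable_ft[OF f] integrable_ft[OF f1] by simp
    also have "\<dots> \<le> (\<integral>p. norm (f2 p) * t\<^sup>2 \<partial>lborel)"
      by (rule Bochner_Integration.integral_norm_bound_integral)
        (use integrable_ft[OF f] integrable_ft[OF f1] schwartz_integrable[OF f2] pt in auto)
    finally show ?thesis by simp
  qed
  then show ?thesis unfolding f1_def[symmetric] by (rule has_vector_derivative_from_quadratic)
qed

text \<open>Translation invariance of the integral, differentiated; the Gaussian factor makes the
  family of translates a Schwartz function of both variables.\<close>

lemma integral_partial_zero:
  fixes f :: "real^'n::finite \<Rightarrow> complex"
  assumes f: "schwartz f"
  shows "(\<integral>x. partial_dir i f x \<partial>lborel) = 0"
proof -
  define G where "G z = gauss 1 (xpart z) * f (xpart z + ppart z)" for z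
  have lin: "linear (\<lambda>z. pvec (xpart z) (xpart z + ppart z))" "inj (\<lambda>z. pvec (xpart z) (xpart z + ppart z))"
    by (auto intro!: linearI injI simp: parts_add parts_scaleR pvec_add pvec_scaleR scaleR_add_right)
      (metis pvec_parts)
  have G: "schwartz G"
    unfolding G_def using schwartz_linear[OF lin schwartz_tensor[OF schwartz_gauss'[of 1] f]] by simp
  \<comment> \<open>The auxiliary Gaussian has value 1 and derivative 0 at the origin, so it
    disappears from the derivative at t = 0.\<close>
  have gd: "((\<lambda>t. gauss 1 (t *\<^sub>R axis i 1 :: real^'n)) has_vector_derivative 0) (at 0)"
  proof -
    have "((\<lambda>t. exp (- (t * t))) has_real_derivative 0) (at 0)" by (auto intro!: derivative_eq_intros)
    then have "((\<lambda>t. complex_of_real (exp (- (t * t)))) has_vector_derivative complex_of_real 0) (at 0)"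
      by (intro has_vector_derivative_of_real) (simp add: has_real_derivative_iff_has_vector_derivative)
    then show ?thesis by (simp add: gauss_def inner_axis)
  qed
  have pG: "partial_dir (Inl i) G (pvec 0 v) = partial_dir i f v" for v
  proof -
    have "((\<lambda>t. gauss 1 (t *\<^sub>R axis i 1 :: real^'n) * f (v + t *\<^sub>R axis i 1)) has_vector_derivative
        gauss 1 (0 *\<^sub>R axis i 1 :: real^'n) * partial_dir i f v + 0 * f (v + 0 *\<^sub>R axis i 1)) (at 0)"
      by (rule has_vector_derivative_mult[OF gd schwartz_deriv[OF f]])
    then have "((\<lambda>t. G (pvec 0 v + t *\<^sub>R axis (Inl i) 1)) has_vector_derivative partial_dir i f v) (at 0)"
      by (simp add: G_def pvec_axis_Inl add.commute)
    then show ?thesis unfolding partial_dir_def[of "Inl i"] by (rule vector_derivative_at)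
  qed
  have "((\<lambda>t. \<integral>v. G (pvec (0 + t *\<^sub>R axis i 1) v) \<partial>lborel) has_vector_derivative (\<integral>v. partial_dir (Inl i) G (pvec 0 v) \<partial>lborel)) (at 0)"
    by (rule has_vector_derivative_tempered_slice[OF tempered_integral G])
  moreover have "(\<integral>v. G (pvec (0 + t *\<^sub>R axis i 1) v) \<partial>lborel) = gauss 1 (t *\<^sub>R axis i 1 :: real^'n) * (\<integral>v. f v \<partial>lborel)" for t
    unfolding G_def using lborel_integral_translate[OF schwartz_measurable[OF f], of "t *\<^sub>R axis i 1"] by simp
  moreover have "((\<lambda>t. gauss 1 (t *\<^sub>R axis i 1 :: real^'n) * (\<integral>v. f v \<partial>lborel)) has_vector_derivative 0 * (\<integral>v. f v \<partial>lborel)) (at 0)"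
    by (rule has_vector_derivative_mult_left[OF gd])
  ultimately have "(\<integral>v. partial_dir (Inl i) G (pvec 0 v) \<partial>lborel) = 0 * (\<integral>v. f v \<partial>lborel)"
    by (metis (no_types, lifting) ext vector_derivative_unique_at)
  then show ?thesis by (simp add: pG)
qed

text \<open>A linear phase is a chirp whose quadratic part vanishes.\<close>

lemma ft_kernel_schwartz:
  fixes f :: "real^'m::finite \<Rightarrow> complex"
  assumes "schwartz f"
  shows "schwartz (\<lambda>p. exp (- \<i> * complex_of_real (p \<bullet> y / h)) * f p)"
proof -
  have "((\<lambda>t. - ((x + t *\<^sub>R axis i 1) \<bullet> y / h)) has_real_derivative - (y $ i / h) + (\<Sum>j\<in>UNIV. 0 * x $ j)) (at 0)"
    for x :: "real^'m" and i
  proof -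
    obtain k where k: "inverse h = k" by blast
    show ?thesis unfolding divide_inverse k
      by (auto intro!: derivative_eq_intros simp: inner_add_left inner_axis inner_commute[of "axis i 1"])
  qed
  from schwartz_op_schwartz[OF schwartz_op_chirp[OF this] assms] show ?thesis by simp
qed

text \<open>Integration by parts. The constant stays inside the transform, so that multiplication by
  a coordinate is again of the form \<open>ft h\<close> after a \<open>diffop\<close>.\<close>

lemma ft_mult_coord:
  fixes f :: "real^'m::finite \<Rightarrow> complex"
  assumes f: "schwartz f" and h: "h \<noteq> 0"
  shows "ft h (\<lambda>p. (- \<i> * complex_of_real h) * partial_dir j f p) y = complex_of_real (y $ j) * ft h f y"
proof -
  let ?e = "\<lambda>p. exp (- \<i> * complex_of_real (p \<bullet> y / h))"
  let ?c = "- \<i> * complex_of_real (y $ j / h)"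
  have ed: "((\<lambda>t. ?e (x + t *\<^sub>R axis j 1)) has_vector_derivative ?c * ?e x) (at 0)" for x
  proof -
    have "((\<lambda>t. - \<i> * complex_of_real ((x + t *\<^sub>R axis j 1) \<bullet> y / h)) has_vector_derivative ?c) (at 0)"
    proof -
      obtain k where k: "inverse h = k" by blast
      have "((\<lambda>t. (x + t *\<^sub>R axis j 1) \<bullet> y / h) has_real_derivative y $ j / h) (at 0)"
        unfolding divide_inverse k by (auto intro!: derivative_eq_intros simp: inner_add_left inner_axis inner_commute[of "axis j 1"])
      then show ?thesis
        by (rule has_vector_derivative_mult_right[OF has_vector_derivative_of_real])
    qed
    then have "(exp \<circ> (\<lambda>t. - \<i> * complex_of_real ((x + t *\<^sub>R axis j 1) \<bullet> y / h)) has_vector_derivative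
        ?c * exp (- \<i> * complex_of_real ((x + 0 *\<^sub>R axis j 1) \<bullet> y / h))) (at 0)"
      by (rule field_vector_diff_chain_at) (rule DERIV_exp)
    then show ?thesis by (simp add: o_def)
  qed
  have pd: "partial_dir j (\<lambda>p. ?e p * f p) = (\<lambda>p. ?e p * partial_dir j f p + ?c * (?e p * f p))"
  proof (rule partial_dir_eqI)
    fix x
    from has_vector_derivative_mult[OF ed[of x] schwartz_deriv[OF f, of x j]]
    show "((\<lambda>t. ?e (x + t *\<^sub>R axis j 1) * f (x + t *\<^sub>R axis j 1)) has_vector_derivative
      ?e x * partial_dir j f x + ?c * (?e x * f x)) (at 0)" by (simp add: mult.assoc)
  qed
  have "0 = (\<integral>p. ?e p * partial_dir j f p + ?c * (?e p * f p) \<partial>lborel)"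
    using integral_partial_zero[OF ft_kernel_schwartz[OF f, of y h], of j] unfolding pd by simp
  also have "\<dots> = ft h (partial_dir j f) y + ?c * ft h f y"
    unfolding ft_def using integrable_ft[OF f, of y h] integrable_ft[OF schwartz_partial[OF f], of y h j]
    by (subst Bochner_Integration.integral_add) auto
  finally have "ft h (partial_dir j f) y = - (?c * ft h f y)" by (simp add: eq_neg_iff_add_eq_0)
  then have "(- \<i> * complex_of_real h) * ft h (partial_dir j f) y = complex_of_real (y $ j) * ft h f y"
    using h by (simp add: field_simps)
  then show ?thesis using tempered_scale[OF tempered_ft schwartz_partial[OF f]] by metis
qed

lemma schwartz_op_ft:
  assumes h: "h \<noteq> 0"
  shows "schwartz_op (ft h :: (real^'m::finite \<Rightarrow> complex) \<Rightarrow> _)"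
proof -
  have "schwartz_op (\<lambda>f::real^'m \<Rightarrow> complex. ft h ((\<lambda>f. f) f))"
  proof (rule schwartz_op_coinduct[where P="\<lambda>A. \<exists>B. diffop B \<and> A = (\<lambda>f. ft h (B f))"])
    fix A and i :: 'm assume "\<exists>B. diffop B \<and> A = (\<lambda>f::real^'m \<Rightarrow> complex. ft h (B f))"
    then obtain B where B: "diffop B" "A = (\<lambda>f::real^'m \<Rightarrow> complex. ft h (B f))" by blast
    have SB: "schwartz (B f)" if "schwartz f" for f by (rule diffop_schwartz[OF B(1) that])
    obtain C k where C: "C \<ge> 0" "\<And>f (y::real^'m). schwartz f \<Longrightarrow> norm (ft h f y) \<le> C * schwartz_seminorm k f"
      using ft_bound[of h] by blast
    obtain D m where D: "D \<ge> 0" "\<And>f. schwartz f \<Longrightarrow> schwartz_seminorm k (B f) \<le> D * schwartz_seminorm m f"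
      by (rule schwartz_op_bound[OF diffop_schwartz_op[OF B(1)], of k]) blast
    have "norm (A f x) \<le> (C * D) * schwartz_seminorm m f" if f: "schwartz f" for f x
      unfolding B(2) using order_trans[OF C(2)[OF SB[OF f]] mult_left_mono[OF D(2)[OF f] C(1)]] by (simp add: mult.assoc)
    then show "\<exists>C m. \<forall>f. schwartz f \<longrightarrow> (\<forall>x. norm (A f x) \<le> C * schwartz_seminorm m f)" by blast
    obtain B' where B': "diffop B'" "\<And>f. schwartz f \<Longrightarrow> partial_dir i (B f) = B' f"
      using diffop_partial[OF B(1)] by metis
    have "ft h (\<lambda>p. (- \<i> * complex_of_real h) * B' f p) = (\<lambda>x. complex_of_real (x $ i) * A f x)" if f: "schwartz f" for f
      unfolding B(2) B'(2)[OF f, symmetric] by (rule ext) (rule ft_mult_coord[OF SB[OF f] h])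
    then show "\<exists>A'. (\<exists>B. diffop B \<and> A' = (\<lambda>f. ft h (B f))) \<and>
        (\<forall>f. schwartz f \<longrightarrow> A' f = (\<lambda>x. complex_of_real (x $ i) * A f x))"
      using diffop.scale[OF B'(1)] by blast
    show "\<exists>A'. (\<exists>B. diffop B \<and> A' = (\<lambda>f. ft h (B f))) \<and> (\<forall>f x. schwartz f \<longrightarrow>
        ((\<lambda>t. A f (x + t *\<^sub>R axis i 1)) has_vector_derivative A' f x) (at 0))"
      using diffop.scale[OF diffop.mul[OF B(1), of i], of "- \<i> * complex_of_real (1 / h)"] ft_deriv[OF SB, of _ h _ i]
      unfolding B(2) by blast
  qed (use diffop_id in blast)
  then show ?thesis by simp
qed

section \<open>Fourier transform in the momentum alone\<close>

definition pft :: "real \<Rightarrow> (real^('n::finite + 'n) \<Rightarrow> complex) \<Rightarrow> real^('n + 'n) \<Rightarrow> complex" where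
  "pft h a z = ft h (\<lambda>p. a (pvec (xpart z) p)) (ppart z)"

text \<open>The image of \<open>pft h\<close> is stable: position coordinates and position
  derivatives commute with the transform, momentum coordinates and momentum derivatives are
  exchanged up to constants.\<close>

lemma schwartz_pft:
  fixes a :: "real^('n::finite + 'n) \<Rightarrow> complex"
  assumes a: "schwartz a" and h: "h \<noteq> 0"
  shows "schwartz (pft h a)"
proof (rule schwartz_coinduct[where P="\<lambda>G. \<exists>a. schwartz a \<and> G = pft h a"])
  fix G :: "real^('n + 'n) \<Rightarrow> complex" and k :: "'n + 'n" assume "\<exists>a. schwartz a \<and> G = pft h a"
  then obtain a where a: "schwartz a" "G = pft h a" by blast
  obtain C m where C: "C \<ge> 0" "\<And>f (y::real^'n). schwartz f \<Longrightarrow> norm (ft h f y) \<le> C * schwartz_seminorm m f"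
    using ft_bound[of h] by blast
  have "norm (G z) \<le> C * (seminorm_const TYPE('n) m * schwartz_seminorm m a)" for z
    unfolding a(2) pft_def
    by (rule order_trans[OF C(2)[OF schwartz_slice[OF a(1)]] mult_left_mono[OF schwartz_seminorm_slice[OF a(1)] C(1)]])
  then show "\<exists>B. \<forall>x. norm (G x) \<le> B" by blast
  have slice_partial: "partial_dir j (\<lambda>p. a (pvec x p)) = (\<lambda>p. partial_dir (Inr j) a (pvec x p))" for j x
    using iter_partial_slice[of "[j]" a x] by simp
  show "\<exists>a. schwartz a \<and> (\<lambda>x. complex_of_real (x $ k) * G x) = pft h a"
  proof (cases k)
    case (Inl i)
    have "(\<lambda>z. complex_of_real (z $ k) * G z) = pft h (\<lambda>z. complex_of_real (z $ Inl i) * a z)"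
      unfolding a(2) pft_def Inl
      by (rule ext) (simp add: tempered_scale[OF tempered_ft schwartz_slice[OF a(1)]])
    then show ?thesis using schwartz_coord[OF a(1), of "Inl i"] by blast
  next
    case (Inr j)
    have "(\<lambda>z. complex_of_real (z $ k) * G z) = pft h (\<lambda>z. (- \<i> * complex_of_real h) * partial_dir (Inr j) a z)"
      unfolding a(2) pft_def Inr
      using ft_mult_coord[OF schwartz_slice[OF a(1)] h, unfolded slice_partial, of j] by (intro ext) simp
    then show ?thesis using schwartz_scale[OF schwartz_partial[OF a(1), of "Inr j"]] by blast
  qed
  show "\<exists>G'. (\<exists>a. schwartz a \<and> G' = pft h a) \<and> (\<forall>x. ((\<lambda>t. G (x + t *\<^sub>R axis k 1)) has_vector_derivative G' x) (at 0))"
  proof (cases k)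
    case (Inl i)
    have "((\<lambda>t. G (x + t *\<^sub>R axis k 1)) has_vector_derivative pft h (partial_dir (Inl i) a) x) (at 0)" for x
      using has_vector_derivative_tempered_slice[OF tempered_ft[of h "ppart x"] a(1), of "xpart x" i]
      unfolding a(2) pft_def Inl by (simp add: parts_add parts_scaleR parts_axis)
    then show ?thesis using schwartz_partial[OF a(1)] by blast
  next
    case (Inr j)
    have "((\<lambda>t. G (x + t *\<^sub>R axis k 1)) has_vector_derivative
        pft h (\<lambda>z. (- \<i> * complex_of_real (1 / h)) * (complex_of_real (z $ Inr j) * a z)) x) (at 0)" for x
      using ft_deriv[where f="\<lambda>p. a (pvec (xpart x) p)" and h=h and y="ppart x" and j=j, OF schwartz_slice[OF a(1)]]
      unfolding a(2) pft_def Inr by (simp add: parts_add parts_scaleR parts_axis)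
    then show ?thesis using schwartz_scale[OF schwartz_coord[OF a(1), of "Inr j"]] by blast
  qed
qed (use a in blast)

text \<open>The phase is quadratic on phase space, with off-diagonal coefficients \<Lambda>. Once
  the Fourier kernel is part of a Schwartz function of both variables, double integrals containing
  it fall under \<open>tempered_fubini\<close>.\<close>

lemma phase_schwartz:
  fixes G :: "real^('n::finite + 'n) \<Rightarrow> complex"
  assumes "schwartz G"
  shows "schwartz (\<lambda>z. exp (- \<i> * complex_of_real (xpart z \<bullet> ppart z / h)) * G z)"
proof -
  define \<Lambda> where "\<Lambda> k l = (case (k, l) of (Inl i, Inr j) \<Rightarrow> if i = j then - 1 / h else 0
     | (Inr i, Inl j) \<Rightarrow> if i = j then - 1 / h else 0 | _ \<Rightarrow> 0)" for k l :: "'n + 'n"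
  have "((\<lambda>t. - (xpart (x + t *\<^sub>R axis k 1) \<bullet> ppart (x + t *\<^sub>R axis k 1) / h)) has_real_derivative 0 + (\<Sum>l\<in>UNIV. \<Lambda> k l * x $ l)) (at 0)"
    for x :: "real^('n + 'n)" and k
  proof -
    obtain c where c: "inverse h = c" by blast
    show ?thesis
  proof (cases k)
    case (Inl i)
    have "(\<Sum>l\<in>UNIV. \<Lambda> k l * x $ l) = - (x $ Inr i / h)"
      unfolding sum_UNIV_sum Inl by (simp add: \<Lambda>_def if_distrib[of "\<lambda>c. c * _"] cong: if_cong)
    then show ?thesis unfolding Inl divide_inverse c
      by (auto intro!: derivative_eq_intros simp: parts_add parts_scaleR parts_axis inner_add_left inner_axis inner_commute[of "axis i 1"])
  next
    case (Inr i)
    have "(\<Sum>l\<in>UNIV. \<Lambda> k l * x $ l) = - (x $ Inl i / h)"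
      unfolding sum_UNIV_sum Inr by (simp add: \<Lambda>_def if_distrib[of "\<lambda>c. c * _"] cong: if_cong)
    then show ?thesis unfolding Inr divide_inverse c
      by (auto intro!: derivative_eq_intros simp: parts_add parts_scaleR parts_axis inner_add_right inner_axis)
  qed
  qed
  from schwartz_op_schwartz[OF schwartz_op_chirp[OF this] assms] show ?thesis by simp
qed

text \<open>A Gaussian factor in y makes the integrand Schwartz in both variables, so the integrals
  may be exchanged and the Gaussian is transformed in closed form. As it flattens out, its transform
  concentrates at 0. The base 2 pi h of the constant is sqrt pi from the transform times sqrt (4 pi
  h^2) from the limiting Gaussian integral.\<close>

lemma ft_inversion_zero:
  fixes f :: "real^'n::finite \<Rightarrow> complex"
  assumes f: "schwartz f" and h: "h > 0"
  shows "(\<integral>y. ft h f y \<partial>lborel) = complex_of_real ((2 * pi * h) ^ CARD('n)) * f 0"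
proof -
  let ?n = "CARD('n)"
  have h0: "h \<noteq> 0" using h by simp
  have F: "schwartz (ft h f)" by (rule schwartz_op_schwartz[OF schwartz_op_ft[OF h0] f])
  have g1: "schwartz (gauss 1 :: real^'n \<Rightarrow> complex)" by (rule schwartz_gauss') simp
  obtain B where B: "\<And>x. norm (f x) \<le> B" using schwartz_bounded[OF f] by blast
  have hh: "1 / (4 * h\<^sup>2) > 0" using h by simp
  have eq: "(\<integral>y. ft h f y * gauss 1 ((1 / real (Suc j)) *\<^sub>R y) \<partial>lborel)
    = complex_of_real (sqrt pi ^ ?n) * (\<integral>q. gauss (1 / (4 * h\<^sup>2)) q * f ((1 / real (Suc j)) *\<^sub>R q) \<partial>lborel)" for j
  proof -
    let ?J = "real (Suc j)"
    let ?a = "1 / ?J\<^sup>2"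
    have a: "?a > 0" by simp
    have ga: "gauss 1 ((1 / ?J) *\<^sub>R y) = gauss ?a y" for y :: "real^'n"
      unfolding gauss_scaleR by (simp add: power_divide)
    have Sg: "schwartz (gauss ?a :: real^'n \<Rightarrow> complex)" by (rule schwartz_gauss'[OF a])
    define G where "G z = exp (- \<i> * complex_of_real (xpart z \<bullet> ppart z / h)) * (gauss ?a (xpart z) * f (ppart z))" for z
    have G: "schwartz G" unfolding G_def by (rule phase_schwartz[OF schwartz_tensor[OF Sg f]])
    have e1: "(\<integral>y. ft h f y * gauss ?a y \<partial>lborel) = (\<integral>y. (\<integral>p. G (pvec y p) \<partial>lborel) \<partial>lborel)"
      unfolding ft_def G_def
      by (rule Bochner_Integration.integral_cong[OF refl])
        (simp add: inner_commute mult_ac flip: integral_mult_left_zero integral_mult_right_zero)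
    have e2: "(\<integral>y. (\<integral>p. G (pvec y p) \<partial>lborel) \<partial>lborel) = (\<integral>p. (\<integral>y. G (pvec y p) \<partial>lborel) \<partial>lborel)"
      by (rule tempered_fubini[OF tempered_integral tempered_integral G])
    have e3: "(\<integral>y. G (pvec y p) \<partial>lborel) = complex_of_real (sqrt (pi / ?a) ^ ?n) * (gauss (?J\<^sup>2 / (4 * h\<^sup>2)) p * f p)" for p
    proof -
      have "(\<integral>y. G (pvec y p) \<partial>lborel) = (\<integral>y. (exp (- \<i> * complex_of_real (((1 / h) *\<^sub>R p) \<bullet> y)) * gauss ?a y) * f p \<partial>lborel)"
        unfolding G_def by (rule Bochner_Integration.integral_cong[OF refl]) (simp add: inner_commute)
      also have "\<dots> = (\<integral>y. exp (- \<i> * complex_of_real (((1 / h) *\<^sub>R p) \<bullet> y)) * gauss ?a y \<partial>lborel) * f p"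
        by (rule integral_mult_left_zero)
      also have "(\<integral>y. exp (- \<i> * complex_of_real (((1 / h) *\<^sub>R p) \<bullet> y)) * gauss ?a y \<partial>lborel)
          = complex_of_real (sqrt (pi / ?a) ^ ?n) * gauss (1 / (4 * ?a)) ((1 / h) *\<^sub>R p)"
        by (rule gauss_ft[OF a])
      also have "gauss (1 / (4 * ?a)) ((1 / h) *\<^sub>R p) = gauss (?J\<^sup>2 / (4 * h\<^sup>2)) p"
        unfolding gauss_scaleR by (simp add: power_divide)
      finally show ?thesis by (simp only: mult.assoc)
    qed
    have e4: "(\<integral>p. complex_of_real (sqrt (pi / ?a) ^ ?n) * (gauss (?J\<^sup>2 / (4 * h\<^sup>2)) p * f p) \<partial>lborel)
        = complex_of_real (sqrt (pi / ?a) ^ ?n) * (\<integral>p. gauss (?J\<^sup>2 / (4 * h\<^sup>2)) p * f p \<partial>lborel)"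
      by (rule integral_mult_right_zero)
    have e5: "(\<integral>p. gauss (?J\<^sup>2 / (4 * h\<^sup>2)) p * f p \<partial>lborel) =
        (1 / ?J) ^ ?n *\<^sub>R (\<integral>q. gauss (1 / (4 * h\<^sup>2)) q * f ((1 / ?J) *\<^sub>R q) \<partial>lborel)"
    proof -
      have J: "?J\<^sup>2 / (4 * h\<^sup>2) > 0" using h by simp
      have m: "(\<lambda>p. gauss (?J\<^sup>2 / (4 * h\<^sup>2)) p * f p) \<in> borel_measurable borel"
        by (rule schwartz_measurable[OF schwartz_mult[OF schwartz_gauss'[OF J] f]])
      have g: "gauss (?J\<^sup>2 / (4 * h\<^sup>2)) ((1 / ?J) *\<^sub>R q) = gauss (1 / (4 * h\<^sup>2)) q" for q :: "real^'n"
        unfolding gauss_scaleR by (simp add: power_divide)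
      show ?thesis
        using lborel_integral_affine[OF _ m, of "1 / ?J" 0] by (simp only: add_0_left g) simp
    qed
    have e6: "complex_of_real (sqrt (pi / ?a) ^ ?n) * ((1 / ?J) ^ ?n *\<^sub>R (\<integral>q. gauss (1 / (4 * h\<^sup>2)) q * f ((1 / ?J) *\<^sub>R q) \<partial>lborel))
       = complex_of_real ((sqrt (pi / ?a) * (1 / ?J)) ^ ?n) * (\<integral>q. gauss (1 / (4 * h\<^sup>2)) q * f ((1 / ?J) *\<^sub>R q) \<partial>lborel)"
      unfolding power_mult_distrib by (simp only: scaleR_conv_of_real of_real_mult mult.assoc)
    have e7: "sqrt (pi / ?a) * (1 / ?J) = sqrt pi"
      by (simp add: real_sqrt_mult)
    show ?thesis unfolding ga e1 e2 e3 e4 e5 e6 e7 ..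
  qed
  have "(\<lambda>j. \<integral>y. ft h f y * gauss 1 ((1 / real (Suc j)) *\<^sub>R y) \<partial>lborel) \<longlonglongrightarrow> gauss 1 (0::real^'n) * (\<integral>y. ft h f y \<partial>lborel)"
    by (rule gauss_scaling_limit[OF schwartz_continuous[OF g1] _ F, where B=1]) (simp add: gauss_def)
  moreover have "(\<lambda>j. complex_of_real (sqrt pi ^ ?n) * (\<integral>q. gauss (1 / (4 * h\<^sup>2)) q * f ((1 / real (Suc j)) *\<^sub>R q) \<partial>lborel))
     \<longlonglongrightarrow> complex_of_real (sqrt pi ^ ?n) * (f 0 * (\<integral>q. gauss (1 / (4 * h\<^sup>2)) (q::real^'n) \<partial>lborel))"
    by (intro tendsto_mult_left gauss_scaling_limit[OF schwartz_continuous[OF f] B schwartz_gauss'[OF hh]])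
  ultimately have "gauss 1 (0::real^'n) * (\<integral>y. ft h f y \<partial>lborel) = complex_of_real (sqrt pi ^ ?n) * (f 0 * (\<integral>q. gauss (1 / (4 * h\<^sup>2)) (q::real^'n) \<partial>lborel))"
    unfolding eq by (rule LIMSEQ_unique)
  also have "\<dots> = complex_of_real ((sqrt pi * sqrt (pi / (1 / (4 * h\<^sup>2)))) ^ ?n) * f 0"
    unfolding gauss_integral[OF hh] power_mult_distrib of_real_mult by (simp only: mult_ac)
  also have "sqrt pi * sqrt (pi / (1 / (4 * h\<^sup>2))) = 2 * pi * h"
    using h by (simp add: real_sqrt_mult)
  finally show ?thesis by simp
qed

text \<open>Inversion at x is inversion at 0 for a translate of f, whose transform differs by a
  phase.\<close>

theorem ft_inversion:
  fixes f :: "real^'n::finite \<Rightarrow> complex"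
  assumes f: "schwartz f" and h: "h > 0"
  shows "(\<integral>y. exp (\<i> * complex_of_real (x \<bullet> y / h)) * ft h f y \<partial>lborel) = complex_of_real ((2 * pi * h) ^ CARD('n)) * f x"
proof -
  define k where "k p = f (p + x)" for p
  have k: "schwartz k" unfolding k_def using schwartz_affine[OF linear_id inj_on_id f, of x] by simp
  have "ft h k y = exp (\<i> * complex_of_real (x \<bullet> y / h)) * ft h f y" for y
  proof -
    have "ft h f y = (\<integral>p. exp (- \<i> * complex_of_real ((x + p) \<bullet> y / h)) * f (x + p) \<partial>lborel)"
      unfolding ft_def
      by (rule lborel_integral_translate[symmetric]) (use schwartz_measurable[OF f] in measurable)
    also have "\<dots> = (\<integral>p. exp (- \<i> * complex_of_real (x \<bullet> y / h)) * (exp (- \<i> * complex_of_real (p \<bullet> y / h)) * k p) \<partial>lborel)"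
    proof (rule Bochner_Integration.integral_cong[OF refl])
      fix p
      have "- \<i> * complex_of_real ((x + p) \<bullet> y / h) = - \<i> * complex_of_real (x \<bullet> y / h) + - \<i> * complex_of_real (p \<bullet> y / h)"
        by (simp add: inner_add_left add_divide_distrib distrib_left)
      then show "exp (- \<i> * complex_of_real ((x + p) \<bullet> y / h)) * f (x + p)
          = exp (- \<i> * complex_of_real (x \<bullet> y / h)) * (exp (- \<i> * complex_of_real (p \<bullet> y / h)) * k p)"
        by (simp only: exp_add k_def add.commute[of x] mult.assoc)
    qed
    also have "\<dots> = exp (- \<i> * complex_of_real (x \<bullet> y / h)) * ft h k y"
      unfolding ft_def by (rule integral_mult_right_zero)
    finally show ?thesis by (simp add: exp_minus field_simps)
  qed
  then show ?thesis using ft_inversion_zero[OF k h] by (simp add: k_def)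
qed

section \<open>Linear substitution in integrals\<close>

lemma schwartz_op_comp: "schwartz_op A \<Longrightarrow> schwartz_op B \<Longrightarrow> schwartz_op (\<lambda>f. A (B f))"
proof -
  assume A: "schwartz_op A" and B: "schwartz_op B"
  have "\<exists>C m. \<forall>f. schwartz f \<longrightarrow> schwartz_seminorm k (A (B f)) \<le> C * schwartz_seminorm m f" for k
  proof -
    obtain C l where C: "C \<ge> 0" "\<And>f. schwartz f \<Longrightarrow> schwartz_seminorm k (A f) \<le> C * schwartz_seminorm l f"
      by (rule schwartz_op_bound[OF A, of k]) blast
    obtain D m where D: "D \<ge> 0" "\<And>f. schwartz f \<Longrightarrow> schwartz_seminorm l (B f) \<le> D * schwartz_seminorm m f"
      by (rule schwartz_op_bound[OF B, of l]) blast
    have "schwartz_seminorm k (A (B f)) \<le> (C * D) * schwartz_seminorm m f" if f: "schwartz f" for f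
      using order_trans[OF C(2)[OF schwartz_op_schwartz[OF B f]] mult_left_mono[OF D(2)[OF f] C(1)]]
      by (simp add: mult.assoc)
    then show ?thesis by blast
  qed
  with A B show ?thesis unfolding schwartz_op_def by blast
qed

lemma schwartz_op_scale: "schwartz_op A \<Longrightarrow> schwartz_op (\<lambda>f x. c * A f x)"
  using schwartz_op_comp[OF diffop_schwartz_op[OF diffop.scale[OF diffop_id]]] by blast

lemma schwartz_matrix: "invertible A \<Longrightarrow> schwartz f \<Longrightarrow> schwartz (\<lambda>x. f (A *v x))"
  for A :: "real^'m::finite^'m"
  by (rule schwartz_op_schwartz[OF schwartz_op_matrix])

lemma matrix_inverse:
  fixes A :: "real^'m::finite^'m"
  assumes "invertible A"
  shows matrix_inverse_left: "matrix_inv A ** A = mat 1" and matrix_inverse_right: "A ** matrix_inv A = mat 1"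
proof -
  have "A ** matrix_inv A = mat 1 \<and> matrix_inv A ** A = mat 1"
    unfolding matrix_inv_def using assms unfolding invertible_def by (rule someI_ex)
  then show "matrix_inv A ** A = mat 1" "A ** matrix_inv A = mat 1" by simp_all
qed

lemma matrix_inv_vector:
  fixes A :: "real^'m::finite^'m"
  assumes "invertible A"
  shows "matrix_inv A *v (A *v x) = x" "A *v (matrix_inv A *v x) = x"
  using assms by (simp_all add: matrix_vector_mul_assoc matrix_inverse)

lemma invertible_matrix_inv: "invertible A \<Longrightarrow> invertible (matrix_inv (A :: real^'m::finite^'m))"
  using matrix_inverse unfolding invertible_def by blast

text \<open>Uniqueness of the translation invariant functional: pair a translation invariant T with a convolution.\<close>

lemma integral_matrix_proportional:
  fixes A :: "real^'m::finite^'m"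
  assumes A: "invertible A" and f: "schwartz f"
  shows "(\<integral>x. f (A *v x) \<partial>lborel) * (\<integral>x. gauss 1 (x :: real^'m) \<partial>lborel)
    = (\<integral>x. gauss 1 (A *v x) \<partial>lborel) * (\<integral>x. f x \<partial>lborel)"
proof -
  define T where "T f = (\<integral>x. f (A *v x) \<partial>lborel)" for f :: "real^'m \<Rightarrow> complex"
  have T: "tempered T"
    unfolding T_def by (rule tempered_comp[OF tempered_integral schwartz_op_matrix[OF A]]) simp_all
  have g: "schwartz (gauss 1 :: real^'m \<Rightarrow> complex)" by (rule schwartz_gauss') simp
  have inv: "T (\<lambda>x. k (x - y)) = T k" if k: "schwartz k" for k y
  proof -
    have "(\<integral>x. k (A *v (- (matrix_inv A *v y) + x)) \<partial>lborel) = (\<integral>x. k (A *v x) \<partial>lborel)"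
      by (rule lborel_integral_translate[OF schwartz_measurable[OF schwartz_matrix[OF A k]]])
    moreover have "A *v (- (matrix_inv A *v y) + x) = A *v x - y" for x
      by (simp add: matrix_vector_mult_diff_distrib matrix_inv_vector[OF A])
    ultimately show ?thesis by (simp add: T_def)
  qed
  have lin: "linear (\<lambda>z. pvec (xpart z) (ppart z - xpart z))" "inj (\<lambda>z. pvec (xpart z) (ppart z - xpart z))"
    by (auto intro!: linearI injI simp: parts_add parts_scaleR pvec_add pvec_scaleR scaleR_diff_right)
      (metis pvec_parts)
  have tens: "schwartz (\<lambda>z. f (xpart z) * k (ppart z - xpart z))"
    if "schwartz f" "schwartz k" for f k :: "real^'m \<Rightarrow> complex"
    using schwartz_linear[OF lin schwartz_tensor[OF that]] by simp
  \<comment> \<open>Convolution is symmetric in its factors; evaluating T on the convolution of f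
    with a Gaussian in both orders gives the proportionality.\<close>
  have conv: "T (\<lambda>x. \<integral>w. k w * l (x - w) \<partial>lborel) = T l * (\<integral>w. k w \<partial>lborel)"
    if k: "schwartz k" and l: "schwartz l" for k l
  proof -
    have s: "schwartz (\<lambda>x. l (x - w))" for w
      using schwartz_affine[OF linear_id inj_on_id l, of "- w"] by simp
    have "T (\<lambda>x. k w * l (x - w)) = k w * T l" for w
      using tempered_scale[OF T s] inv[OF l] by simp
    moreover have "T (\<lambda>x. \<integral>w. k w * l (x - w) \<partial>lborel) = (\<integral>w. T (\<lambda>x. k w * l (x - w)) \<partial>lborel)"
      using tempered_lborel_interchange[OF T tens[OF k l]] by simp
    ultimately show ?thesis by simp
  qed
  have "(\<integral>w. f w * gauss 1 (x - w) \<partial>lborel) = (\<integral>y. gauss 1 y * f (x - y) \<partial>lborel)" for x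
  proof -
    note schwartz_measurable[OF f, measurable] schwartz_measurable[OF g, measurable]
    have "(\<lambda>w. f w * gauss 1 (x - w)) \<in> borel_measurable borel" by measurable
    from lborel_integral_reflect[OF this, of x] show ?thesis by (simp add: mult.commute)
  qed
  then show ?thesis using conv[OF f g] conv[OF g f] by (simp add: T_def)
qed

lemma gauss_integral_nonzero: "c > 0 \<Longrightarrow> (\<integral>x. gauss c (x :: real^'m::finite) \<partial>lborel) \<noteq> 0"
  by (simp add: gauss_integral)

lemma gauss_integral_diagonal:
  fixes d :: "'m::finite \<Rightarrow> real"
  assumes d: "\<And>i. d i \<noteq> 0"
  shows "complex_of_real \<bar>\<Prod>i\<in>UNIV. d i\<bar> * (\<integral>x. gauss 1 ((\<chi> i. d i * x $ i) :: real^'m) \<partial>lborel)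
    = (\<integral>x. gauss 1 (x :: real^'m) \<partial>lborel)"
proof -
  have pos: "(d i)\<^sup>2 > 0" for i using d by simp
  define f where "f i t = complex_of_real (exp (- (d i)\<^sup>2 * t\<^sup>2))" for i t
  have int: "integrable lborel (f i)" for i
    using integrable_gauss_1d[OF pos, of 0 i] by (simp add: f_def[abs_def])
  have val: "(\<integral>t. f i t \<partial>lborel) = complex_of_real (sqrt pi / \<bar>d i\<bar>)" for i
    using gauss_ft_1d[OF pos, of 0 i] by (simp add: f_def real_sqrt_divide)
  have "gauss 1 ((\<chi> i. d i * x $ i) :: real^'m) = (\<Prod>i\<in>UNIV. f i (x $ i))" for x
  proof -
    have "exp (- 1 * (((\<chi> i. d i * x $ i) :: real^'m) \<bullet> (\<chi> i. d i * x $ i))) = (\<Prod>i\<in>UNIV. exp (- (d i)\<^sup>2 * (x $ i)\<^sup>2))"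
      by (simp add: inner_vec_def power2_eq_square mult_ac flip: exp_sum sum_negf)
    then show ?thesis unfolding gauss_def f_def by simp
  qed
  then have "(\<integral>x. gauss 1 ((\<chi> i. d i * x $ i) :: real^'m) \<partial>lborel) = (\<Prod>i\<in>UNIV. complex_of_real (sqrt pi / \<bar>d i\<bar>))"
    using integral_prod_coord[OF int] by (simp add: val)
  moreover have "complex_of_real \<bar>\<Prod>i\<in>UNIV. d i\<bar> * (\<Prod>i\<in>UNIV. complex_of_real (sqrt pi / \<bar>d i\<bar>)) = complex_of_real (sqrt pi ^ CARD('m))"
    unfolding abs_prod of_real_prod prod.distrib[symmetric] using d by simp
  ultimately show ?thesis using gauss_integral[where 'm='m, of 1] by simp
qed

text \<open>Divided by the full Gaussian integral, the integral on the left is multiplicative in the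
  matrix by \<open>integral_matrix_proportional\<close>, as the determinant is. This leaves diagonal
  matrices, where the coordinates separate, transpositions, which preserve the norm, and
  shears.\<close>

lemma gauss_integral_matrix:
  fixes A :: "real^'m::finite^'m"
  assumes "det A \<noteq> 0"
  shows "complex_of_real \<bar>det A\<bar> * (\<integral>x. gauss 1 (A *v x) \<partial>lborel) = (\<integral>x. gauss 1 (x :: real^'m) \<partial>lborel)"
proof -
  let ?I = "\<lambda>A::real^'m^'m. \<integral>x. gauss 1 (A *v x) \<partial>lborel"
  let ?G = "\<integral>x. gauss 1 (x :: real^'m) \<partial>lborel"
  have g: "schwartz (gauss 1 :: real^'m \<Rightarrow> complex)" by (rule schwartz_gauss') simp
  have G0: "?G \<noteq> 0" by (rule gauss_integral_nonzero) simp
  have mult: "?I (A ** B) * ?G = ?I A * ?I B" if "det A \<noteq> 0" "det B \<noteq> 0" for A B :: "real^'m^'m"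
    using integral_matrix_proportional[OF _ schwartz_matrix[OF _ g], of B A] that
    by (simp add: invertible_det_nz matrix_vector_mul_assoc mult.commute)
  have diag: "complex_of_real \<bar>det A\<bar> * ?I A = ?G"
    if "\<And>i j. i \<noteq> j \<Longrightarrow> A $ i $ j = 0" "det A \<noteq> 0" for A :: "real^'m^'m"
  proof -
    have dt: "det A = (\<Prod>i\<in>UNIV. A $ i $ i)" by (rule det_diagonal) (rule that(1))
    have "A *v x = (\<chi> i. A $ i $ i * x $ i)" for x
      using that(1) by (simp add: vec_eq_iff matrix_vector_mult_def) (metis (no_types, lifting) UNIV_I finite_class.finite_UNIV mult_eq_0_iff sum.remove sum.neutral add.right_neutral DiffD2 singletonI)
    then show ?thesis
      using gauss_integral_diagonal[of "\<lambda>i. A $ i $ i"] that(2) unfolding dt by simp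
  qed
  have "det A \<noteq> 0 \<longrightarrow> complex_of_real \<bar>det A\<bar> * ?I A = ?G"
  proof (induction A rule: induct_matrix_elementary_alt)
    case (1 A B)
    show ?case
    proof
      assume d: "det (A ** B) \<noteq> 0"
      then have d': "det A \<noteq> 0" "det B \<noteq> 0" by (auto simp: det_mul)
      have "complex_of_real \<bar>det (A ** B)\<bar> * ?I (A ** B) * ?G = (complex_of_real \<bar>det A\<bar> * ?I A) * (complex_of_real \<bar>det B\<bar> * ?I B)"
        using mult[OF d'] by (simp add: det_mul abs_mult)
      also have "\<dots> = ?G * ?G" using 1 d' by simp
      finally show "complex_of_real \<bar>det (A ** B)\<bar> * ?I (A ** B) = ?G" using G0 by simp
    qed
  next
    case (2 A i)
    then show ?case using det_zero_row(2) by blast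
  next
    case (3 A)
    then show ?case using diag by blast
  next
    case (4 m n)
    let ?P = "(\<chi> i j. mat 1 $ i $ Transposition.transpose m n j) :: real^'m^'m"
    have perm: "Transposition.transpose m n permutes UNIV" by (rule permutes_swap_id) auto
    have "det ?P = of_int (sign (Transposition.transpose m n)) * det (mat 1 :: real^'m^'m)"
      by (rule det_permute_columns[OF perm])
    then have d: "\<bar>det ?P\<bar> = 1" by (simp add: sign_def)
    have "?P *v x = (\<chi> i. x $ Transposition.transpose m n i)" for x
    proof -
      have "(\<Sum>j\<in>UNIV. (if i = Transposition.transpose m n j then 1 else 0) * x $ j) = (\<Sum>j\<in>UNIV. if j = Transposition.transpose m n i then x $ j else 0)" for i
        by (rule sum.cong) (auto simp: transpose_eq_iff)
      then show ?thesis by (simp add: vec_eq_iff matrix_vector_mult_def mat_def)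
    qed
    moreover have "((\<chi> i. x $ Transposition.transpose m n i) :: real^'m) \<bullet> (\<chi> i. x $ Transposition.transpose m n i) = x \<bullet> x" for x :: "real^'m"
      unfolding inner_vec_def
      using sum.permute[OF perm, of "\<lambda>i. x $ i \<bullet> x $ i"] by (simp add: o_def)
    ultimately have "gauss 1 (?P *v x) = gauss 1 x" for x by (simp add: gauss_def)
    then show ?case by (simp add: d)
  next
    case (5 m n)
    let ?S = "(\<chi> i j. of_bool (i = m \<and> j = n \<or> i = j)) :: real^'m^'m"
    let ?D = "(\<chi> i j. if i = j then (if i = m then 2 else 1) else 0) :: real^'m^'m"
    have Sx: "?S *v x = (\<chi> i. if i = m then x $ m + x $ n else x $ i)" for x
    proof -
      have "(\<Sum>j\<in>UNIV. of_bool (i = m \<and> j = n \<or> i = j) * x $ j) = (\<Sum>j\<in>UNIV. (if j = i then x $ j else 0) + (if i = m then (if j = n then x $ j else 0) else 0))" for i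
        using 5 by (intro sum.cong) auto
      then show ?thesis by (simp add: vec_eq_iff matrix_vector_mult_def sum.distrib)
    qed
    have Dx: "?D *v x = (\<chi> i. if i = m then 2 * x $ m else x $ i)" for x
      by (simp add: vec_eq_iff matrix_vector_mult_def if_distrib[of "\<lambda>c. c * _"] cong: if_cong)
    have dD: "det ?D = (\<Prod>i\<in>UNIV. if i = m then 2 else 1)"
      by (subst det_diagonal) simp_all
    then have dD0: "det ?D \<noteq> 0" by simp
    \<comment> \<open>D doubles the m-th coordinate, and conjugating the shear by D gives its
      square. Multiplicativity then forces the determinant and the normalised integral of an
      invertible shear to be 1.\<close>
    have rel: "?D ** ?S = (?S ** ?S) ** ?D"
    proof -
      have "(?D ** ?S) *v x = ((?S ** ?S) ** ?D) *v x" for x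
        unfolding matrix_vector_mul_assoc[symmetric] Sx Dx using 5 by (simp add: vec_eq_iff)
      then show ?thesis by (simp add: matrix_eq)
    qed
    have "det ?D * det ?S = det ?S * det ?S * det ?D"
      using arg_cong[OF rel, of det] unfolding det_mul .
    then have dS: "det ?S = 0 \<or> det ?S = 1" using dD0 by (simp only: mult.commute[of "det ?D"]) simp
    show ?case
    proof
      assume d: "det ?S \<noteq> 0"
      then have d1: "det ?S = 1" using dS by simp
      define iS iD iSS where "iS = ?I ?S" and "iD = ?I ?D" and "iSS = ?I (?S ** ?S)"
      have "complex_of_real \<bar>det ?D\<bar> * iD = ?G" unfolding iD_def by (rule diag[OF _ dD0]) simp
      then have D0: "iD \<noteq> 0" using G0 by (auto simp only: mult_zero_right)
      have SS: "det (?S ** ?S) \<noteq> 0" using d by (simp only: det_mul mult_eq_0_iff) simp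
      have "iD * iS = iSS * iD"
        unfolding iS_def iD_def iSS_def mult[OF dD0 d, symmetric] mult[OF SS dD0, symmetric] rel ..
      then have "iS = iSS" using D0 by simp
      moreover have "iSS * ?G = iS * iS" unfolding iS_def iSS_def by (rule mult[OF d d])
      ultimately have "iS * ?G = iS * iS" by simp
      \<comment> \<open>The integrals belonging to the shear and to its inverse multiply to the
        square of the Gaussian integral.\<close>
      moreover have "iS \<noteq> 0"
      proof
        assume z: "iS = 0"
        have inv: "invertible ?S" using d by (simp only: invertible_det_nz) simp
        have "det (matrix_inv ?S) \<noteq> 0" using invertible_matrix_inv[OF inv] by (simp only: invertible_det_nz) simp
        from mult[OF d this] have "?G * ?G = 0" 
          unfolding matrix_inverse_right[OF inv] z[unfolded iS_def] matrix_vector_mul_lid mult_zero_left .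
        then show False using G0 by simp
      qed
      ultimately have "iS = ?G" by simp
      then show "complex_of_real \<bar>det ?S\<bar> * ?I ?S = ?G" unfolding iS_def[symmetric] d1 by simp
    qed
  qed
  then show ?thesis using assms by blast
qed

theorem integral_matrix:
  fixes A :: "real^'m::finite^'m"
  assumes A: "invertible A" and f: "schwartz f"
  shows "complex_of_real \<bar>det A\<bar> * (\<integral>x. f (A *v x) \<partial>lborel) = (\<integral>x. f x \<partial>lborel)"
proof -
  let ?G = "\<integral>x. gauss 1 (x :: real^'m) \<partial>lborel"
  have G0: "?G \<noteq> 0" by (rule gauss_integral_nonzero) simp
  have d: "det A \<noteq> 0" using A by (simp add: invertible_det_nz)
  have "complex_of_real \<bar>det A\<bar> * (\<integral>x. f (A *v x) \<partial>lborel) * ?G = ?G * (\<integral>x. f x \<partial>lborel)"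
    using integral_matrix_proportional[OF A f] gauss_integral_matrix[OF d] by (simp add: mult.assoc)
  then show ?thesis using G0 by simp
qed

section \<open>The Wigner kernel\<close>

lemma wig_kernel_pft:
  "wig_kernel h a u v = complex_of_real ((1 / (2 * pi * h)) ^ CARD('n)) * pft h a (pvec ((1/2) *\<^sub>R (u + v)) (u - v))"
  for u v :: "real^'n::finite"
  by (simp add: wig_kernel_def Let_def pft_def ft_def)

text \<open>Up to an exchange of its arguments, the kernel of the Weyl operator with symbol a,
  gathered into one function on phase space so that the lemmas on slices apply.\<close>

definition wigk :: "real \<Rightarrow> (real^('n::finite + 'n) \<Rightarrow> complex) \<Rightarrow> real^('n + 'n) \<Rightarrow> complex" where
  "wigk h a z = wig_kernel h a (xpart z) (ppart z)"

lemma wigk_pvec [simp]: "wigk h a (pvec u v) = wig_kernel h a u v"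
  by (simp add: wigk_def)

lemma schwartz_wigk:
  assumes "schwartz a" "h \<noteq> 0"
  shows "schwartz (wigk h a)"
proof -
  let ?l = "\<lambda>z. pvec ((1/2) *\<^sub>R (xpart z + ppart z)) (xpart z - ppart z)"
  have lin: "linear ?l"
    by (rule linearI) (simp_all add: parts_add parts_scaleR pvec_add pvec_scaleR algebra_simps)
  have "inj ?l"
  proof (rule injI)
    fix z w assume "?l z = ?l w"
    then have e: "(1/2) *\<^sub>R (xpart z + ppart z) = (1/2) *\<^sub>R (xpart w + ppart w)" "xpart z - ppart z = xpart w - ppart w"
      by simp_all
    have "xpart z = (1/2) *\<^sub>R (xpart z + ppart z) + (1/2) *\<^sub>R (xpart z - ppart z)" for z
      by (simp add: vec_eq_iff field_simps)
    moreover have "ppart z = (1/2) *\<^sub>R (xpart z + ppart z) - (1/2) *\<^sub>R (xpart z - ppart z)" for z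
      by (simp add: vec_eq_iff field_simps)
    ultimately show "z = w" using e by (metis pvec_parts)
  qed
  from schwartz_scale[OF schwartz_linear[OF lin this schwartz_pft[OF assms]]]
  show ?thesis by (simp add: wigk_def[abs_def] wig_kernel_pft)
qed

section \<open>Metaplectic operators\<close>

text \<open>The point transformations s and si are the symplectic matrix covered by A and its inverse;
  the last conjunct is the covariance of the kernel, A K A* being the kernel of the transformed symbol.\<close>

definition mp_good :: "real \<Rightarrow> ((real^'n::finite \<Rightarrow> complex) \<Rightarrow> real^'n \<Rightarrow> complex) \<Rightarrow>
    (real^('n + 'n) \<Rightarrow> real^('n + 'n)) \<Rightarrow> (real^('n + 'n) \<Rightarrow> real^('n + 'n)) \<Rightarrow> bool" where
  "mp_good h A s si \<longleftrightarrow>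
    (\<forall>f. schwartz f \<longrightarrow> schwartz (A f)) \<and>
    (\<forall>T. tempered T \<longrightarrow> tempered (\<lambda>f. T (A f))) \<and>
    (\<forall>g. schwartz g \<longrightarrow> (\<exists>f. schwartz f \<and> A f = g)) \<and>
    (\<forall>G. schwartz G \<longrightarrow> schwartz (\<lambda>z. A (\<lambda>v. G (pvec (xpart z) v)) (ppart z))) \<and>
    (\<forall>z f. schwartz f \<longrightarrow> A (heis h z f) = heis h (s z) (A f)) \<and>
    (\<forall>z. si (s z) = z) \<and> (\<forall>a. schwartz a \<longrightarrow> schwartz (\<lambda>z. a (si z))) \<and>
    (\<forall>a u v. schwartz a \<longrightarrow>
       cnj (A (\<lambda>u. cnj (A (\<lambda>v. wig_kernel h a u v) v)) u) = wig_kernel h (\<lambda>z. a (si z)) u v)"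

lemma mp_goodD:
  assumes "mp_good h A s si"
  shows "schwartz f \<Longrightarrow> schwartz (A f)"
    and "tempered T \<Longrightarrow> tempered (\<lambda>f. T (A f))"
    and "schwartz g \<Longrightarrow> \<exists>f. schwartz f \<and> A f = g"
    and "schwartz G \<Longrightarrow> schwartz (\<lambda>z. A (\<lambda>v. G (pvec (xpart z) v)) (ppart z))"
    and "schwartz f \<Longrightarrow> A (heis h z f) = heis h (s z) (A f)"
    and "si (s z) = z"
    and "schwartz a \<Longrightarrow> schwartz (\<lambda>z. a (si z))"
    and "schwartz a \<Longrightarrow> cnj (A (\<lambda>u. cnj (A (\<lambda>v. wig_kernel h a u v) v)) u) = wig_kernel h (\<lambda>z. a (si z)) u v"
  using assms unfolding mp_good_def by blast+

text \<open>The value of A f at a point is a tempered distribution in f, so exchanging A with T is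
  an instance of \<open>tempered_fubini\<close>.\<close>

lemma mp_good_interchange:
  assumes "mp_good h A s si" "tempered T" "schwartz G"
  shows "A (\<lambda>u. T (\<lambda>v. G (pvec u v))) = (\<lambda>w. T (\<lambda>v. A (\<lambda>u. G (pvec u v)) w))"
  by (rule ext) (rule tempered_fubini[OF mp_goodD(2)[OF assms(1) tempered_point] assms(2,3)])

text \<open>The kernel is transformed by B in both variables and then by A in both. For this, B in
  the first variable must be moved past A in the second, which is
  \<open>mp_good_interchange\<close>. Inverses compose in reverse order.\<close>

lemma mp_good_comp:
  fixes A B :: "(real^'n::finite \<Rightarrow> complex) \<Rightarrow> real^'n \<Rightarrow> complex"
  assumes A: "mp_good h A s si" and B: "mp_good h B t ti" and h: "h \<noteq> 0"
  shows "mp_good h (A \<circ> B) (s \<circ> t) (ti \<circ> si)"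
  unfolding mp_good_def o_def
proof (intro conjI allI impI)
  fix a :: "real^('n + 'n) \<Rightarrow> complex" and u v :: "real^'n" assume a: "schwartz a"
  define G where "G z = B (\<lambda>v. wigk h a (pvec (xpart z) v)) (ppart z)" for z
  have G: "schwartz G" unfolding G_def by (rule mp_goodD(4)[OF B schwartz_wigk[OF a h]])
  define T where "T v f = A f v" for v f
  have T: "tempered (T v)" for v unfolding T_def by (rule mp_goodD(2)[OF A tempered_point])
  have b: "schwartz (\<lambda>z. a (ti z))" by (rule mp_goodD(7)[OF B a])
  have "B (\<lambda>u. cnj (A (\<lambda>v. G (pvec u v)) w)) = (\<lambda>u. cnj (A (\<lambda>v. wig_kernel h (\<lambda>z. a (ti z)) u v) w))" for w
  proof -
    have "B (\<lambda>u. dist_conj (T w) (\<lambda>v. cnj (G (pvec u v)))) = (\<lambda>u. dist_conj (T w) (\<lambda>v. B (\<lambda>u. cnj (G (pvec u v))) u))"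
      by (rule mp_good_interchange[OF B tempered_dist_conj[OF T] schwartz_cnj[OF G]])
    then show ?thesis
      unfolding dist_conj_def T_def complex_cnj_cnj mp_goodD(8)[OF B a, symmetric] by (simp add: G_def)
  qed
  then show "cnj (A (B (\<lambda>u. cnj (A (B (\<lambda>v. wig_kernel h a u v)) v))) u) = wig_kernel h (\<lambda>z. a (ti (si z))) u v"
    using mp_goodD(8)[OF A b, where u=u and v=v] by (simp add: G_def)
next
  fix G :: "real^('n + 'n) \<Rightarrow> complex" assume G: "schwartz G"
  have "schwartz (\<lambda>z. A (\<lambda>v. (\<lambda>z. B (\<lambda>v. G (pvec (xpart z) v)) (ppart z)) (pvec (xpart z) v)) (ppart z))"
    by (rule mp_goodD(4)[OF A mp_goodD(4)[OF B G]])
  then show "schwartz (\<lambda>z. A (B (\<lambda>v. G (pvec (xpart z) v))) (ppart z))" by simp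
next
  fix g :: "real^'n \<Rightarrow> complex" assume "schwartz g"
  then show "\<exists>f. schwartz f \<and> A (B f) = g" using mp_goodD(3)[OF A] mp_goodD(3)[OF B] by metis
next
  fix z and f :: "real^'n \<Rightarrow> complex" assume "schwartz f"
  then show "A (B (heis h z f)) = heis h (s (t z)) (A (B f))"
    by (simp add: mp_goodD(5)[OF B] mp_goodD(5)[OF A mp_goodD(1)[OF B]])
next
  fix T :: "(real^'n \<Rightarrow> complex) \<Rightarrow> complex" assume "tempered T"
  then show "tempered (\<lambda>f. T (A (B f)))" by (rule mp_goodD(2)[OF B mp_goodD(2)[OF A]])
qed (auto simp: mp_goodD(6)[OF A] mp_goodD(6)[OF B] intro: mp_goodD(1)[OF A] mp_goodD(1)[OF B] mp_goodD(7)[OF A mp_goodD(7)[OF B]])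

lemma schwartz_linear_inv:
  assumes "linear l" "\<And>z. k (l z) = z" "schwartz a"
  shows "schwartz (\<lambda>z. a (l z))"
  by (rule schwartz_linear[OF assms(1) _ assms(3)]) (rule injI, metis assms(2))

subsection \<open>Chirps\<close>

lemma symmetric_inner:
  fixes P :: "real^'n::finite^'n"
  assumes "transpose P = P"
  shows "(P *v x) \<bullet> y = x \<bullet> (P *v y)"
  by (metis assms dot_lmul_matrix transpose_matrix_vector)

lemma quadratic_deriv:
  fixes P :: "real^'n::finite^'n"
  assumes P: "transpose P = P"
  shows "((\<lambda>t. ((P *v (x + t *\<^sub>R axis i 1)) \<bullet> (x + t *\<^sub>R axis i 1)) / (2 * h)) has_real_derivative
     (\<Sum>j\<in>UNIV. (P $ i $ j / h) * x $ j)) (at 0)"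
proof -
  let ?e = "axis i 1 :: real^'n"
  have eq: "((P *v (x + t *\<^sub>R ?e)) \<bullet> (x + t *\<^sub>R ?e)) / (2 * h) =
      (((P *v x) \<bullet> x) + t * (2 * (P *v x) $ i) + t * t * ((P *v ?e) \<bullet> ?e)) * inverse (2 * h)" for t
  proof -
    have "(P *v ?e) \<bullet> x = (P *v x) $ i" "(P *v x) \<bullet> ?e = (P *v x) $ i"
      using symmetric_inner[OF P, of ?e x] by (simp_all add: inner_axis inner_commute[of ?e])
    then show ?thesis
      unfolding divide_inverse
      by (simp add: matrix_vector_right_distrib matrix_vector_mult_scaleR inner_add_left inner_add_right algebra_simps)
  qed
  obtain k where k: "inverse (2 * h) = k" by blast
  have "((\<lambda>t. (((P *v x) \<bullet> x) + t * (2 * (P *v x) $ i) + t * t * ((P *v ?e) \<bullet> ?e)) * k) has_real_derivative (2 * (P *v x) $ i) * k) (at 0)"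
    by (auto intro!: derivative_eq_intros)
  moreover have "(2 * (P *v x) $ i) * k = (\<Sum>j\<in>UNIV. (P $ i $ j / h) * x $ j)"
  proof -
    have "(2 * (P *v x) $ i) * k = (P *v x) $ i / h" unfolding k[symmetric] by (simp only: inverse_mult_distrib divide_inverse) simp
    then show ?thesis by (simp add: matrix_vector_mult_def sum_divide_distrib)
  qed
  ultimately show ?thesis unfolding eq k by simp
qed

lemma schwartz_op_mp_chirp:
  fixes P :: "real^'n::finite^'n"
  assumes P: "transpose P = P"
  shows "schwartz_op (mp_chirp h P)"
proof -
  have "((\<lambda>t. ((P *v (x + t *\<^sub>R axis i 1)) \<bullet> (x + t *\<^sub>R axis i 1)) / (2 * h)) has_real_derivative
     0 + (\<Sum>j\<in>UNIV. (P $ i $ j / h) * x $ j)) (at 0)" for x i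
    using quadratic_deriv[OF P, of x i h] by simp
  from schwartz_op_chirp[OF this] show ?thesis unfolding mp_chirp_def[abs_def] .
qed

text \<open>The chirps multiply the kernel by the phase (P v \<bullet> v - P u \<bullet> u) / (2 h).
  As P is symmetric, this is - P x \<bullet> y / h for the midpoint x and the difference y, which is
  the effect of translating the momentum by P x.\<close>

lemma mp_chirp_good:
  fixes P :: "real^'n::finite^'n"
  assumes P: "transpose P = P" and h: "h \<noteq> 0"
  shows "mp_good h (mp_chirp h P) (\<lambda>z. pvec (xpart z) (ppart z + P *v xpart z)) (\<lambda>z. pvec (xpart z) (ppart z - P *v xpart z))"
  unfolding mp_good_def
proof (intro conjI allI impI)
  fix f :: "real^'n \<Rightarrow> complex" assume "schwartz f"
  then show "schwartz (mp_chirp h P f)" by (rule schwartz_op_schwartz[OF schwartz_op_mp_chirp[OF P]])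
next
  fix T :: "(real^'n \<Rightarrow> complex) \<Rightarrow> complex" assume "tempered T"
  then show "tempered (\<lambda>f. T (mp_chirp h P f))"
    by (rule tempered_comp[OF _ schwartz_op_mp_chirp[OF P]]) (simp_all add: mp_chirp_def[abs_def] distrib_left distrib_right mult_ac)
next
  fix g :: "real^'n \<Rightarrow> complex" assume g: "schwartz g"
  have P': "transpose (- P) = - P" using P by (simp add: transpose_def vec_eq_iff)
  have "mp_chirp h P (mp_chirp h (- P) g) x = g x" for x
  proof -
    have "((- P) *v x) \<bullet> x / (2 * h) = - (((P *v x) \<bullet> x) / (2 * h))"
      by (simp add: matrix_vector_mult_def inner_vec_def sum_negf)
    then show ?thesis unfolding mp_chirp_def by (simp add: mult.assoc[symmetric] exp_add[symmetric])
  qed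
  then show "\<exists>f. schwartz f \<and> mp_chirp h P f = g"
    using schwartz_op_schwartz[OF schwartz_op_mp_chirp[OF P'] g] by blast
next
  fix G :: "real^('n + 'n) \<Rightarrow> complex" assume G: "schwartz G"
  define \<Lambda> where "\<Lambda> k l = (case (k, l) of (Inr i, Inr j) \<Rightarrow> P $ i $ j / h | _ \<Rightarrow> 0)" for k l :: "'n + 'n"
  have "((\<lambda>t. ((P *v ppart (x + t *\<^sub>R axis k 1)) \<bullet> ppart (x + t *\<^sub>R axis k 1)) / (2 * h)) has_real_derivative
     0 + (\<Sum>j\<in>UNIV. \<Lambda> k j * x $ j)) (at 0)" for x k
  proof (cases k)
    case (Inl i)
    then show ?thesis by (simp add: parts_add parts_scaleR parts_axis sum_UNIV_sum \<Lambda>_def)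
  next
    case (Inr i)
    then show ?thesis
      using quadratic_deriv[OF P, of "ppart x" i h] by (simp add: parts_add parts_scaleR parts_axis sum_UNIV_sum \<Lambda>_def)
  qed
  from schwartz_op_schwartz[OF schwartz_op_chirp[OF this] G]
  show "schwartz (\<lambda>z. mp_chirp h P (\<lambda>v. G (pvec (xpart z) v)) (ppart z))" by (simp add: mp_chirp_def)
next
  fix z and f :: "real^'n \<Rightarrow> complex" assume "schwartz f"
  show "mp_chirp h P (heis h z f) = heis h (pvec (xpart z) (ppart z + P *v xpart z)) (mp_chirp h P f)"
  proof
    fix x
    let ?q = "xpart z" and ?p = "ppart z"
    \<comment> \<open>The quadratic form is expanded around x - q, the shifted argument; the cross
      term with x adds P q to the momentum.\<close>
    have "((P *v x) \<bullet> x) / (2 * h) + (?p \<bullet> x - (?p \<bullet> ?q) / 2) / h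
      = ((?p + P *v ?q) \<bullet> x - ((?p + P *v ?q) \<bullet> ?q) / 2) / h + ((P *v (x - ?q)) \<bullet> (x - ?q)) / (2 * h)"
      using h symmetric_inner[OF P, of x ?q]
      by (simp add: matrix_vector_mult_diff_distrib inner_diff_left inner_diff_right inner_add_left inner_commute[of x] field_simps)
    then have "\<i> * complex_of_real (((P *v x) \<bullet> x) / (2 * h)) + \<i> * complex_of_real ((?p \<bullet> x - (?p \<bullet> ?q) / 2) / h)
      = \<i> * complex_of_real (((?p + P *v ?q) \<bullet> x - ((?p + P *v ?q) \<bullet> ?q) / 2) / h) + \<i> * complex_of_real (((P *v (x - ?q)) \<bullet> (x - ?q)) / (2 * h))"
      by (simp only: distrib_left[symmetric] of_real_add[symmetric])
    then show "mp_chirp h P (heis h z f) x = heis h (pvec ?q (?p + P *v ?q)) (mp_chirp h P f) x"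
      unfolding mp_chirp_def heis_def xpart_pvec ppart_pvec mult.assoc[symmetric] exp_add[symmetric] by (simp only:)
  qed
next
  fix a :: "real^('n + 'n) \<Rightarrow> complex" assume a: "schwartz a"
  have "linear (\<lambda>z::real^('n + 'n). pvec (xpart z) (ppart z - P *v xpart z))"
    by (rule linearI) (simp_all add: parts_add parts_scaleR pvec_add pvec_scaleR matrix_vector_right_distrib matrix_vector_mult_scaleR scaleR_diff_right)
  then show "schwartz (\<lambda>z. a (pvec (xpart z) (ppart z - P *v xpart z)))"
    by (rule schwartz_linear_inv[where k="\<lambda>z. pvec (xpart z) (ppart z + P *v xpart z)"]) (simp_all add: a)
next
  fix a :: "real^('n + 'n) \<Rightarrow> complex" and u v :: "real^'n" assume a: "schwartz a"
  let ?x = "(1/2) *\<^sub>R (u + v)" and ?y = "u - v"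
  have m: "(\<lambda>p. exp (- \<i> * complex_of_real (p \<bullet> ?y / h)) * a (pvec ?x (p - P *v ?x))) \<in> borel_measurable borel"
  proof -
    have "schwartz (\<lambda>p. a (pvec ?x (p - P *v ?x)))"
      using schwartz_affine[OF linear_id inj_on_id schwartz_slice[OF a, of ?x], of "- (P *v ?x)"] by simp
    from schwartz_measurable[OF ft_kernel_schwartz[OF this]] show ?thesis .
  qed
  have "(\<integral>p. exp (- \<i> * complex_of_real (p \<bullet> ?y / h)) * a (pvec ?x (p - P *v ?x)) \<partial>lborel)
    = (\<integral>p. exp (- \<i> * complex_of_real ((P *v ?x + p) \<bullet> ?y / h)) * a (pvec ?x (P *v ?x + p - P *v ?x)) \<partial>lborel)"
    using lborel_integral_translate[OF m, of "P *v ?x"] by simp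
  also have "\<dots> = (\<integral>p. exp (- \<i> * complex_of_real ((P *v ?x) \<bullet> ?y / h)) * (exp (- \<i> * complex_of_real (p \<bullet> ?y / h)) * a (pvec ?x p)) \<partial>lborel)"
  proof (rule Bochner_Integration.integral_cong[OF refl])
    fix p
    have "- \<i> * complex_of_real ((P *v ?x + p) \<bullet> ?y / h) = - \<i> * complex_of_real ((P *v ?x) \<bullet> ?y / h) + - \<i> * complex_of_real (p \<bullet> ?y / h)"
      by (simp add: inner_add_left add_divide_distrib distrib_left)
    then show "exp (- \<i> * complex_of_real ((P *v ?x + p) \<bullet> ?y / h)) * a (pvec ?x (P *v ?x + p - P *v ?x))
      = exp (- \<i> * complex_of_real ((P *v ?x) \<bullet> ?y / h)) * (exp (- \<i> * complex_of_real (p \<bullet> ?y / h)) * a (pvec ?x p))"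
      by (simp only: exp_add mult.assoc add_diff_cancel_left')
  qed
  also have "\<dots> = exp (- \<i> * complex_of_real ((P *v ?x) \<bullet> ?y / h)) * (\<integral>p. exp (- \<i> * complex_of_real (p \<bullet> ?y / h)) * a (pvec ?x p) \<partial>lborel)"
    by (rule integral_mult_right_zero)
  finally have R: "wig_kernel h (\<lambda>z. a (pvec (xpart z) (ppart z - P *v xpart z))) u v
    = exp (- \<i> * complex_of_real ((P *v ?x) \<bullet> ?y / h)) * wig_kernel h a u v"
    unfolding wig_kernel_def Let_def by (simp only: xpart_pvec ppart_pvec mult.left_commute)
  have "(P *v ?x) \<bullet> ?y / h = ((P *v u) \<bullet> u) / (2 * h) - ((P *v v) \<bullet> v) / (2 * h)"
    using symmetric_inner[OF P, of u v] h
    by (simp add: matrix_vector_right_distrib matrix_vector_mult_scaleR inner_add_left inner_diff_right inner_commute[of u] field_simps)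
  then have "- \<i> * complex_of_real ((P *v ?x) \<bullet> ?y / h) = - (\<i> * complex_of_real (((P *v u) \<bullet> u) / (2 * h))) + \<i> * complex_of_real (((P *v v) \<bullet> v) / (2 * h))"
    by (simp add: right_diff_distrib)
  then show "cnj (mp_chirp h P (\<lambda>u. cnj (mp_chirp h P (\<lambda>v. wig_kernel h a u v) v)) u)
      = wig_kernel h (\<lambda>z. a (pvec (xpart z) (ppart z - P *v xpart z))) u v"
    unfolding R mp_chirp_def by (simp only: exp_add complex_cnj_mult complex_cnj_cnj exp_cnj)
      (simp add: mult_ac)
qed simp_all

subsection \<open>Dilations\<close>

lemma transpose_inner: "(transpose L *v p) \<bullet> x = p \<bullet> (L *v x)" for L :: "real^'n::finite^'n"
  by (metis dot_lmul_matrix transpose_matrix_vector inner_commute)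

text \<open>Acting on both variables of the kernel produces the factor |det L|, which is the
  Jacobian of substituting the inverse transpose of L in the momentum integral. The Maslov phase
  cancels against its conjugate.\<close>

lemma mp_dil_good:
  fixes L :: "real^'n::finite^'n"
  assumes L: "invertible L"
  shows "mp_good h (mp_dil L m) (\<lambda>z. pvec (matrix_inv L *v xpart z) (transpose L *v ppart z))
     (\<lambda>z. pvec (L *v xpart z) (matrix_inv (transpose L) *v ppart z))"
  unfolding mp_good_def
proof (intro conjI allI impI)
  let ?c = "\<i> ^ m * complex_of_real (sqrt \<bar>det L\<bar>)"
  have d0: "det L \<noteq> 0" using L by (simp add: invertible_det_nz)
  have c0: "?c \<noteq> 0" using d0 by simp
  have cc: "?c * cnj ?c = complex_of_real \<bar>det L\<bar>"
  proof -
    have "?c * cnj ?c = complex_of_real ((norm ?c)\<^sup>2)" by (rule complex_norm_square[symmetric])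
    then show ?thesis by (simp add: norm_mult norm_power)
  qed
  have tL: "invertible (transpose L)" using L by (rule transpose_invertible)
  have op: "schwartz_op (mp_dil L m)"
    unfolding mp_dil_def[abs_def] by (rule schwartz_op_scale[OF schwartz_op_matrix[OF L]])
  {
    fix f :: "real^'n \<Rightarrow> complex" assume "schwartz f"
    then show "schwartz (mp_dil L m f)" by (rule schwartz_op_schwartz[OF op])
  next
    fix T :: "(real^'n \<Rightarrow> complex) \<Rightarrow> complex" assume "tempered T"
    then show "tempered (\<lambda>f. T (mp_dil L m f))"
      by (rule tempered_comp[OF _ op]) (simp_all add: mp_dil_def[abs_def] distrib_left distrib_right mult_ac)
  next
    fix g :: "real^'n \<Rightarrow> complex" assume g: "schwartz g"
    have "schwartz (\<lambda>x. (1 / ?c) * g (matrix_inv L *v x))"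
      by (rule schwartz_scale[OF schwartz_matrix[OF invertible_matrix_inv[OF L] g]])
    moreover have "mp_dil L m (\<lambda>x. (1 / ?c) * g (matrix_inv L *v x)) = g"
      unfolding mp_dil_def matrix_inv_vector[OF L] using c0 by (intro ext) simp
    ultimately show "\<exists>f. schwartz f \<and> mp_dil L m f = g" by blast
  next
    fix G :: "real^('n + 'n) \<Rightarrow> complex" assume G: "schwartz G"
    have "linear (\<lambda>z::real^('n + 'n). pvec (xpart z) (L *v ppart z))"
      by (rule linearI) (simp_all add: parts_add parts_scaleR pvec_add pvec_scaleR matrix_vector_right_distrib matrix_vector_mult_scaleR)
    then have "schwartz (\<lambda>z. G (pvec (xpart z) (L *v ppart z)))"
      by (rule schwartz_linear_inv[where k="\<lambda>z. pvec (xpart z) (matrix_inv L *v ppart z)"]) (simp_all add: G matrix_inv_vector[OF L])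
    from schwartz_scale[OF this]
    show "schwartz (\<lambda>z. mp_dil L m (\<lambda>v. G (pvec (xpart z) v)) (ppart z))" by (simp add: mp_dil_def)
  next
    fix z and f :: "real^'n \<Rightarrow> complex" assume "schwartz f"
    show "mp_dil L m (heis h z f) = heis h (pvec (matrix_inv L *v xpart z) (transpose L *v ppart z)) (mp_dil L m f)"
      by (rule ext) (simp add: mp_dil_def heis_def transpose_inner matrix_inv_vector[OF L] matrix_vector_mult_diff_distrib mult_ac del: transpose_matrix_vector)
  next
    fix z
    show "pvec (L *v xpart (pvec (matrix_inv L *v xpart z) (transpose L *v ppart z)))
       (matrix_inv (transpose L) *v ppart (pvec (matrix_inv L *v xpart z) (transpose L *v ppart z))) = z"
      by (simp add: matrix_inv_vector[OF L] matrix_inv_vector[OF tL] del: transpose_matrix_vector)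
  next
    fix a :: "real^('n + 'n) \<Rightarrow> complex" assume a: "schwartz a"
    have "linear (\<lambda>z::real^('n + 'n). pvec (L *v xpart z) (matrix_inv (transpose L) *v ppart z))"
      by (rule linearI) (simp_all add: parts_add parts_scaleR pvec_add pvec_scaleR matrix_vector_right_distrib matrix_vector_mult_scaleR)
    then show "schwartz (\<lambda>z. a (pvec (L *v xpart z) (matrix_inv (transpose L) *v ppart z)))"
      by (rule schwartz_linear_inv[where k="\<lambda>z. pvec (matrix_inv L *v xpart z) (transpose L *v ppart z)"])
        (simp_all add: a matrix_inv_vector[OF L] matrix_inv_vector[OF tL] del: transpose_matrix_vector)
  next
    fix a :: "real^('n + 'n) \<Rightarrow> complex" and u v :: "real^'n" assume a: "schwartz a"
    let ?B = "matrix_inv (transpose L)"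
    let ?x = "(1/2) *\<^sub>R (u + v)" and ?y = "u - v"
    have Lx: "(1/2) *\<^sub>R (L *v u + L *v v) = L *v ?x" "L *v u - L *v v = L *v ?y"
      by (simp_all add: matrix_vector_right_distrib matrix_vector_mult_scaleR matrix_vector_mult_diff_distrib)
    have B: "invertible ?B" by (rule invertible_matrix_inv[OF tL])
    have dB: "\<bar>det ?B\<bar> * \<bar>det L\<bar> = 1"
      using arg_cong[OF matrix_inverse_left[OF tL], of det] by (simp add: det_mul flip: abs_mult)
    define f where "f p = exp (- \<i> * complex_of_real (p \<bullet> (L *v ?y) / h)) * a (pvec (L *v ?x) p)" for p
    have f: "schwartz f" unfolding f_def by (rule ft_kernel_schwartz[OF schwartz_slice[OF a]])
    have fB: "f (?B *v p) = exp (- \<i> * complex_of_real (p \<bullet> ?y / h)) * a (pvec (L *v ?x) (?B *v p))" for p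
    proof -
      have "(?B *v p) \<bullet> (L *v ?y) = p \<bullet> ?y"
        using transpose_inner[of L "?B *v p" ?y] by (simp add: matrix_inv_vector[OF tL] del: transpose_matrix_vector)
      then show ?thesis by (simp add: f_def)
    qed
    have "complex_of_real \<bar>det L\<bar> * (\<integral>p. f p \<partial>lborel) = complex_of_real (\<bar>det ?B\<bar> * \<bar>det L\<bar>) * (\<integral>p. f (?B *v p) \<partial>lborel)"
      using integral_matrix[OF B f] by (simp add: mult_ac)
    then have I: "(\<integral>p. f (?B *v p) \<partial>lborel) = complex_of_real \<bar>det L\<bar> * (\<integral>p. f p \<partial>lborel)" by (simp add: dB)
    have "cnj (mp_dil L m (\<lambda>u. cnj (mp_dil L m (\<lambda>v. wig_kernel h a u v) v)) u) = (?c * cnj ?c) * wig_kernel h a (L *v u) (L *v v)"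
      unfolding mp_dil_def by (simp only: complex_cnj_mult complex_cnj_cnj mult_ac)
    also have "\<dots> = complex_of_real ((1 / (2 * pi * h)) ^ CARD('n)) * (complex_of_real \<bar>det L\<bar> * (\<integral>p. f p \<partial>lborel))"
      unfolding cc wig_kernel_def Let_def Lx f_def by (simp only: mult.left_commute)
    also have "\<dots> = wig_kernel h (\<lambda>z. a (pvec (L *v xpart z) (?B *v ppart z))) u v"
      unfolding wig_kernel_def Let_def I[symmetric] fB xpart_pvec ppart_pvec ..
    finally show "cnj (mp_dil L m (\<lambda>u. cnj (mp_dil L m (\<lambda>v. wig_kernel h a u v) v)) u) = \<dots>" .
  }
qed

subsection \<open>The Fourier transform\<close>

lemma schwartz_heis:
  fixes f :: "real^'n::finite \<Rightarrow> complex"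
  assumes "schwartz f"
  shows "schwartz (heis h z f)"
proof -
  let ?q = "xpart z" and ?p = "ppart z"
  have "schwartz (\<lambda>x. exp (- \<i> * complex_of_real ((?p \<bullet> ?q) / 2 / h)) * (exp (- \<i> * complex_of_real (x \<bullet> (- ?p) / h)) * f (x - ?q)))"
    using schwartz_affine[OF linear_id inj_on_id assms, of "- ?q"]
    by (intro schwartz_scale ft_kernel_schwartz) simp
  moreover have "exp (- \<i> * complex_of_real ((?p \<bullet> ?q) / 2 / h)) * (exp (- \<i> * complex_of_real (x \<bullet> (- ?p) / h)) * f (x - ?q)) = heis h z f x" for x
  proof -
    have "\<i> * complex_of_real ((?p \<bullet> x - (?p \<bullet> ?q) / 2) / h) = - \<i> * complex_of_real ((?p \<bullet> ?q) / 2 / h) + - \<i> * complex_of_real (x \<bullet> (- ?p) / h)"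
      by (simp add: inner_commute diff_divide_distrib right_diff_distrib)
    then show ?thesis unfolding heis_def by (simp only: exp_add mult.assoc)
  qed
  ultimately show ?thesis by (simp only:)
qed

definition mp_J_const :: "'n::finite itself \<Rightarrow> real \<Rightarrow> complex" where
  "mp_J_const _ h = exp (- \<i> * complex_of_real (pi * real CARD('n) / 4)) *
      complex_of_real ((1 / (2 * pi * h)) powr (real CARD('n) / 2))"

lemma mp_J_ft: "mp_J h f x = mp_J_const TYPE('n) h * ft h f x" for x :: "real^'n::finite"
  unfolding mp_J_def ft_def mp_J_const_def by (simp add: inner_commute)

lemma mp_J_const_norm:
  assumes "h > 0"
  shows "mp_J_const TYPE('n::finite) h * cnj (mp_J_const TYPE('n) h) = complex_of_real ((1 / (2 * pi * h)) ^ CARD('n))"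
proof -
  let ?k = "1 / (2 * pi * h)"
  have k: "?k > 0" using assms by simp
  have "norm (mp_J_const TYPE('n) h) = ?k powr (real CARD('n) / 2)"
    unfolding mp_J_const_def by (simp only: norm_mult ft_kernel_norm norm_of_real) simp
  moreover have "(?k powr (real CARD('n) / 2))\<^sup>2 = ?k ^ CARD('n)"
    using k by (simp add: power2_eq_square powr_add[symmetric] powr_realpow)
  ultimately show ?thesis using complex_norm_square[of "mp_J_const TYPE('n) h"] by simp
qed

lemma mp_J_const_nonzero: "h > 0 \<Longrightarrow> mp_J_const TYPE('n::finite) h \<noteq> 0"
  by (simp add: mp_J_const_def)

lemma phase_measurable: "(\<lambda>u::real^'n::finite. exp (\<i> * complex_of_real (u \<bullet> y / h))) \<in> borel_measurable borel"
  unfolding divide_inverse by (intro borel_measurable_continuous_onI continuous_intros)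

lemma tempered_phase: "tempered (\<lambda>f. \<integral>u. exp (\<i> * complex_of_real (u \<bullet> (y :: real^'n::finite) / h)) * f u \<partial>lborel)"
  by (rule tempered_bounded_integral[OF phase_measurable, of _ _ 1]) simp

text \<open>The v-integral is taken in y = u - v, and the u-integral is then centred at x = u - y/2.
  The x-integral is a transform in position, while the y-integral undoes the momentum transform
  inside the kernel by \<open>ft_inversion\<close>. Position and momentum have exchanged roles, a
  quarter turn of the symbol.\<close>

lemma mp_J_kernel:
  fixes a :: "real^('n::finite + 'n) \<Rightarrow> complex" and u0 v0 :: "real^'n"
  assumes a: "schwartz a" and h: "h > 0"
  shows "cnj (mp_J h (\<lambda>u. cnj (mp_J h (\<lambda>v. wig_kernel h a u v) v0)) u0)
    = wig_kernel h (\<lambda>z. a (pvec (- ppart z) (xpart z))) u0 v0"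
proof -
  let ?c = "mp_J_const TYPE('n) h"
  define \<kappa> where "\<kappa> = complex_of_real ((1 / (2 * pi * h)) ^ CARD('n))"
  have h0: "h \<noteq> 0" using h by simp
  have \<kappa>2: "\<kappa> * complex_of_real ((2 * pi * h) ^ CARD('n)) = 1"
    unfolding \<kappa>_def of_real_mult[symmetric] power_mult_distrib[symmetric] using h by simp
  define X Y where "X = (1/2) *\<^sub>R (u0 + v0)" and "Y = u0 - v0"
  define B where "B = pft h a"
  have B: "schwartz B" unfolding B_def by (rule schwartz_pft[OF a h0])
  define g where "g z = B (pvec (xpart z - (1/2) *\<^sub>R ppart z) (ppart z))" for z
  have g: "schwartz g"
  proof -
    have "linear (\<lambda>z::real^('n + 'n). pvec (xpart z - (1/2) *\<^sub>R ppart z) (ppart z))"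
      by (rule linearI) (simp_all add: parts_add parts_scaleR pvec_add pvec_scaleR scaleR_diff_right scaleR_add_right)
    then show ?thesis unfolding g_def
      by (rule schwartz_linear_inv[where k="\<lambda>z. pvec (xpart z + (1/2) *\<^sub>R ppart z) (ppart z)"]) (simp_all add: B)
  qed
  define W where "W u = ft h (\<lambda>v. B (pvec ((1/2) *\<^sub>R (u + v)) (u - v))) v0" for u
  define e where "e y u = exp (\<i> * complex_of_real (u \<bullet> y / h))" for y u :: "real^'n"
  have Kslice: "schwartz (\<lambda>v. B (pvec ((1/2) *\<^sub>R (u + v)) (u - v)))" for u
  proof -
    have "linear (\<lambda>v::real^'n. pvec ((1/2) *\<^sub>R v) (- v))"
      by (rule linearI) (simp_all add: pvec_add pvec_scaleR scaleR_add_right)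
    moreover have "inj (\<lambda>v::real^'n. pvec ((1/2) *\<^sub>R v) (- v))" by (rule injI) simp
    ultimately show ?thesis
      using schwartz_affine[OF _ _ B, of "\<lambda>v. pvec ((1/2) *\<^sub>R v) (- v)" "pvec ((1/2) *\<^sub>R u) u"]
      by (simp add: pvec_add scaleR_add_right add.commute)
  qed
  \<comment> \<open>The phase in v0 left over by the substitution combines with the outer phase in
    u0 to the phase in Y = u0 - v0.\<close>
  have W: "e u0 u * W u = e Y u * (\<integral>y. e v0 y * g (pvec u y) \<partial>lborel)" for u
  proof -
    have "W u = (\<integral>y. exp (- \<i> * complex_of_real ((u - y) \<bullet> v0 / h)) * B (pvec ((1/2) *\<^sub>R (u + (u - y))) (u - (u - y))) \<partial>lborel)"
      unfolding W_def ft_def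
      by (rule lborel_integral_reflect[symmetric]) (rule schwartz_measurable[OF ft_kernel_schwartz[OF Kslice]])
    also have "\<dots> = (\<integral>y. exp (- \<i> * complex_of_real (u \<bullet> v0 / h)) * (e v0 y * g (pvec u y)) \<partial>lborel)"
    proof (rule Bochner_Integration.integral_cong[OF refl])
      fix y
      have "- \<i> * complex_of_real ((u - y) \<bullet> v0 / h) = - \<i> * complex_of_real (u \<bullet> v0 / h) + \<i> * complex_of_real (y \<bullet> v0 / h)"
        by (simp add: inner_diff_left diff_divide_distrib right_diff_distrib)
      moreover have "(1/2) *\<^sub>R (u + (u - y)) = u - (1/2) *\<^sub>R y" by (simp add: vec_eq_iff field_simps)
      ultimately show "exp (- \<i> * complex_of_real ((u - y) \<bullet> v0 / h)) * B (pvec ((1/2) *\<^sub>R (u + (u - y))) (u - (u - y)))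
         = exp (- \<i> * complex_of_real (u \<bullet> v0 / h)) * (e v0 y * g (pvec u y))"
        unfolding e_def g_def by (simp only: exp_add mult.assoc xpart_pvec ppart_pvec) simp
    qed
    also have "\<dots> = exp (- \<i> * complex_of_real (u \<bullet> v0 / h)) * (\<integral>y. e v0 y * g (pvec u y) \<partial>lborel)"
      by (rule integral_mult_right_zero)
    finally have W: "W u = \<dots>" .
    have "\<i> * complex_of_real (u \<bullet> u0 / h) + - \<i> * complex_of_real (u \<bullet> v0 / h) = \<i> * complex_of_real (u \<bullet> Y / h)"
      by (simp add: Y_def inner_diff_right diff_divide_distrib right_diff_distrib)
    then have "e u0 u * exp (- \<i> * complex_of_real (u \<bullet> v0 / h)) = e Y u"
      unfolding e_def by (simp only: exp_add[symmetric])
    then show ?thesis unfolding W by (simp only: mult.assoc[symmetric])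
  qed
  \<comment> \<open>The symbol transformed in position at the frequency Y; it is Schwartz in the
    momentum because integration against a phase is a tempered distribution.\<close>
  define \<alpha> where "\<alpha> p = (\<integral>x. e Y x * a (pvec x p) \<partial>lborel)" for p
  have \<alpha>: "schwartz \<alpha>"
    unfolding \<alpha>_def[abs_def] e_def using schwartz_tempered_slice[OF tempered_phase schwartz_swap[OF a], of Y h] by simp
  have inner: "(\<integral>u. e Y u * g (pvec u y) \<partial>lborel) = exp (\<i> * complex_of_real (((1/2) *\<^sub>R y) \<bullet> Y / h)) * ft h \<alpha> y" for y
  proof -
    have "(\<lambda>u. e Y u * g (pvec u y)) \<in> borel_measurable borel"
      unfolding e_def by (intro borel_measurable_times phase_measurable schwartz_measurable schwartz_slice'[OF g])
    then have "(\<integral>u. e Y u * g (pvec u y) \<partial>lborel) = (\<integral>x. e Y ((1/2) *\<^sub>R y + x) * g (pvec ((1/2) *\<^sub>R y + x) y) \<partial>lborel)"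
      by (rule lborel_integral_translate[symmetric])
    also have "\<dots> = (\<integral>x. exp (\<i> * complex_of_real (((1/2) *\<^sub>R y) \<bullet> Y / h)) * (e Y x * B (pvec x y)) \<partial>lborel)"
    proof (rule Bochner_Integration.integral_cong[OF refl])
      fix x
      have "\<i> * complex_of_real (((1/2) *\<^sub>R y + x) \<bullet> Y / h) = \<i> * complex_of_real (((1/2) *\<^sub>R y) \<bullet> Y / h) + \<i> * complex_of_real (x \<bullet> Y / h)"
        by (simp only: inner_add_left add_divide_distrib of_real_add distrib_left)
      then show "e Y ((1/2) *\<^sub>R y + x) * g (pvec ((1/2) *\<^sub>R y + x) y) = exp (\<i> * complex_of_real (((1/2) *\<^sub>R y) \<bullet> Y / h)) * (e Y x * B (pvec x y))"
        unfolding e_def g_def by (simp only: exp_add mult.assoc xpart_pvec ppart_pvec add_diff_cancel_left')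
    qed
    also have "\<dots> = exp (\<i> * complex_of_real (((1/2) *\<^sub>R y) \<bullet> Y / h)) * (\<integral>x. e Y x * B (pvec x y) \<partial>lborel)"
      by (rule integral_mult_right_zero)
    also have "(\<integral>x. e Y x * B (pvec x y) \<partial>lborel) = ft h \<alpha> y"
      using tempered_fubini[OF tempered_phase[of Y h] tempered_ft[of h y] a]
      unfolding B_def pft_def \<alpha>_def e_def by simp
    finally show ?thesis .
  qed
  have I: "(\<integral>u. e u0 u * W u \<partial>lborel) = complex_of_real ((2 * pi * h) ^ CARD('n)) * \<alpha> X"
  proof -
    have "(\<integral>u. e u0 u * W u \<partial>lborel) = (\<integral>u. e Y u * (\<integral>y. e v0 y * g (pvec u y) \<partial>lborel) \<partial>lborel)"
      unfolding W ..
    also have "\<dots> = (\<integral>y. e v0 y * (\<integral>u. e Y u * g (pvec u y) \<partial>lborel) \<partial>lborel)"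
      using tempered_fubini[OF tempered_phase[of Y h] tempered_phase[of v0 h] g] unfolding e_def .
    also have "\<dots> = (\<integral>y. exp (\<i> * complex_of_real (X \<bullet> y / h)) * ft h \<alpha> y \<partial>lborel)"
    proof (rule Bochner_Integration.integral_cong[OF refl])
      fix y
      \<comment> \<open>v0 + Y/2 is the midpoint X, at which the inversion formula is then
        applied.\<close>
      have "\<i> * complex_of_real (y \<bullet> v0 / h) + \<i> * complex_of_real (((1/2) *\<^sub>R y) \<bullet> Y / h) = \<i> * complex_of_real (X \<bullet> y / h)"
        unfolding distrib_left[symmetric] of_real_add[symmetric] add_divide_distrib[symmetric]
        by (simp add: X_def Y_def inner_diff_right inner_add_left inner_commute[of y] field_simps)
      then show "e v0 y * (\<integral>u. e Y u * g (pvec u y) \<partial>lborel) = exp (\<i> * complex_of_real (X \<bullet> y / h)) * ft h \<alpha> y"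
        unfolding inner unfolding e_def by (simp only: mult.assoc[symmetric] exp_add[symmetric])
    qed
    also have "\<dots> = complex_of_real ((2 * pi * h) ^ CARD('n)) * \<alpha> X" by (rule ft_inversion[OF \<alpha> h])
    finally show ?thesis .
  qed
  have ftK: "ft h (\<lambda>v. wig_kernel h a u v) v0 = \<kappa> * W u" for u
    unfolding wig_kernel_pft W_def B_def[symmetric] \<kappa>_def by (rule tempered_scale[OF tempered_ft Kslice])
  have ce: "cnj (exp (- \<i> * complex_of_real (u \<bullet> u0 / h))) = e u0 u" for u
    unfolding e_def exp_cnj by simp
  have "cnj (mp_J h (\<lambda>u. cnj (mp_J h (\<lambda>v. wig_kernel h a u v) v0)) u0)
    = cnj ?c * (\<integral>u. cnj (exp (- \<i> * complex_of_real (u \<bullet> u0 / h)) * cnj (?c * (\<kappa> * W u))) \<partial>lborel)"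
    unfolding mp_J_ft ftK unfolding ft_def by (subst complex_cnj_mult) (simp only: Bochner_Integration.integral_cnj)
  also have "(\<lambda>u. cnj (exp (- \<i> * complex_of_real (u \<bullet> u0 / h)) * cnj (?c * (\<kappa> * W u)))) = (\<lambda>u. (?c * \<kappa>) * (e u0 u * W u))"
    by (rule ext) (simp only: complex_cnj_mult complex_cnj_cnj ce mult_ac)
  also have "(\<integral>u. (?c * \<kappa>) * (e u0 u * W u) \<partial>lborel) = (?c * \<kappa>) * (complex_of_real ((2 * pi * h) ^ CARD('n)) * \<alpha> X)"
    unfolding I[symmetric] by (rule integral_mult_right_zero)
  also have "cnj ?c * ((?c * \<kappa>) * (complex_of_real ((2 * pi * h) ^ CARD('n)) * \<alpha> X))
    = (?c * cnj ?c) * (\<kappa> * complex_of_real ((2 * pi * h) ^ CARD('n))) * \<alpha> X"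
    by (simp only: mult_ac)
  also have "\<dots> = \<kappa> * \<alpha> X" by (simp only: \<kappa>2 mp_J_const_norm[OF h] \<kappa>_def[symmetric] mult_1_right)
  \<comment> \<open>The reflection restores the sign of the kernel and puts - p into the position
    slot.\<close>
  also have "\<alpha> X = (\<integral>p. e Y (0 - p) * a (pvec (0 - p) X) \<partial>lborel)"
    unfolding \<alpha>_def e_def
    by (rule lborel_integral_reflect[symmetric])
      (intro borel_measurable_times phase_measurable schwartz_measurable schwartz_slice'[OF a])
  also have "(\<lambda>p. e Y (0 - p) * a (pvec (0 - p) X)) = (\<lambda>p. exp (- \<i> * complex_of_real (p \<bullet> Y / h)) * a (pvec (- p) X))"
    by (rule ext) (simp add: e_def)
  finally show ?thesis
    unfolding wig_kernel_def Let_def \<kappa>_def X_def Y_def xpart_pvec ppart_pvec .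
qed

lemma mp_J_good:
  assumes h: "h > 0"
  shows "mp_good h (mp_J h) (\<lambda>z::real^('n::finite + 'n). pvec (ppart z) (- xpart z)) (\<lambda>z. pvec (- ppart z) (xpart z))"
  unfolding mp_good_def
proof (intro conjI allI impI)
  let ?c = "mp_J_const TYPE('n) h"
  have h0: "h \<noteq> 0" using h by simp
  have op: "schwartz_op (mp_J h :: (real^'n \<Rightarrow> complex) \<Rightarrow> _)"
    unfolding mp_J_ft[abs_def] by (rule schwartz_op_scale[OF schwartz_op_ft[OF h0]])
  {
    fix f :: "real^'n \<Rightarrow> complex" assume "schwartz f"
    then show "schwartz (mp_J h f)" by (rule schwartz_op_schwartz[OF op])
  next
    fix T :: "(real^'n \<Rightarrow> complex) \<Rightarrow> complex" assume "tempered T"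
    then show "tempered (\<lambda>f. T (mp_J h f))"
      by (rule tempered_comp[OF _ op])
        (simp_all add: mp_J_ft[abs_def] tempered_add[OF tempered_ft] tempered_scale[OF tempered_ft] distrib_left mult_ac)
  next
    fix g :: "real^'n \<Rightarrow> complex" assume g: "schwartz g"
    \<comment> \<open>The preimage is the reflected transform of g; \<open>?k\<close> cancels the
      constant of \<open>mp_J\<close> and the factor (2 pi h)^n of the inversion formula.\<close>
    let ?k = "complex_of_real (1 / (2 * pi * h) ^ CARD('n)) / ?c"
    define f where "f x = ?k * ft h g (0 - x)" for x
    have ftg: "schwartz (ft h g)" by (rule schwartz_op_schwartz[OF schwartz_op_ft[OF h0] g])
    have "linear (\<lambda>x::real^'n. 0 - x)" by (rule linearI) simp_all
    then have S: "schwartz (\<lambda>x. ft h g (0 - x))" by (rule schwartz_linear) (simp_all add: ftg inj_on_def)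
    have f: "schwartz f" unfolding f_def by (rule schwartz_scale[OF S])
    have "mp_J h f x = g x" for x
    proof -
      have m: "(\<lambda>y. exp (\<i> * complex_of_real (x \<bullet> y / h)) * ft h g y) \<in> borel_measurable borel"
        unfolding inner_commute[of x] by (intro borel_measurable_times phase_measurable schwartz_measurable ftg)
      have "ft h (\<lambda>x. ft h g (0 - x)) x = (\<integral>y. exp (\<i> * complex_of_real (x \<bullet> (0 - y) / h)) * ft h g (0 - y) \<partial>lborel)"
        unfolding ft_def[of h "\<lambda>x. ft h g (0 - x)"] by (simp add: inner_commute)
      also have "\<dots> = (\<integral>y. exp (\<i> * complex_of_real (x \<bullet> y / h)) * ft h g y \<partial>lborel)"
        by (rule lborel_integral_reflect[OF m])
      also have "\<dots> = complex_of_real ((2 * pi * h) ^ CARD('n)) * g x" by (rule ft_inversion[OF g h])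
      finally have "mp_J h f x = ?c * (?k * (complex_of_real ((2 * pi * h) ^ CARD('n)) * g x))"
        unfolding mp_J_ft f_def tempered_scale[OF tempered_ft S] by simp
      then show ?thesis using h mp_J_const_nonzero[OF h, where 'n='n] by simp
    qed
    with f show "\<exists>f. schwartz f \<and> mp_J h f = g" by blast
  next
    fix G :: "real^('n + 'n) \<Rightarrow> complex" assume G: "schwartz G"
    from schwartz_scale[OF schwartz_pft[OF G h0]]
    show "schwartz (\<lambda>z. mp_J h (\<lambda>v. G (pvec (xpart z) v)) (ppart z))"
      by (simp add: mp_J_ft pft_def)
  next
    fix z :: "real^('n + 'n)" and f :: "real^'n \<Rightarrow> complex" assume f: "schwartz f"
    let ?q = "xpart z" and ?p = "ppart z"
    show "mp_J h (heis h z f) = heis h (pvec ?p (- ?q)) (mp_J h f)"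
    proof
      fix x
      let ?e = "exp (\<i> * complex_of_real (((- ?q) \<bullet> x - ((- ?q) \<bullet> ?p) / 2) / h))"
      have m: "(\<lambda>y. exp (- \<i> * complex_of_real (y \<bullet> x / h)) * heis h z f y) \<in> borel_measurable borel"
        by (rule schwartz_measurable[OF ft_kernel_schwartz[OF schwartz_heis[OF f]]])
      have "ft h (heis h z f) x = (\<integral>s. exp (- \<i> * complex_of_real ((?q + s) \<bullet> x / h)) * heis h z f (?q + s) \<partial>lborel)"
        unfolding ft_def by (rule lborel_integral_translate[OF m, symmetric])
      also have "\<dots> = (\<integral>s. ?e * (exp (- \<i> * complex_of_real (s \<bullet> (x - ?p) / h)) * f s) \<partial>lborel)"
      proof (rule Bochner_Integration.integral_cong[OF refl])
        fix s
        have "- \<i> * complex_of_real ((?q + s) \<bullet> x / h) + \<i> * complex_of_real ((?p \<bullet> (?q + s) - (?p \<bullet> ?q) / 2) / h)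
           = \<i> * complex_of_real (((- ?q) \<bullet> x - ((- ?q) \<bullet> ?p) / 2) / h) + - \<i> * complex_of_real (s \<bullet> (x - ?p) / h)"
        proof -
          have "- ((?q + s) \<bullet> x / h) + (?p \<bullet> (?q + s) - (?p \<bullet> ?q) / 2) / h = ((- ?q) \<bullet> x - ((- ?q) \<bullet> ?p) / 2) / h + - (s \<bullet> (x - ?p) / h)"
            using h by (simp add: inner_add_left inner_add_right inner_diff_right inner_commute[of ?p] field_simps)
          from arg_cong[OF this, of "\<lambda>r. \<i> * complex_of_real r"] show ?thesis
            by (simp only: of_real_add of_real_minus distrib_left mult_minus_right mult_minus_left)
        qed
        then show "exp (- \<i> * complex_of_real ((?q + s) \<bullet> x / h)) * heis h z f (?q + s)
          = ?e * (exp (- \<i> * complex_of_real (s \<bullet> (x - ?p) / h)) * f s)"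
          unfolding heis_def mult.assoc[symmetric] exp_add[symmetric] by (simp only: add_diff_cancel_left')
      qed
      also have "\<dots> = ?e * ft h f (x - ?p)" unfolding ft_def by (rule integral_mult_right_zero)
      finally show "mp_J h (heis h z f) x = heis h (pvec ?p (- ?q)) (mp_J h f) x"
        unfolding mp_J_ft heis_def xpart_pvec ppart_pvec by (simp only: mult.left_commute)
    qed
  next
    fix a :: "real^('n + 'n) \<Rightarrow> complex" assume a: "schwartz a"
    have "linear (\<lambda>z::real^('n + 'n). pvec (- ppart z) (xpart z))"
      by (rule linearI) (simp_all add: parts_add parts_scaleR pvec_add pvec_scaleR)
    then show "schwartz (\<lambda>z. a (pvec (- ppart z) (xpart z)))"
      by (rule schwartz_linear_inv[where k="\<lambda>z. pvec (ppart z) (- xpart z)"]) (simp_all add: a)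
  next
    fix a :: "real^('n + 'n) \<Rightarrow> complex" and u v :: "real^'n" assume "schwartz a"
    then show "cnj (mp_J h (\<lambda>u. cnj (mp_J h (\<lambda>v. wig_kernel h a u v) v)) u) = wig_kernel h (\<lambda>z. a (pvec (- ppart z) (xpart z))) u v"
      by (rule mp_J_kernel[OF _ h])
  }
qed simp

subsection \<open>The covering projection\<close>

theorem metaplectic_good:
  assumes "A \<in> metaplectic h" and h: "h > 0"
  shows "\<exists>s si. mp_good h A s si"
  using assms(1)
proof induction
  case gen_J
  show ?case using mp_J_good[OF h] by blast
next
  case (gen_chirp P)
  then show ?case using mp_chirp_good[of P h] h by blast
next
  case (gen_dil L m)
  then show ?case using mp_dil_good[of L h m] by blast
next
  case (comp A B)
  then obtain s si t ti where "mp_good h A s si" "mp_good h B t ti" by blast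
  from mp_good_comp[OF this] h show ?case by blast
qed

text \<open>The modulus of a shifted Gaussian at its centre determines the position shift. What
  remains is a phase that is affine in x, and a nonzero momentum difference would let it take the
  value pi.\<close>

lemma heis_gauss_inject:
  fixes w w' :: "real^('n::finite + 'n)"
  assumes h: "h > 0" and eq: "heis h w (gauss 1) = heis h w' (gauss 1)"
  shows "w = w'"
proof -
  let ?q = "xpart w" and ?p = "ppart w" and ?q' = "xpart w'" and ?p' = "ppart w'"
  have pt: "exp (\<i> * complex_of_real ((?p \<bullet> x - (?p \<bullet> ?q) / 2) / h)) * gauss 1 (x - ?q)
     = exp (\<i> * complex_of_real ((?p' \<bullet> x - (?p' \<bullet> ?q') / 2) / h)) * gauss 1 (x - ?q')" for x
    using fun_cong[OF eq, of x] by (simp add: heis_def)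
  have "norm (gauss 1 (?q - ?q)) = norm (gauss 1 (?q - ?q'))"
    using arg_cong[OF pt[of ?q], of norm] unfolding norm_mult norm_exp_i_times by simp
  then have "exp (- ((?q - ?q') \<bullet> (?q - ?q'))) = 1" by (simp add: gauss_def)
  then have q: "?q = ?q'" by simp
  define d where "d = ?p - ?p'"
  have ex: "exp (\<i> * complex_of_real ((d \<bullet> x - (d \<bullet> ?q) / 2) / h)) = 1" for x
  proof -
    have "\<i> * complex_of_real ((?p \<bullet> x - (?p \<bullet> ?q) / 2) / h) = \<i> * complex_of_real ((d \<bullet> x - (d \<bullet> ?q) / 2) / h) + \<i> * complex_of_real ((?p' \<bullet> x - (?p' \<bullet> ?q) / 2) / h)"
      unfolding distrib_left[symmetric] of_real_add[symmetric] add_divide_distrib[symmetric]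
      by (simp add: d_def inner_diff_left diff_divide_distrib algebra_simps)
    then show ?thesis
      using pt[of x] gauss_nonzero[of 1 "x - ?q"] unfolding q[symmetric] by (simp only: exp_add mult_cancel_right mult_cancel_right2 exp_not_eq_zero simp_thms)
  qed
  have "d = 0"
  proof (rule ccontr)
    assume d: "d \<noteq> 0"
    \<comment> \<open>From q/2, where the phase is 0, move along d until it equals pi.\<close>
    define x where "x = (1/2) *\<^sub>R ?q + ((h * pi) / (d \<bullet> d)) *\<^sub>R d"
    have "(d \<bullet> x - (d \<bullet> ?q) / 2) / h = pi"
      using d h by (simp add: x_def inner_add_right)
    with ex[of x] have "exp (\<i> * complex_of_real pi) = 1" by simp
    then show False by (simp add: exp_pi_i')
  qed
  then show ?thesis using q by (metis d_def eq_iff_diff_eq_0 pvec_parts)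
qed

text \<open>\<open>metaplectic_good\<close> obtains s from a factorisation of A, whereas
  \<open>mp_covers\<close> constrains A itself. A maps some Schwartz function to a Gaussian, whose
  Heisenberg translates tell the two images of z apart.\<close>

lemma mp_covers_unique:
  assumes good: "mp_good h A s si" and cov: "mp_covers h A S" and h: "h > 0"
  shows "S *v z = s z"
proof -
  obtain f where f: "schwartz f" "A f = gauss 1"
    using mp_goodD(3)[OF good schwartz_gauss'[OF zero_less_one]] by blast
  have "heis h (S *v z) (A f) = heis h (s z) (A f)"
    using cov f(1) mp_goodD(5)[OF good f(1), of z] unfolding mp_covers_def by simp
  then show ?thesis unfolding f(2) by (rule heis_gauss_inject[OF h])
qed

section \<open>Antisymplectic covariance\<close>

lemma Cmat_vector: "Cmat *v z = pvec (xpart z) (- ppart z)"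
proof -
  have "(Cmat *v z) $ Inl i = xpart z $ i" "(Cmat *v z) $ Inr i = - ppart z $ i" for i
    by (simp_all add: Cmat_def matrix_vector_mult_def sum_UNIV_sum if_distrib[of "\<lambda>c. c * _"] cong: if_cong)
  then show ?thesis by (simp add: vec_sum_eq_iff)
qed

lemma Jmat_vector: "Jmat *v z = pvec (ppart z) (- xpart z)"
proof -
  have "(Jmat *v z) $ Inl i = ppart z $ i" "(Jmat *v z) $ Inr i = - xpart z $ i" for i
    by (simp_all add: Jmat_def matrix_vector_mult_def sum_UNIV_sum if_distrib[of "\<lambda>c. c * _"] cong: if_cong)
  then show ?thesis by (simp add: vec_sum_eq_iff)
qed

lemma Jmat_square: "Jmat ** Jmat = (- mat 1 :: real^('a::finite + 'a)^('a + 'a))"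
proof -
  have "(- mat 1 :: real^('a + 'a)^('a + 'a)) *v z = - z" for z
    by (simp add: matrix_vector_mult_def mat_def vec_eq_iff if_distrib[of uminus] if_distrib[of "\<lambda>c. c * _"] cong: if_cong)
  then have "(Jmat ** Jmat) *v z = (- mat 1) *v z" for z :: "real^('a + 'a)"
    by (simp add: matrix_vector_mul_assoc[symmetric] Jmat_vector vec_sum_eq_iff)
  then show ?thesis by (simp add: matrix_eq)
qed

lemma abs_det_uminus:
  fixes A :: "real^'m::finite^'m"
  shows "\<bar>det (- A)\<bar> = \<bar>det A\<bar>"
proof -
  let ?E = "- mat 1 :: real^'m^'m"
  have E: "?E *v x = - x" for x
    by (simp add: matrix_vector_mult_def mat_def vec_eq_iff if_distrib[of uminus] if_distrib[of "\<lambda>c. c * _"] cong: if_cong)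
  have "(?E ** ?E) *v x = mat 1 *v x" for x by (simp only: matrix_vector_mul_assoc[symmetric] E) simp
  then have "?E ** ?E = mat 1" by (simp only: matrix_eq) simp
  from arg_cong[OF this, of det] have "(det ?E)\<^sup>2 = 1" unfolding det_mul det_I power2_eq_square .
  then have E1: "\<bar>det ?E\<bar> = 1" unfolding power2_eq_1_iff by auto
  have "(- A) *v x = (?E ** A) *v x" for x
    unfolding matrix_vector_mul_assoc[symmetric] E by (simp add: matrix_vector_mult_def vec_eq_iff sum_negf)
  then have "- A = ?E ** A" by (simp only: matrix_eq) simp
  from arg_cong[OF this, of det] have "\<bar>det (- A)\<bar> = \<bar>det ?E\<bar> * \<bar>det A\<bar>" unfolding det_mul by (simp only: abs_mult)
  then show ?thesis unfolding E1 by simp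
qed

text \<open>Removes the Jacobian factor of \<open>dist_comp\<close>. Working with absolute values
  avoids the sign of the determinant of - J.\<close>

lemma abs_det_antisymplectic:
  fixes M :: "real^('n::finite + 'n)^('n + 'n)"
  assumes "antisymplectic M"
  shows "\<bar>det M\<bar> = 1"
proof -
  let ?J = "Jmat :: real^('n + 'n)^('n + 'n)"
  have "\<bar>det ?J\<bar> * \<bar>det ?J\<bar> = \<bar>det (- mat 1 :: real^('n + 'n)^('n + 'n))\<bar>"
    unfolding Jmat_square[symmetric] by (simp add: det_mul abs_mult)
  then have J: "\<bar>det ?J\<bar> \<noteq> 0" by (auto simp: abs_det_uminus)
  have "\<bar>det (transpose M ** ?J ** M)\<bar> = \<bar>det ?J\<bar>"
    using assms unfolding antisymplectic_def by (simp only: abs_det_uminus)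
  then have "\<bar>det M\<bar> * \<bar>det M\<bar> * \<bar>det ?J\<bar> = 1 * \<bar>det ?J\<bar>"
    by (simp add: det_mul abs_mult mult_ac)
  then have "\<bar>det M\<bar> * \<bar>det M\<bar> = 1" using J by (simp only: mult_cancel_right) simp
  then have "\<bar>det M\<bar>\<^sup>2 = 1" by (simp add: power2_eq_square)
  then show ?thesis unfolding power2_eq_1_iff using abs_ge_zero[of "det M"] by linarith
qed

text \<open>Reversing the momentum exchanges the two arguments of the kernel. The covariance of A
  accounts for the symplectic factor C M, the exchange turns \<psi> \<otimes> conj \<psi> into conj
  \<psi> \<otimes> \<psi>, and \<open>tempered_fubini\<close> restores the order of the two
  factors.\<close>

theorem wigner_antisymplectic:
  fixes M :: "real^('n::finite + 'n)^('n + 'n)"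
  assumes h: "h > 0" and M: "invertible M" and anti: "antisymplectic M"
    and A: "A \<in> metaplectic h" and cov: "mp_covers h A (Cmat ** M)" and \<psi>: "tempered \<psi>" and a: "schwartz a"
  shows "dist_comp M (wigner h \<psi>) a = wigner h (mp_inv_dist A (dist_conj \<psi>)) a"
proof -
  have h0: "h \<noteq> 0" using h by simp
  obtain s si where good: "mp_good h A s si" using metaplectic_good[OF A h] by blast
  define b where "b w = a (matrix_inv M *v w)" for w
  have b: "schwartz b" unfolding b_def by (rule schwartz_matrix[OF invertible_matrix_inv[OF M] a])
  \<comment> \<open>s is the action of C M, and C is an involution, so its inverse is
    \<open>matrix_inv M\<close> after C.\<close>
  have si: "si z = matrix_inv M *v (Cmat *v z)" for z
  proof -
    let ?w = "matrix_inv M *v (Cmat *v z)"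
    have "s ?w = z"
      using mp_covers_unique[OF good cov h, of ?w]
      by (simp add: matrix_vector_mul_assoc[symmetric] matrix_inv_vector[OF M] Cmat_vector)
    then show ?thesis using mp_goodD(6)[OF good, of ?w] by simp
  qed
  have flip: "wig_kernel h (\<lambda>z. a (si z)) u v = wig_kernel h b v u" for u v
  proof -
    let ?x = "(1/2) *\<^sub>R (u + v)"
    have x: "(1/2) *\<^sub>R (v + u) = ?x" by (simp add: add.commute)
    have m: "(\<lambda>p. exp (- \<i> * complex_of_real (p \<bullet> (v - u) / h)) * b (pvec ?x p)) \<in> borel_measurable borel"
      by (rule schwartz_measurable[OF ft_kernel_schwartz[OF schwartz_slice[OF b]]])
    have "(\<integral>p. exp (- \<i> * complex_of_real (p \<bullet> (u - v) / h)) * a (si (pvec ?x p)) \<partial>lborel)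
      = (\<integral>p. exp (- \<i> * complex_of_real ((0 - p) \<bullet> (v - u) / h)) * b (pvec ?x (0 - p)) \<partial>lborel)"
      by (rule Bochner_Integration.integral_cong[OF refl]) (simp add: si b_def Cmat_vector inner_diff_right)
    also have "\<dots> = (\<integral>p. exp (- \<i> * complex_of_real (p \<bullet> (v - u) / h)) * b (pvec ?x p) \<partial>lborel)"
      by (rule lborel_integral_reflect[OF m])
    finally show ?thesis unfolding wig_kernel_def Let_def x by simp
  qed
  define G where "G z = A (\<lambda>v. wigk h a (pvec (xpart z) v)) (ppart z)" for z
  have G: "schwartz G" unfolding G_def by (rule mp_goodD(4)[OF good schwartz_wigk[OF a h0]])
  have AK: "A (\<lambda>v. wig_kernel h a u v) = (\<lambda>v. G (pvec u v))" for u
    by (simp add: G_def)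
  \<comment> \<open>A passes under the conjugate of \<psi>, so both copies of A meet at the kernel,
    where the covariance applies.\<close>
  have pull: "A (\<lambda>u. cnj (\<psi> (\<lambda>v. G (pvec u v)))) = (\<lambda>w. cnj (\<psi> (\<lambda>v. wig_kernel h b v w)))"
  proof -
    have "A (\<lambda>u. dist_conj \<psi> (\<lambda>v. cnj (G (pvec u v)))) = (\<lambda>w. dist_conj \<psi> (\<lambda>v. A (\<lambda>u. cnj (G (pvec u v))) w))"
      by (rule mp_good_interchange[OF good tempered_dist_conj[OF \<psi>] schwartz_cnj[OF G]])
    moreover have "cnj (A (\<lambda>u. cnj (G (pvec u v))) w) = wig_kernel h b v w" for v w
      using mp_goodD(8)[OF good a, where u=w and v=v] by (simp add: AK[unfolded fun_eq_iff] flip)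
    ultimately show ?thesis unfolding dist_conj_def complex_cnj_cnj by simp
  qed
  have "wigner h (mp_inv_dist A (dist_conj \<psi>)) a = cnj (\<psi> (A (\<lambda>u. cnj (\<psi> (A (\<lambda>v. wig_kernel h a u v))))))"
    unfolding wigner_def mp_inv_dist_def dist_conj_def complex_cnj_cnj by simp
  also have "\<dots> = cnj (\<psi> (\<lambda>w. cnj (\<psi> (\<lambda>v. wig_kernel h b v w))))"
    unfolding AK pull ..
  also have "\<dots> = dist_conj \<psi> (\<lambda>w. \<psi> (\<lambda>v. wigk h b (pvec v w)))" by (simp add: dist_conj_def)
  also have "\<dots> = \<psi> (\<lambda>u. dist_conj \<psi> (\<lambda>v. wigk h b (pvec u v)))"
    by (rule tempered_fubini[OF \<psi> tempered_dist_conj[OF \<psi>] schwartz_wigk[OF b h0], symmetric])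
  also have "\<dots> = dist_comp M (wigner h \<psi>) a"
    unfolding dist_comp_def abs_det_antisymplectic[OF anti] wigner_def b_def by simp
  finally show ?thesis ..
qed

section \<open>The Wigner function of a Gaussian\<close>

definition psi_gauss :: "real \<Rightarrow> real^'n::finite^'n \<Rightarrow> real^'n \<Rightarrow> complex" where
  "psi_gauss h L x = gauss (1 / (2 * h)) (L *v x)"

lemma gauss_cnj [simp]: "cnj (gauss c x) = gauss c x" by (simp add: gauss_def)

text \<open>The parallelogram identity in the exponent: midpoint and difference separate.\<close>

lemma gauss_sum_diff:
  shows "gauss (1 / (2 * h)) (x + (1/2) *\<^sub>R y) * gauss (1 / (2 * h)) (x - (1/2) *\<^sub>R y)
    = gauss (1 / h) x * gauss (1 / (4 * h)) y"
proof -
  have "- (1 / (2 * h)) * ((x + (1/2) *\<^sub>R y) \<bullet> (x + (1/2) *\<^sub>R y)) + - (1 / (2 * h)) * ((x - (1/2) *\<^sub>R y) \<bullet> (x - (1/2) *\<^sub>R y))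
    = - (1 / h) * (x \<bullet> x) + - (1 / (4 * h)) * (y \<bullet> y)"
  proof -
    have 1: "(x + (1/2) *\<^sub>R y) \<bullet> (x + (1/2) *\<^sub>R y) = x \<bullet> x + x \<bullet> y + (y \<bullet> y) / 4"
      "(x - (1/2) *\<^sub>R y) \<bullet> (x - (1/2) *\<^sub>R y) = x \<bullet> x - x \<bullet> y + (y \<bullet> y) / 4"
      by (simp_all add: inner_add_left inner_add_right inner_diff_left inner_diff_right inner_commute[of y x] add_divide_distrib diff_divide_distrib)
    obtain k where k: "1 / h = k" by blast
    have k': "1 / (2 * h) = k / 2" "1 / (4 * h) = k / 4" unfolding k[symmetric] by simp_all
    show ?thesis unfolding 1 k k' by (simp add: algebra_simps)
  qed
  then show ?thesis
    unfolding gauss_def of_real_mult[symmetric] exp_add[symmetric] by (simp only:)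
qed

lemma schwartz_psi_gauss:
  assumes "h > 0" "invertible L"
  shows "schwartz (psi_gauss h L)"
  unfolding psi_gauss_def[abs_def]
  by (rule schwartz_matrix[OF assms(2) schwartz_gauss']) (use assms(1) in simp)

text \<open>The substitution of L y moves L to the frequency as its inverse transpose. The Jacobian
  remains as a factor on the left, so no determinant is divided by.\<close>

lemma psi_gauss_ft:
  fixes L :: "real^'n::finite^'n"
  assumes h: "h > 0" and L: "invertible L"
  shows "complex_of_real \<bar>det L\<bar> * (\<integral>y. exp (- \<i> * complex_of_real (p \<bullet> y / h)) * gauss (1 / (4 * h)) (L *v y) \<partial>lborel)
    = complex_of_real (sqrt (4 * pi * h) ^ CARD('n)) * gauss (1 / h) (matrix_inv (transpose L) *v p)"
proof -
  let ?B = "matrix_inv (transpose L)"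
  have tL: "invertible (transpose L)" using L by (rule transpose_invertible)
  have h4: "1 / (4 * h) > 0" using h by simp
  define f where "f y = exp (- \<i> * complex_of_real (((1 / h) *\<^sub>R (?B *v p)) \<bullet> y)) * gauss (1 / (4 * h)) y" for y
  have f_eq: "f y = exp (- \<i> * complex_of_real (y \<bullet> (?B *v p) / h)) * gauss (1 / (4 * h)) y" for y
    by (simp add: f_def inner_commute)
  have f: "schwartz f" unfolding f_eq by (rule ft_kernel_schwartz[OF schwartz_gauss'[OF h4]])
  have "(?B *v p) \<bullet> (L *v y) = p \<bullet> y" for y
    using transpose_inner[of L "?B *v p" y] by (simp add: matrix_inv_vector[OF tL] del: transpose_matrix_vector)
  then have "f (L *v y) = exp (- \<i> * complex_of_real (p \<bullet> y / h)) * gauss (1 / (4 * h)) (L *v y)" for y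
    by (simp add: f_def)
  then have "complex_of_real \<bar>det L\<bar> * (\<integral>y. exp (- \<i> * complex_of_real (p \<bullet> y / h)) * gauss (1 / (4 * h)) (L *v y) \<partial>lborel) = (\<integral>y. f y \<partial>lborel)"
    using integral_matrix[OF L f] by simp
  also have "\<dots> = complex_of_real (sqrt (pi / (1 / (4 * h))) ^ CARD('n)) * gauss (1 / (4 * (1 / (4 * h)))) ((1 / h) *\<^sub>R (?B *v p))"
    unfolding f_def by (rule gauss_ft[OF h4])
  also have "pi / (1 / (4 * h)) = 4 * pi * h" by simp
  also have "gauss (1 / (4 * (1 / (4 * h)))) ((1 / h) *\<^sub>R (?B *v p)) = gauss (1 / h) (?B *v p)"
    unfolding gauss_scaleR using h by (simp add: power2_eq_square)
  finally show ?thesis .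
qed

text \<open>In midpoint and difference variables the two copies of the state separate into a
  Gaussian in x and one in y, and the Fourier integral over y produces the Gaussian in p. The
  functions F and H gather factors into one Schwartz function of two variables, so that
  \<open>tempered_fubini\<close> can exchange the integrals.\<close>

lemma wigner_psi_gauss:
  fixes L :: "real^'n::finite^'n" and b :: "real^('n + 'n) \<Rightarrow> complex"
  assumes h: "h > 0" and L: "invertible L" and b: "schwartz b"
  shows "complex_of_real \<bar>det L\<bar> * wigner h (fun_dist (psi_gauss h L)) b
    = complex_of_real ((1 / (2 * pi * h)) ^ CARD('n) * sqrt (4 * pi * h) ^ CARD('n)) *
      (\<integral>x. (\<integral>p. gauss (1 / h) (L *v x) * gauss (1 / h) (matrix_inv (transpose L) *v p) * b (pvec x p) \<partial>lborel) \<partial>lborel)"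
proof -
  have h0: "h \<noteq> 0" using h by simp
  let ?\<psi> = "psi_gauss h L"
  define \<kappa> where "\<kappa> = complex_of_real ((1 / (2 * pi * h)) ^ CARD('n))"
  define B where "B = pft h b"
  have B: "schwartz B" unfolding B_def by (rule schwartz_pft[OF b h0])
  have \<psi>: "schwartz ?\<psi>" by (rule schwartz_psi_gauss[OF h L])
  define g1 :: "real^'n \<Rightarrow> complex" where "g1 = gauss (1 / h)"
  define g4 :: "real^'n \<Rightarrow> complex" where "g4 x = gauss (1 / (4 * h)) (L *v x)" for x :: "real^'n"
  have Sg1: "schwartz (\<lambda>x. g1 (L *v x))" unfolding g1_def
    by (rule schwartz_matrix[OF L schwartz_gauss']) (use h in simp)
  have Sg4: "schwartz g4" unfolding g4_def[abs_def]
    by (rule schwartz_matrix[OF L schwartz_gauss']) (use h in simp)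
  define F where "F z = (?\<psi> (xpart z) * ?\<psi> (xpart z - ppart z)) * B (pvec (xpart z - (1/2) *\<^sub>R ppart z) (ppart z))" for z
  have F: "schwartz F"
  proof -
    have "linear (\<lambda>z::real^('n + 'n). pvec (xpart z) (xpart z - ppart z))"
      by (rule linearI) (simp_all add: parts_add parts_scaleR pvec_add pvec_scaleR scaleR_diff_right)
    then have 1: "schwartz (\<lambda>z. (\<lambda>z. ?\<psi> (xpart z) * ?\<psi> (ppart z)) (pvec (xpart z) (xpart z - ppart z)))"
      by (rule schwartz_linear_inv[where k="\<lambda>z. pvec (xpart z) (xpart z - ppart z)"]) (simp_all add: schwartz_tensor \<psi>)
    have "linear (\<lambda>z::real^('n + 'n). pvec (xpart z - (1/2) *\<^sub>R ppart z) (ppart z))"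
      by (rule linearI) (simp_all add: parts_add parts_scaleR pvec_add pvec_scaleR scaleR_diff_right scaleR_add_right)
    then have 2: "schwartz (\<lambda>z. B (pvec (xpart z - (1/2) *\<^sub>R ppart z) (ppart z)))"
      by (rule schwartz_linear_inv[where k="\<lambda>z. pvec (xpart z + (1/2) *\<^sub>R ppart z) (ppart z)"]) (simp_all add: B)
    show ?thesis unfolding F_def using schwartz_mult[OF 1 2] by simp
  qed
  have K: "wig_kernel h b u v = \<kappa> * B (pvec ((1/2) *\<^sub>R (u + v)) (u - v))" for u v
    unfolding wig_kernel_pft B_def \<kappa>_def ..
  have inner1: "?\<psi> u * dist_conj (fun_dist ?\<psi>) (\<lambda>v. wig_kernel h b u v) = \<kappa> * (\<integral>y. F (pvec u y) \<partial>lborel)" for u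
  proof -
    have m: "(\<lambda>v. ?\<psi> v * wig_kernel h b u v) \<in> borel_measurable borel"
      using schwartz_slice[OF schwartz_wigk[OF b h0], of u]
      by (intro borel_measurable_times schwartz_measurable \<psi>) simp
    have "dist_conj (fun_dist ?\<psi>) (\<lambda>v. wig_kernel h b u v) = (\<integral>v. cnj (?\<psi> v * cnj (wig_kernel h b u v)) \<partial>lborel)"
      unfolding dist_conj_def fun_dist_def by (rule Bochner_Integration.integral_cnj[symmetric])
    also have "\<dots> = (\<integral>v. ?\<psi> v * wig_kernel h b u v \<partial>lborel)" by (simp add: psi_gauss_def)
    also have "\<dots> = (\<integral>y. ?\<psi> (u - y) * wig_kernel h b u (u - y) \<partial>lborel)"
      by (rule lborel_integral_reflect[OF m, symmetric])
    finally have "?\<psi> u * dist_conj (fun_dist ?\<psi>) (\<lambda>v. wig_kernel h b u v) = (\<integral>y. ?\<psi> u * (?\<psi> (u - y) * wig_kernel h b u (u - y)) \<partial>lborel)"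
      by simp
    also have "\<dots> = (\<integral>y. \<kappa> * F (pvec u y) \<partial>lborel)"
    proof (rule Bochner_Integration.integral_cong[OF refl])
      fix y
      have "(1/2) *\<^sub>R (u + (u - y)) = u - (1/2) *\<^sub>R y" by (simp add: vec_eq_iff field_simps)
      then show "?\<psi> u * (?\<psi> (u - y) * wig_kernel h b u (u - y)) = \<kappa> * F (pvec u y)"
        unfolding K F_def xpart_pvec ppart_pvec by (simp add: mult_ac)
    qed
    finally show ?thesis by simp
  qed
  have inner2: "(\<integral>u. F (pvec u y) \<partial>lborel) = g4 y * (\<integral>x. g1 (L *v x) * B (pvec x y) \<partial>lborel)" for y
  proof -
    have "(\<integral>u. F (pvec u y) \<partial>lborel) = (\<integral>x. F (pvec ((1/2) *\<^sub>R y + x) y) \<partial>lborel)"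
      by (rule lborel_integral_translate[symmetric]) (rule schwartz_measurable[OF schwartz_slice'[OF F]])
    also have "\<dots> = (\<integral>x. g4 y * (g1 (L *v x) * B (pvec x y)) \<partial>lborel)"
    proof (rule Bochner_Integration.integral_cong[OF refl])
      fix x
      have 1: "(1/2) *\<^sub>R y + x = x + (1/2) *\<^sub>R y" "(1/2) *\<^sub>R y + x - y = x - (1/2) *\<^sub>R y" "(1/2) *\<^sub>R y + x - (1/2) *\<^sub>R y = x"
        by (simp_all add: vec_eq_iff field_simps)
      have 2: "?\<psi> (x + (1/2) *\<^sub>R y) * ?\<psi> (x - (1/2) *\<^sub>R y) = g1 (L *v x) * g4 y"
        using gauss_sum_diff[of h "L *v x" "L *v y"]
        by (simp add: psi_gauss_def g1_def g4_def matrix_vector_right_distrib matrix_vector_mult_diff_distrib matrix_vector_mult_scaleR)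
      show "F (pvec ((1/2) *\<^sub>R y + x) y) = g4 y * (g1 (L *v x) * B (pvec x y))"
        unfolding F_def xpart_pvec ppart_pvec 1(2,3) unfolding 1(1) 2 by (simp only: mult_ac)
    qed
    also have "\<dots> = g4 y * (\<integral>x. g1 (L *v x) * B (pvec x y) \<partial>lborel)" by (rule integral_mult_right_zero)
    finally show ?thesis .
  qed
  have inner3: "complex_of_real \<bar>det L\<bar> * (\<integral>y. g4 y * B (pvec x y) \<partial>lborel)
    = complex_of_real (sqrt (4 * pi * h) ^ CARD('n)) * (\<integral>p. g1 (matrix_inv (transpose L) *v p) * b (pvec x p) \<partial>lborel)" for x
  proof -
    define H where "H z = exp (- \<i> * complex_of_real (xpart z \<bullet> ppart z / h)) * (g4 (xpart z) * b (pvec x (ppart z)))" for z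
    have H: "schwartz H" unfolding H_def by (rule phase_schwartz[OF schwartz_tensor[OF Sg4 schwartz_slice[OF b]]])
    have "(\<integral>y. g4 y * B (pvec x y) \<partial>lborel) = (\<integral>y. (\<integral>p. H (pvec y p) \<partial>lborel) \<partial>lborel)"
      unfolding B_def pft_def ft_def H_def xpart_pvec ppart_pvec integral_mult_right_zero[symmetric]
      by (simp only: inner_commute mult.left_commute)
    also have "\<dots> = (\<integral>p. (\<integral>y. H (pvec y p) \<partial>lborel) \<partial>lborel)"
      by (rule tempered_fubini[OF tempered_integral tempered_integral H])
    finally have e: "(\<integral>y. g4 y * B (pvec x y) \<partial>lborel) = (\<integral>p. (\<integral>y. H (pvec y p) \<partial>lborel) \<partial>lborel)" .
    have i: "complex_of_real \<bar>det L\<bar> * (\<integral>y. H (pvec y p) \<partial>lborel) = complex_of_real (sqrt (4 * pi * h) ^ CARD('n)) * (g1 (matrix_inv (transpose L) *v p) * b (pvec x p))" for p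
    proof -
      have "(\<integral>y. H (pvec y p) \<partial>lborel) = (\<integral>y. (exp (- \<i> * complex_of_real (p \<bullet> y / h)) * gauss (1 / (4 * h)) (L *v y)) * b (pvec x p) \<partial>lborel)"
        unfolding H_def xpart_pvec ppart_pvec g4_def by (simp only: inner_commute mult.assoc)
      also have "\<dots> = (\<integral>y. exp (- \<i> * complex_of_real (p \<bullet> y / h)) * gauss (1 / (4 * h)) (L *v y) \<partial>lborel) * b (pvec x p)"
        by (rule integral_mult_left_zero)
      finally show ?thesis using psi_gauss_ft[OF h L, of p] unfolding g1_def by (simp add: mult.assoc[symmetric])
    qed
    have "complex_of_real \<bar>det L\<bar> * (\<integral>p. (\<integral>y. H (pvec y p) \<partial>lborel) \<partial>lborel) = (\<integral>p. complex_of_real \<bar>det L\<bar> * (\<integral>y. H (pvec y p) \<partial>lborel) \<partial>lborel)"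
      by (rule integral_mult_right_zero[symmetric])
    also have "\<dots> = complex_of_real (sqrt (4 * pi * h) ^ CARD('n)) * (\<integral>p. g1 (matrix_inv (transpose L) *v p) * b (pvec x p) \<partial>lborel)"
      unfolding i by (rule integral_mult_right_zero)
    finally show ?thesis unfolding e .
  qed
  have swap: "(\<integral>y. g4 y * (\<integral>x. g1 (L *v x) * B (pvec x y) \<partial>lborel) \<partial>lborel) = (\<integral>x. g1 (L *v x) * (\<integral>y. g4 y * B (pvec x y) \<partial>lborel) \<partial>lborel)"
    using tempered_fubini[OF tempered_fun_dist[OF Sg1] tempered_fun_dist[OF Sg4] B] unfolding fun_dist_def by simp
  have "wigner h (fun_dist ?\<psi>) b = (\<integral>u. ?\<psi> u * dist_conj (fun_dist ?\<psi>) (\<lambda>v. wig_kernel h b u v) \<partial>lborel)"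
    unfolding wigner_def by (rule fun_dist_def)
  also have "\<dots> = \<kappa> * (\<integral>u. (\<integral>y. F (pvec u y) \<partial>lborel) \<partial>lborel)"
    unfolding inner1 by (rule integral_mult_right_zero)
  also have "(\<integral>u. (\<integral>y. F (pvec u y) \<partial>lborel) \<partial>lborel) = (\<integral>y. (\<integral>u. F (pvec u y) \<partial>lborel) \<partial>lborel)"
    by (rule tempered_fubini[OF tempered_integral tempered_integral F])
  also have "\<dots> = (\<integral>x. g1 (L *v x) * (\<integral>y. g4 y * B (pvec x y) \<partial>lborel) \<partial>lborel)"
    unfolding inner2 by (rule swap)
  finally have W: "wigner h (fun_dist ?\<psi>) b = \<kappa> * (\<integral>x. g1 (L *v x) * (\<integral>y. g4 y * B (pvec x y) \<partial>lborel) \<partial>lborel)" .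
  have "complex_of_real \<bar>det L\<bar> * wigner h (fun_dist ?\<psi>) b
    = \<kappa> * (\<integral>x. g1 (L *v x) * (complex_of_real \<bar>det L\<bar> * (\<integral>y. g4 y * B (pvec x y) \<partial>lborel)) \<partial>lborel)"
    unfolding W mult.left_commute[of _ "complex_of_real \<bar>det L\<bar>"] integral_mult_right_zero ..
  also have "\<dots> = \<kappa> * (complex_of_real (sqrt (4 * pi * h) ^ CARD('n)) * (\<integral>x. g1 (L *v x) * (\<integral>p. g1 (matrix_inv (transpose L) *v p) * b (pvec x p) \<partial>lborel) \<partial>lborel))"
    unfolding inner3 mult.left_commute[of _ "complex_of_real (sqrt (4 * pi * h) ^ CARD('n))"] integral_mult_right_zero ..
  also have "\<dots> = complex_of_real ((1 / (2 * pi * h)) ^ CARD('n) * sqrt (4 * pi * h) ^ CARD('n)) *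
      (\<integral>x. (\<integral>p. gauss (1 / h) (L *v x) * gauss (1 / h) (matrix_inv (transpose L) *v p) * b (pvec x p) \<partial>lborel) \<partial>lborel)"
    unfolding \<kappa>_def g1_def mult.assoc integral_mult_right_zero by (simp only: of_real_mult mult.assoc)
  finally show ?thesis .
qed

section \<open>Test functions whose kernel is a product\<close>

lemma gauss_deriv:
  "((\<lambda>t. gauss c (x + t *\<^sub>R axis j 1)) has_vector_derivative complex_of_real (- 2 * c * x $ j) * gauss c x) (at 0)"
proof -
  have eq: "(x + t *\<^sub>R axis j 1) \<bullet> (x + t *\<^sub>R axis j 1) = x \<bullet> x + 2 * t * x $ j + t * t" for t
    by (simp add: inner_add_left inner_add_right inner_axis inner_commute[of "axis j 1"] algebra_simps)
  have "((\<lambda>t. exp (- c * (x \<bullet> x + 2 * t * x $ j + t * t))) has_real_derivative (- 2 * c * x $ j) * exp (- c * (x \<bullet> x))) (at 0)"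
    by (auto intro!: derivative_eq_intros)
  from has_vector_derivative_of_real[OF this] show ?thesis unfolding gauss_def eq of_real_mult .
qed

text \<open>\<open>ft_deriv\<close> read backwards: a moment is found by differentiating a known
  transform.\<close>

lemma ft_coord:
  assumes f: "schwartz f" and h: "h \<noteq> 0"
    and d: "((\<lambda>t. ft h f (y + t *\<^sub>R axis j 1)) has_vector_derivative D) (at 0)"
  shows "ft h (\<lambda>p. complex_of_real (p $ j) * f p) y = \<i> * complex_of_real h * D"
proof -
  have "D = ft h (\<lambda>p. (- \<i> * complex_of_real (1 / h)) * (complex_of_real (p $ j) * f p)) y"
    by (rule vector_derivative_unique_at[OF d ft_deriv[OF f]])
  also have "\<dots> = (- \<i> * complex_of_real (1 / h)) * ft h (\<lambda>p. complex_of_real (p $ j) * f p) y"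
    by (rule tempered_scale[OF tempered_ft schwartz_coord[OF f]])
  finally show ?thesis using h by simp
qed

text \<open>Each momentum coordinate acts on the transform as \<i> h times a derivative. The
  constant h/2 in the last formula arises when the second derivative hits the factor produced by the
  first.\<close>

lemma ft_gauss_moments:
  fixes y :: "real^'n::finite"
  assumes h: "h > 0"
  defines "s \<equiv> complex_of_real (sqrt (pi * h) ^ CARD('n))"
  shows "ft h (gauss (1 / h)) y = s * gauss (1 / (4 * h)) y"
    and "ft h (\<lambda>p. complex_of_real (p $ j) * gauss (1 / h) p) y = s * ((- \<i> * complex_of_real (y $ j / 2)) * gauss (1 / (4 * h)) y)"
    and "ft h (\<lambda>p. complex_of_real (p $ i) * (complex_of_real (p $ j) * gauss (1 / h) p)) y
      = s * ((complex_of_real h * (if i = j then 1 else 0) / 2 - complex_of_real (y $ i * y $ j / 4)) * gauss (1 / (4 * h)) y)"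
proof -
  have h0: "h \<noteq> 0" and h1: "1 / h > 0" using h by simp_all
  have g: "schwartz (gauss (1 / h) :: real^'n \<Rightarrow> complex)" by (rule schwartz_gauss'[OF h1])
  let ?g = "gauss (1 / (4 * h)) :: real^'n \<Rightarrow> complex"
  have F0: "ft h (gauss (1 / h)) y = s * ?g y" for y :: "real^'n"
  proof -
    have "ft h (gauss (1 / h)) y = (\<integral>p. exp (- \<i> * complex_of_real (((1 / h) *\<^sub>R y) \<bullet> p)) * gauss (1 / h) p \<partial>lborel)"
      unfolding ft_def by (simp add: inner_commute)
    also have "\<dots> = complex_of_real (sqrt (pi / (1 / h)) ^ CARD('n)) * gauss (1 / (4 * (1 / h))) ((1 / h) *\<^sub>R y)"
      by (rule gauss_ft[OF h1])
    also have "gauss (1 / (4 * (1 / h))) ((1 / h) *\<^sub>R y) = ?g y"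
      unfolding gauss_scaleR using h by (simp add: power2_eq_square)
    finally show ?thesis by (simp add: s_def)
  qed
  then show "ft h (gauss (1 / h)) y = s * ?g y" .
  have c: "- 2 * (1 / (4 * h)) * r = - r / (2 * h)" for r using h by (simp add: field_simps)
  have d0: "((\<lambda>t. ?g (y + t *\<^sub>R axis j 1)) has_vector_derivative complex_of_real (- (y $ j) / (2 * h)) * ?g y) (at 0)" for y j
    using gauss_deriv[of "1 / (4 * h)" y j] unfolding c .
  have F1: "ft h (\<lambda>p. complex_of_real (p $ j) * gauss (1 / h) p) y = s * ((- \<i> * complex_of_real (y $ j / 2)) * ?g y)" for y j
  proof -
    have "ft h (\<lambda>p. complex_of_real (p $ j) * gauss (1 / h) p) y = \<i> * complex_of_real h * (s * (complex_of_real (- (y $ j) / (2 * h)) * ?g y))"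
      by (rule ft_coord[OF g h0]) (unfold F0, rule has_vector_derivative_mult_right[OF d0])
    then show ?thesis using h0 by simp
  qed
  then show "ft h (\<lambda>p. complex_of_real (p $ j) * gauss (1 / h) p) y = s * ((- \<i> * complex_of_real (y $ j / 2)) * ?g y)" .
  define \<delta> :: complex where "\<delta> = (if j = i then 1 else 0)"
  let ?D = "complex_of_real (y $ j) * (complex_of_real (- (y $ i) / (2 * h)) * ?g y) + \<delta> * ?g y"
  have "((\<lambda>t. complex_of_real ((y + t *\<^sub>R axis i 1) $ j) * ?g (y + t *\<^sub>R axis i 1)) has_vector_derivative ?D) (at 0)"
    using has_vector_derivative_mult[OF has_vector_derivative_coord[of y i j] d0[of y i]]
    by (simp only: scaleR_zero_left add_0_right \<delta>_def)
  then have "((\<lambda>t. (s * (- \<i> / 2)) * (complex_of_real ((y + t *\<^sub>R axis i 1) $ j) * ?g (y + t *\<^sub>R axis i 1))) has_vector_derivative (s * (- \<i> / 2)) * ?D) (at 0)"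
    by (rule has_vector_derivative_mult_right)
  moreover have "(s * (- \<i> / 2)) * (complex_of_real (z $ j) * ?g z) = s * ((- \<i> * complex_of_real (z $ j / 2)) * ?g z)" for z
    by simp
  ultimately have "((\<lambda>t. ft h (\<lambda>p. complex_of_real (p $ j) * gauss (1 / h) p) (y + t *\<^sub>R axis i 1)) has_vector_derivative (s * (- \<i> / 2)) * ?D) (at 0)"
    unfolding F1 by (simp only:)
  from ft_coord[OF schwartz_coord[OF g] h0 this]
  have "ft h (\<lambda>p. complex_of_real (p $ i) * (complex_of_real (p $ j) * gauss (1 / h) p)) y = \<i> * complex_of_real h * ((s * (- \<i> / 2)) * ?D)" .
  also have "\<dots> = s * ((complex_of_real h * \<delta> / 2 - complex_of_real (y $ i * y $ j / 4)) * ?g y)"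
    using h0 by (simp add: field_simps)
  finally show "ft h (\<lambda>p. complex_of_real (p $ i) * (complex_of_real (p $ j) * gauss (1 / h) p)) y
      = s * ((complex_of_real h * (if i = j then 1 else 0) / 2 - complex_of_real (y $ i * y $ j / 4)) * ?g y)"
    by (simp add: \<delta>_def eq_commute[of j])
qed

lemma wig_kernel_ft:
  "wig_kernel h a u v = complex_of_real ((1 / (2 * pi * h)) ^ CARD('n)) *
    ft h (\<lambda>p. a (pvec ((1/2) *\<^sub>R (u + v)) p)) (u - v)"
  for u v :: "real^'n::finite"
  by (simp add: wig_kernel_pft pft_def)

text \<open>Four terms cover the polynomials in \<open>gauss_product_kernel\<close>: a constant, two
  linear terms and one product of momenta.\<close>

lemma ft_lincomb4:
  assumes "schwartz f1" "schwartz f2" "schwartz f3" "schwartz f4"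
  shows "ft h (\<lambda>p. c1 * f1 p + c2 * f2 p + c3 * f3 p + c4 * f4 p) y = c1 * ft h f1 y + c2 * ft h f2 y + c3 * ft h f3 y + c4 * ft h f4 y"
proof -
  note s = schwartz_scale[OF assms(1), of c1] schwartz_scale[OF assms(2), of c2] schwartz_scale[OF assms(3), of c3] schwartz_scale[OF assms(4), of c4]
  show ?thesis
    unfolding tempered_add[OF tempered_ft schwartz_add[OF schwartz_add[OF s(1,2)] s(3)] s(4)]
      tempered_add[OF tempered_ft schwartz_add[OF s(1,2)] s(3)] tempered_add[OF tempered_ft s(1,2)]
      tempered_scale[OF tempered_ft assms(1)] tempered_scale[OF tempered_ft assms(2)]
      tempered_scale[OF tempered_ft assms(3)] tempered_scale[OF tempered_ft assms(4)] ..
qed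

text \<open>\<phi> is the unnormalised ground state. Under the momentum transform of the Gaussian, a
  factor p acts as - \<i> y / 2, so x + \<i> p acts as x + y/2 = u and its conjugate as x - y/2 = v.
  In the product of the two, the second moment contributes the extra constant
  \<open>\<delta> i j\<close>, which is subtracted beforehand.\<close>

lemma gauss_product_kernel:
  fixes u v :: "real^'n::finite"
  assumes h: "h > 0"
  defines "k \<equiv> complex_of_real ((1 / (2 * pi * h)) ^ CARD('n)) * complex_of_real (sqrt (pi * h) ^ CARD('n))"
    and "\<phi> \<equiv> gauss (1 / (2 * h)) :: real^'n \<Rightarrow> complex"
    and "A \<equiv> \<lambda>(i::'n) (z::real^('n + 'n)). complex_of_real (z $ Inl i) + \<i> * complex_of_real (z $ Inr i)"
    and "\<delta> \<equiv> \<lambda>i j::'n. complex_of_real h * (if i = j then 1 else 0) / 2"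
  shows "wig_kernel h (gauss (1 / h)) u v = k * (\<phi> u * \<phi> v)"
    and "wig_kernel h (\<lambda>z. A i z * gauss (1 / h) z) u v = k * ((complex_of_real (u $ i) * \<phi> u) * \<phi> v)"
    and "wig_kernel h (\<lambda>z. (A i z * cnj (A j z) - \<delta> i j) * gauss (1 / h) z) u v
      = k * ((complex_of_real (u $ i) * \<phi> u) * (complex_of_real (v $ j) * \<phi> v))"
proof -
  define s where "s = complex_of_real (sqrt (pi * h) ^ CARD('n))"
  define \<kappa> where "\<kappa> = complex_of_real ((1 / (2 * pi * h)) ^ CARD('n))"
  have k: "k = \<kappa> * s" by (simp add: k_def \<kappa>_def s_def)
  define x y where "x = (1/2) *\<^sub>R (u + v)" and "y = u - v"
  have uv: "u = x + (1/2) *\<^sub>R y" "v = x - (1/2) *\<^sub>R y" by (simp_all add: x_def y_def vec_eq_iff field_simps)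
  have uvi: "u $ i = x $ i + y $ i / 2" "v $ i = x $ i - y $ i / 2" for i by (simp_all add: uv)
  define gx g4 where "gx = gauss (1 / h) x" and "g4 = gauss (1 / (4 * h)) y"
  have \<phi>: "\<phi> u * \<phi> v = gx * g4"
    unfolding \<phi>_def gx_def g4_def using gauss_sum_diff[of h x y] by (simp only: uv)
  let ?g = "gauss (1 / h) :: real^'n \<Rightarrow> complex"
  have g: "schwartz ?g" by (rule schwartz_gauss') (use h in simp)
  have gp: "gauss (1 / h) (pvec x p) = gx * ?g p" for p by (simp add: gauss_pvec[of _ "pvec x p"] gx_def)
  let ?p = "\<lambda>i (p::real^'n). complex_of_real (p $ i) * ?g p"
  let ?pp = "\<lambda>i j (p::real^'n). complex_of_real (p $ i) * (complex_of_real (p $ j) * ?g p)"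
  have m: "ft h ?g y = s * g4" "ft h (?p i) y = s * ((- \<i> * complex_of_real (y $ i / 2)) * g4)"
    "ft h (?pp i j) y = s * ((\<delta> i j - complex_of_real (y $ i * y $ j / 4)) * g4)" for i j
    using ft_gauss_moments[OF h, where y=y] unfolding s_def g4_def \<delta>_def by simp_all
  note lin = ft_lincomb4[where h=h and y=y, OF g schwartz_coord[OF g] schwartz_coord[OF g] schwartz_coord[OF schwartz_coord[OF g]]]
  have K: "wig_kernel h a u v = \<kappa> * ft h (\<lambda>p. a (pvec x p)) y" for a
    unfolding wig_kernel_ft \<kappa>_def x_def y_def ..
  show "wig_kernel h (gauss (1 / h)) u v = k * (\<phi> u * \<phi> v)"
    unfolding K gp \<phi> k tempered_scale[OF tempered_ft g] m by (simp only: mult_ac)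
  have "(\<lambda>p. A i (pvec x p) * gauss (1 / h) (pvec x p)) = (\<lambda>p. (complex_of_real (x $ i) * gx) * ?g p + (\<i> * gx) * ?p i p + 0 * ?p i p + 0 * ?pp i i p)"
    unfolding gp A_def by (rule ext) (simp add: algebra_simps)
  then have "ft h (\<lambda>p. A i (pvec x p) * gauss (1 / h) (pvec x p)) y = s * (complex_of_real (u $ i) * (gx * g4))"
    unfolding uvi by (simp only: lin m) (simp add: algebra_simps)
  then show "wig_kernel h (\<lambda>z. A i z * gauss (1 / h) z) u v = k * ((complex_of_real (u $ i) * \<phi> u) * \<phi> v)"
    unfolding K k \<phi>[symmetric] by (simp only: mult.assoc)
  have "(\<lambda>p. (A i (pvec x p) * cnj (A j (pvec x p)) - \<delta> i j) * gauss (1 / h) (pvec x p))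
     = (\<lambda>p. ((complex_of_real (x $ i * x $ j) - \<delta> i j) * gx) * ?g p + (\<i> * complex_of_real (x $ j) * gx) * ?p i p
        + (- \<i> * complex_of_real (x $ i) * gx) * ?p j p + gx * ?pp i j p)"
    unfolding gp A_def by (rule ext) (simp add: algebra_simps)
  then have "ft h (\<lambda>p. (A i (pvec x p) * cnj (A j (pvec x p)) - \<delta> i j) * gauss (1 / h) (pvec x p)) y
     = s * (complex_of_real (u $ i) * complex_of_real (v $ j) * (gx * g4))"
    unfolding uvi by (simp only: lin m) (simp add: algebra_simps)
  then show "wig_kernel h (\<lambda>z. (A i z * cnj (A j z) - \<delta> i j) * gauss (1 / h) z) u v
      = k * ((complex_of_real (u $ i) * \<phi> u) * (complex_of_real (v $ j) * \<phi> v))"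
    unfolding K k \<phi>[symmetric] by (simp only: mult_ac)
qed

text \<open>This is where the rank one structure of a Wigner function is used: against a product
  kernel the pairing is itself a product.\<close>

lemma wigner_product:
  assumes T: "tempered T" and f: "schwartz f" and g: "schwartz g" and real: "\<And>v. cnj (g v) = g v"
    and K: "\<And>u v. wig_kernel h a u v = k * (f u * g v)"
  shows "wigner h T a = k * (T f * cnj (T g))"
proof -
  have "dist_conj T (\<lambda>v. wig_kernel h a u v) = (k * cnj (T g)) * f u" for u
  proof -
    have "(\<lambda>v. cnj (wig_kernel h a u v)) = (\<lambda>v. cnj (k * f u) * g v)"
      unfolding K by (rule ext) (simp add: real)
    then have "dist_conj T (\<lambda>v. wig_kernel h a u v) = cnj (cnj (k * f u) * T g)"
      unfolding dist_conj_def by (simp only: tempered_scale[OF T g])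
    then show ?thesis by simp
  qed
  then have "wigner h T a = (k * cnj (T g)) * T f"
    unfolding wigner_def by (simp only: tempered_scale[OF T f])
  then show ?thesis by (simp add: mult_ac)
qed

section \<open>Gaussian moments\<close>

text \<open>For a derivative in position the order of the two integrals is exchanged first.\<close>

lemma iterated_integral_partial_zero:
  fixes f :: "real^('n::finite + 'n) \<Rightarrow> complex"
  assumes f: "schwartz f"
  shows "(\<integral>x. (\<integral>p. partial_dir k f (pvec x p) \<partial>lborel) \<partial>lborel) = 0"
proof -
  have right: "(\<integral>p. partial_dir (Inr j) f (pvec x p) \<partial>lborel) = 0" if "schwartz f" for f :: "real^('n + 'n) \<Rightarrow> complex" and j x
    using integral_partial_zero[OF schwartz_slice[OF that, of x], of j] iter_partial_slice[of "[j]" f x] by simp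
  show ?thesis
  proof (cases k)
    case (Inl i)
    have "partial_dir (Inl i) f (pvec x p) = partial_dir i (\<lambda>x. f (pvec x p)) x" for x p
      by (simp add: partial_dir_def pvec_axis_Inl)
    then have "(\<integral>x. partial_dir (Inl i) f (pvec x p) \<partial>lborel) = 0" for p
      using integral_partial_zero[OF schwartz_slice'[OF f, of p], of i] by simp
    then show ?thesis
      unfolding Inl using tempered_fubini[OF tempered_integral tempered_integral schwartz_partial[OF f, of "Inl i"]] by simp
  next
    case (Inr j)
    then show ?thesis using right[OF f] by simp
  qed
qed

lemma integral_pos:
  fixes f :: "real^'n::finite \<Rightarrow> real"
  assumes int: "integrable lborel f" and pos: "\<And>x. f x > 0"
  shows "(\<integral>x. f x \<partial>lborel) > 0"
proof -
  have "(\<integral>x. f x \<partial>lborel) \<ge> 0" by (rule Bochner_Integration.integral_nonneg) (simp add: less_imp_le[OF pos])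
  moreover have "(\<integral>x. f x \<partial>lborel) \<noteq> 0"
  proof
    assume "(\<integral>x. f x \<partial>lborel) = 0"
    then have "AE x in lborel. f x = 0"
      using integral_nonneg_eq_0_iff_AE[OF int] less_imp_le[OF pos] by simp
    then have "AE x::real^'n in lborel. False" using pos by (auto simp: less_le)
    then show False by (simp add: AE_iff_null null_sets_def)
  qed
  ultimately show ?thesis by simp
qed

lemma iterated_integral_positive:
  fixes e :: "real^('n::finite + 'n) \<Rightarrow> real"
  assumes S: "schwartz (\<lambda>z. complex_of_real (e z))" and pos: "\<And>z. e z > 0"
  shows "(\<integral>x. (\<integral>p. complex_of_real (e (pvec x p)) \<partial>lborel) \<partial>lborel) \<noteq> 0"
proof -
  define f where "f x = (\<integral>p. e (pvec x p) \<partial>lborel)" for x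
  have inner: "(\<integral>p. complex_of_real (e (pvec x p)) \<partial>lborel) = complex_of_real (f x)" for x
    unfolding f_def by (rule integral_complex_of_real)
  have "integrable lborel (\<lambda>p. e (pvec x p))" for x
    using schwartz_integrable[OF schwartz_slice[OF S, of x]] by (simp add: complex_of_real_integrable_eq)
  then have fpos: "f x > 0" for x unfolding f_def by (rule integral_pos) (rule pos)
  have "schwartz (\<lambda>x. complex_of_real (f x))"
    using schwartz_tempered_slice[OF tempered_integral S] unfolding inner .
  from schwartz_integrable[OF this] have "integrable lborel f" by (simp add: complex_of_real_integrable_eq)
  then have "(\<integral>x. f x \<partial>lborel) > 0" by (rule integral_pos) (rule fpos)
  then show ?thesis unfolding inner by (simp add: integral_complex_of_real)
qed

lemma schwartz_matrix_coord:
  fixes A :: "real^'m::finite^'k::finite"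
  assumes f: "schwartz f"
  shows "schwartz (\<lambda>z. complex_of_real ((A *v z) $ k) * f z)"
proof -
  have "diffop (\<lambda>f z. \<Sum>l\<in>UNIV. complex_of_real (A $ k $ l) * (complex_of_real (z $ l) * f z))"
    by (intro diffop_sum diffop.scale diffop.mul diffop_id) simp
  from diffop_schwartz[OF this f] show ?thesis
    by (simp add: matrix_vector_mult_def sum_distrib_right mult.assoc)
qed

text \<open>Integration by parts: \<open>(Q *v z) $ l\<close> times E is - h/2 times a partial
  derivative of E, so its integral against a linear form is h/2 times a coefficient of that form and
  the integral of E. Every coordinate of N z is a combination of coordinates of Q z, with
  coefficients from N \<open>matrix_inv Q\<close>.\<close>

lemma gaussian_moments:
  fixes Q :: "real^('n::finite + 'n)^('n + 'n)" and N :: "real^('n + 'n)^('n + 'n)"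
  assumes h: "h > 0" and Q: "transpose Q = Q" "invertible Q"
    and E: "E = (\<lambda>z. complex_of_real (exp (- ((Q *v z) \<bullet> z / h))))" and SE: "schwartz E"
  defines "Lam \<equiv> \<lambda>f::real^('n + 'n) \<Rightarrow> complex. \<integral>x. (\<integral>p. f (pvec x p) \<partial>lborel) \<partial>lborel"
  shows "Lam (\<lambda>z. complex_of_real ((N *v z) $ k) * E z) = 0"
    and "Lam (\<lambda>z. complex_of_real ((N *v z) $ m) * (complex_of_real ((N *v z) $ k) * E z))
      = complex_of_real (h / 2 * (N ** matrix_inv Q ** transpose N) $ k $ m) * Lam E"
proof -
  have L: "tempered Lam" unfolding Lam_def by (rule tempered_iterated[OF tempered_integral tempered_integral])
  have h0: "h \<noteq> 0" using h by simp
  have Ed: "((\<lambda>t. E (z + t *\<^sub>R axis l 1)) has_vector_derivative complex_of_real (- (2 / h) * (Q *v z) $ l) * E z) (at 0)" for z l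
  proof -
    have q: "((\<lambda>t. ((Q *v (z + t *\<^sub>R axis l 1)) \<bullet> (z + t *\<^sub>R axis l 1)) / h) has_real_derivative (2 / h) * (Q *v z) $ l) (at 0)"
    proof -
      have "(\<Sum>j\<in>UNIV. (Q $ l $ j / (h / 2)) * z $ j) = (2 / h) * (Q *v z) $ l"
        by (simp add: matrix_vector_mult_def sum_distrib_left mult_ac)
      then show ?thesis using quadratic_deriv[OF Q(1), of z l "h / 2"] by simp
    qed
    have "((\<lambda>t. exp (- (((Q *v (z + t *\<^sub>R axis l 1)) \<bullet> (z + t *\<^sub>R axis l 1)) / h))) has_real_derivative
        exp (- (((Q *v (z + 0 *\<^sub>R axis l 1)) \<bullet> (z + 0 *\<^sub>R axis l 1)) / h)) * (- ((2 / h) * (Q *v z) $ l))) (at 0)"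
      by (rule DERIV_fun_exp[OF DERIV_minus[OF q]])
    then have "((\<lambda>t. complex_of_real (exp (- (((Q *v (z + t *\<^sub>R axis l 1)) \<bullet> (z + t *\<^sub>R axis l 1)) / h)))) has_vector_derivative
        complex_of_real (exp (- (((Q *v (z + 0 *\<^sub>R axis l 1)) \<bullet> (z + 0 *\<^sub>R axis l 1)) / h)) * (- ((2 / h) * (Q *v z) $ l)))) (at 0)"
      by (rule has_vector_derivative_of_real)
    then show ?thesis unfolding E by (simp add: mult.commute)
  qed
  have SQ: "schwartz (\<lambda>z. complex_of_real ((Q *v z) $ l) * E z)" for l by (rule schwartz_matrix_coord[OF SE])
  have Q1: "Lam (\<lambda>z. complex_of_real ((Q *v z) $ l) * E z) = 0" for l
  proof -
    have "partial_dir l E = (\<lambda>z. complex_of_real (- (2 / h)) * (complex_of_real ((Q *v z) $ l) * E z))"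
      using partial_dir_eqI[OF Ed, of l] by (simp add: mult.assoc)
    then have "complex_of_real (- (2 / h)) * Lam (\<lambda>z. complex_of_real ((Q *v z) $ l) * E z) = 0"
      using iterated_integral_partial_zero[OF SE, of l] tempered_scale[OF L SQ] unfolding Lam_def by simp
    then show ?thesis using h by simp
  qed
  define P where "P = N ** matrix_inv Q"
  have NP: "(N *v z) $ k = (\<Sum>l\<in>UNIV. P $ k $ l * (Q *v z) $ l)" for z k
  proof -
    have "N *v z = P *v (Q *v z)"
      unfolding P_def matrix_vector_mul_assoc[symmetric] matrix_inv_vector[OF Q(2)] ..
    then show ?thesis by (simp add: matrix_vector_mult_def[of P])
  qed
  have "(\<lambda>z. complex_of_real ((N *v z) $ k) * E z) = (\<lambda>z. \<Sum>l\<in>UNIV. complex_of_real (P $ k $ l) * (complex_of_real ((Q *v z) $ l) * E z))"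
    unfolding NP by (rule ext) (simp add: sum_distrib_right mult.assoc)
  then show "Lam (\<lambda>z. complex_of_real ((N *v z) $ k) * E z) = 0"
    by (simp only: tempered_sum[OF L finite_class.finite_UNIV SQ] Q1) simp
  define f where "f z = complex_of_real ((N *v z) $ m) * E z" for z
  have f: "schwartz f" unfolding f_def by (rule schwartz_matrix_coord[OF SE])
  have SQf: "schwartz (\<lambda>z. complex_of_real ((Q *v z) $ l) * f z)" for l by (rule schwartz_matrix_coord[OF f])
  have Q2: "Lam (\<lambda>z. complex_of_real ((Q *v z) $ l) * f z) = complex_of_real (h / 2 * N $ m $ l) * Lam E" for l
  proof -
    have "((\<lambda>t. f (z + t *\<^sub>R axis l 1)) has_vector_derivative
        complex_of_real (N $ m $ l) * E z + complex_of_real (- (2 / h)) * (complex_of_real ((Q *v z) $ l) * f z)) (at 0)" for z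
    proof -
      have "((\<lambda>t. (N *v (z + t *\<^sub>R axis l 1)) $ m) has_real_derivative N $ m $ l) (at 0)"
      proof -
        have "(N *v (z + t *\<^sub>R axis l 1)) $ m = (N *v z) $ m + t * N $ m $ l" for t
          by (simp add: matrix_vector_right_distrib matrix_vector_mult_scaleR matrix_vector_mult_basis column_def)
        then show ?thesis by (auto intro!: derivative_eq_intros)
      qed
      from has_vector_derivative_mult[OF has_vector_derivative_of_real[OF this] Ed]
      show ?thesis unfolding f_def by (simp add: algebra_simps)
    qed
    then have pd: "partial_dir l f = (\<lambda>z. complex_of_real (N $ m $ l) * E z + complex_of_real (- (2 / h)) * (complex_of_real ((Q *v z) $ l) * f z))"
      by (rule partial_dir_eqI)
    have "Lam (partial_dir l f) = 0" unfolding Lam_def by (rule iterated_integral_partial_zero[OF f])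
    then have "complex_of_real (N $ m $ l) * Lam E + complex_of_real (- (2 / h)) * Lam (\<lambda>z. complex_of_real ((Q *v z) $ l) * f z) = 0"
      unfolding pd tempered_add[OF L schwartz_scale[OF SE] schwartz_scale[OF SQf]] tempered_scale[OF L SE] tempered_scale[OF L SQf] .
    then show ?thesis using h0 by (simp add: field_simps)
  qed
  have "(\<lambda>z. complex_of_real ((N *v z) $ m) * (complex_of_real ((N *v z) $ k) * E z)) = (\<lambda>z. \<Sum>l\<in>UNIV. complex_of_real (P $ k $ l) * (complex_of_real ((Q *v z) $ l) * f z))"
    unfolding NP[of _ k] f_def by (rule ext) (simp add: sum_distrib_right sum_distrib_left mult_ac)
  then have "Lam (\<lambda>z. complex_of_real ((N *v z) $ m) * (complex_of_real ((N *v z) $ k) * E z))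
      = (\<Sum>l\<in>UNIV. complex_of_real (P $ k $ l) * (complex_of_real (h / 2 * N $ m $ l) * Lam E))"
    by (simp only: tempered_sum[OF L finite_class.finite_UNIV SQf] Q2)
  also have "\<dots> = complex_of_real (h / 2 * (\<Sum>l\<in>UNIV. P $ k $ l * N $ m $ l)) * Lam E"
    by (simp add: sum_distrib_right sum_distrib_left mult_ac)
  also have "(\<Sum>l\<in>UNIV. P $ k $ l * N $ m $ l) = (N ** matrix_inv Q ** transpose N) $ k $ m"
    unfolding P_def[symmetric] by (simp add: matrix_matrix_mult_def[of P] transpose_def)
  finally show "Lam (\<lambda>z. complex_of_real ((N *v z) $ m) * (complex_of_real ((N *v z) $ k) * E z))
      = complex_of_real (h / 2 * (N ** matrix_inv Q ** transpose N) $ k $ m) * Lam E" .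
qed

section \<open>Block diagonal matrices\<close>

definition blk :: "real^'n::finite^'n \<Rightarrow> real^'n^'n \<Rightarrow> real^('n + 'n)^('n + 'n)" where
  "blk X Y = (\<chi> k l. case (k, l) of (Inl i, Inl j) \<Rightarrow> X $ i $ j | (Inr i, Inr j) \<Rightarrow> Y $ i $ j | _ \<Rightarrow> 0)"

lemma blk_nth [simp]: "blk X Y $ Inl i $ Inl j = X $ i $ j" "blk X Y $ Inr i $ Inr j = Y $ i $ j"
  "blk X Y $ Inl i $ Inr j = 0" "blk X Y $ Inr i $ Inl j = 0"
  by (simp_all add: blk_def)

lemma blk_vector: "blk X Y *v z = pvec (X *v xpart z) (Y *v ppart z)"
  by (simp add: vec_sum_eq_iff matrix_vector_mult_def sum_UNIV_sum)

lemma mat_sum_eq_iff: "(A :: real^('n::finite + 'n)^('n + 'n)) = B \<longleftrightarrow>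
   (\<forall>i j. A $ Inl i $ Inl j = B $ Inl i $ Inl j) \<and> (\<forall>i j. A $ Inl i $ Inr j = B $ Inl i $ Inr j) \<and>
   (\<forall>i j. A $ Inr i $ Inl j = B $ Inr i $ Inl j) \<and> (\<forall>i j. A $ Inr i $ Inr j = B $ Inr i $ Inr j)"
  unfolding vec_sum_eq_iff[of "_ $ _"] vec_eq_iff[of A] split_sum_all by (auto simp: vec_sum_eq_iff)

lemma blk_mult: "blk X Y ** blk X' Y' = blk (X ** X') (Y ** Y')"
  by (simp add: mat_sum_eq_iff matrix_matrix_mult_def sum_UNIV_sum)

lemma transpose_blk: "transpose (blk X Y) = blk (transpose X) (transpose Y)"
  by (simp add: mat_sum_eq_iff transpose_def)

lemma transpose_add: "transpose (A + B) = transpose A + transpose B" for A B :: "real^'n^'m"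
  by (simp add: transpose_def vec_eq_iff)

section \<open>The constraint imposed by a Gaussian state\<close>

text \<open>R is the covariance of N z, in units of h/2, under the Gaussian E that combines the
  Wigner function of the state with the pulled back test Gaussian. The three kernels of
  \<open>gauss_product_kernel\<close> express the products of T \<phi> and T
  (\<open>\<phi>1 i\<close>) with conjugates through moments of E of order 0, 1 and 2.\<close>

lemma gaussian_constraint:
  fixes M :: "real^('n::finite + 'n)^('n + 'n)" and L :: "real^'n^'n"
  assumes h: "h > 0" and M: "invertible M" and L: "invertible L" and T: "tempered T"
    and W: "\<And>a. schwartz a \<Longrightarrow> dist_comp M (wigner h (fun_dist (psi_gauss h L))) a = wigner h T a"
  defines "N \<equiv> matrix_inv M" and "D \<equiv> blk L (matrix_inv (transpose L))"
  defines "Q \<equiv> transpose D ** D + transpose N ** N"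
  defines "R \<equiv> N ** matrix_inv Q ** transpose N"
  shows "invertible Q" "transpose Q = Q" and "R ** Jmat + Jmat ** R = Jmat"
proof -
  have h1: "1 / h > 0" and h2: "1 / (2 * h) > 0" using h by simp_all
  have N: "invertible N" unfolding N_def by (rule invertible_matrix_inv[OF M])
  have tL: "invertible (transpose L)" using L by (rule transpose_invertible)
  have D: "invertible D"
  proof -
    have "D *v z = 0 \<Longrightarrow> z = 0" for z
    proof -
      assume "D *v z = 0"
      then have "L *v xpart z = 0" "matrix_inv (transpose L) *v ppart z = 0"
        unfolding D_def blk_vector by (simp_all add: vec_sum_eq_iff vec_eq_iff)
      then have "xpart z = 0" "ppart z = 0"
        using matrix_inv_vector(1)[OF L, of "xpart z"] matrix_inv_vector(2)[OF tL, of "ppart z"] by simp_all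
      then show "z = 0" by (simp add: vec_sum_eq_iff vec_eq_iff)
    qed
    then show ?thesis by (simp add: invertible_left_inverse matrix_left_invertible_ker)
  qed
  have Qz: "(Q *v z) \<bullet> z = (D *v z) \<bullet> (D *v z) + (N *v z) \<bullet> (N *v z)" for z
    unfolding Q_def matrix_vector_mult_add_rdistrib matrix_vector_mul_assoc[symmetric] inner_add_left transpose_inner ..
  show iQ: "invertible Q"
  proof -
    have "z = 0" if "Q *v z = 0" for z
    proof -
      have "(D *v z) \<bullet> (D *v z) + (N *v z) \<bullet> (N *v z) = 0" using Qz[of z] that by simp
      then have "(N *v z) \<bullet> (N *v z) = 0" by (metis add_nonneg_eq_0_iff inner_ge_zero)
      then have "N *v z = 0" by simp
      then show "z = 0" using matrix_inv_vector(1)[OF N, of z] by simp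
    qed
    then show ?thesis by (simp add: invertible_left_inverse matrix_left_invertible_ker)
  qed
  show sQ: "transpose Q = Q"
    unfolding Q_def transpose_add matrix_transpose_mul transpose_transpose ..
  define E where "E z = gauss (1 / h) (D *v z) * gauss (1 / h) (N *v z)" for z
  have SE: "schwartz E" unfolding E_def
    by (intro schwartz_mult schwartz_matrix[OF D] schwartz_matrix[OF N] schwartz_gauss'[OF h1])
  have E: "E = (\<lambda>z. complex_of_real (exp (- ((Q *v z) \<bullet> z / h))))"
  proof
    fix z
    have "- (1 / h) * ((D *v z) \<bullet> (D *v z)) + - (1 / h) * ((N *v z) \<bullet> (N *v z)) = - ((Q *v z) \<bullet> z / h)"
      unfolding Qz by (simp add: add_divide_distrib)
    then show "E z = complex_of_real (exp (- ((Q *v z) \<bullet> z / h)))"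
      unfolding E_def gauss_def of_real_mult[symmetric] exp_add[symmetric] by (simp only:)
  qed
  define Lam where "Lam f = (\<integral>x. (\<integral>p. f (pvec x p) \<partial>lborel) \<partial>lborel)" for f :: "real^('n + 'n) \<Rightarrow> complex"
  have Lam: "tempered Lam" unfolding Lam_def by (rule tempered_iterated[OF tempered_integral tempered_integral])
  have mom1: "Lam (\<lambda>z. complex_of_real ((N *v z) $ k) * E z) = 0" for k
    unfolding Lam_def by (rule gaussian_moments(1)[OF h sQ iQ E SE])
  have mom2: "Lam (\<lambda>z. complex_of_real ((N *v z) $ m) * (complex_of_real ((N *v z) $ k) * E z)) = complex_of_real (h / 2 * R $ k $ m) * Lam E" for k m
    unfolding Lam_def R_def by (rule gaussian_moments(2)[OF h sQ iQ E SE])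
  have Lam0: "Lam E \<noteq> 0"
    using iterated_integral_positive[OF SE[unfolded E]] unfolding Lam_def E by simp
  \<comment> \<open>The Jacobian of \<open>dist_comp\<close> times the constant of
    \<open>wigner_psi_gauss\<close>, divided by |det L|.\<close>
  define C where "C = complex_of_real (1 / \<bar>det M\<bar>) * (complex_of_real ((1 / (2 * pi * h)) ^ CARD('n) * sqrt (4 * pi * h) ^ CARD('n)) / complex_of_real \<bar>det L\<bar>)"
  have dL: "det L \<noteq> 0" and dM: "det M \<noteq> 0" using L M by (simp_all add: invertible_det_nz)
  have C0: "C \<noteq> 0" using h dL dM by (simp add: C_def)
  have val: "wigner h T a = C * Lam (\<lambda>z. gauss (1 / h) (D *v z) * a (N *v z))" if a: "schwartz a" for a
  proof -
    have b: "schwartz (\<lambda>w. a (N *v w))" by (rule schwartz_matrix[OF N a])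
    have gD: "gauss (1 / h) (L *v x) * gauss (1 / h) (matrix_inv (transpose L) *v p) = gauss (1 / h) (D *v pvec x p)" for x p
      unfolding D_def blk_vector gauss_pvec[of _ "pvec _ _"] xpart_pvec ppart_pvec ..
    have "wigner h (fun_dist (psi_gauss h L)) (\<lambda>w. a (N *v w)) =
       (complex_of_real ((1 / (2 * pi * h)) ^ CARD('n) * sqrt (4 * pi * h) ^ CARD('n)) / complex_of_real \<bar>det L\<bar>) * Lam (\<lambda>z. gauss (1 / h) (D *v z) * a (N *v z))"
    proof -
      have div: "w = (k / d) * l" if "d * w = k * l" "d \<noteq> 0" for w k d l :: complex
        using that by (simp add: field_simps)
      show ?thesis
        by (rule div) (use wigner_psi_gauss[OF h L b] dL in \<open>simp_all only: gD Lam_def, simp_all\<close>)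
    qed
    then show ?thesis
      unfolding W[OF a, symmetric] dist_comp_def N_def[symmetric] C_def by (simp only: mult.assoc)
  qed
  define k0 where "k0 = complex_of_real ((1 / (2 * pi * h)) ^ CARD('n)) * complex_of_real (sqrt (pi * h) ^ CARD('n))"
  define \<phi> :: "real^'n \<Rightarrow> complex" where "\<phi> = gauss (1 / (2 * h))"
  define A where "A i z = complex_of_real (z $ Inl i) + \<i> * complex_of_real (z $ Inr i)" for i :: 'n and z :: "real^('n + 'n)"
  define \<delta> where "\<delta> i j = complex_of_real h * (if i = j then 1 else 0) / 2" for i j :: 'n
  define \<phi>1 where "\<phi>1 i u = complex_of_real (u $ i) * \<phi> u" for i u
  have S\<phi>: "schwartz \<phi>" unfolding \<phi>_def by (rule schwartz_gauss'[OF h2])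
  have S\<phi>1: "schwartz (\<phi>1 i)" for i unfolding \<phi>1_def by (rule schwartz_coord[OF S\<phi>])
  have r: "cnj (\<phi> v) = \<phi> v" "cnj (\<phi>1 i v) = \<phi>1 i v" for i v by (simp_all add: \<phi>_def \<phi>1_def)
  let ?g = "gauss (1 / h) :: real^('n + 'n) \<Rightarrow> complex"
  have g: "schwartz ?g" by (rule schwartz_gauss'[OF h1])
  have Sc: "schwartz (\<lambda>z. complex_of_real (z $ k) * ?g z)" for k by (rule schwartz_coord[OF g])
  have Scc: "schwartz (\<lambda>z. complex_of_real (z $ l) * (complex_of_real (z $ k) * ?g z))" for k l by (rule schwartz_coord[OF Sc])
  have kern: "wig_kernel h ?g u v = k0 * (\<phi> u * \<phi> v)"
    "wig_kernel h (\<lambda>z. A i z * ?g z) u v = k0 * (\<phi>1 i u * \<phi> v)"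
    "wig_kernel h (\<lambda>z. (A i z * cnj (A j z) - \<delta> i j) * ?g z) u v = k0 * (\<phi>1 i u * \<phi>1 j v)" for i j u v
    unfolding k0_def \<phi>1_def \<phi>_def A_def \<delta>_def by (rule gauss_product_kernel[OF h])+
  define X Y where "X = T \<phi>" and "Y i = T (\<phi>1 i)" for i
  have X: "k0 * (X * cnj X) = C * Lam E"
    using wigner_product[OF T S\<phi> S\<phi> r(1) kern(1)] val[OF g] unfolding X_def E_def by simp
  \<comment> \<open>E is even, so the first moments vanish.\<close>
  have XY: "k0 * (Y i * cnj X) = 0" for i
  proof -
    have eq: "(\<lambda>z. A i z * ?g z) = (\<lambda>z. complex_of_real (z $ Inl i) * ?g z + \<i> * (complex_of_real (z $ Inr i) * ?g z))"
      unfolding A_def by (simp add: algebra_simps)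
    have S: "schwartz (\<lambda>z. A i z * ?g z)" unfolding eq by (intro schwartz_add schwartz_scale Sc)
    have "(\<lambda>z. gauss (1 / h) (D *v z) * (A i (N *v z) * ?g (N *v z))) =
       (\<lambda>z. complex_of_real ((N *v z) $ Inl i) * E z + \<i> * (complex_of_real ((N *v z) $ Inr i) * E z))"
      unfolding A_def E_def by (simp add: algebra_simps)
    then have "Lam (\<lambda>z. gauss (1 / h) (D *v z) * (A i (N *v z) * ?g (N *v z))) = 0"
      by (simp only: tempered_add[OF Lam schwartz_matrix_coord[OF SE] schwartz_scale[OF schwartz_matrix_coord[OF SE]]]
          tempered_scale[OF Lam schwartz_matrix_coord[OF SE]] mom1) simp
    then show ?thesis
      using wigner_product[OF T S\<phi>1 S\<phi> r(1) kern(2)] val[OF S] unfolding X_def Y_def by simp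
  qed
  have "k0 \<noteq> 0" using h by (simp add: k0_def)
  \<comment> \<open>E is positive, so its integral is nonzero and T does not annihilate the ground
    state; then \<open>XY\<close> leaves only \<open>Y i = 0\<close>.\<close>
  moreover have "X \<noteq> 0" using X C0 Lam0 by auto
  ultimately have Y0: "Y i = 0" for i using XY[of i] by simp
  have SEc: "schwartz (\<lambda>z. complex_of_real ((N *v z) $ l) * (complex_of_real ((N *v z) $ k) * E z))" for k l
    by (intro schwartz_matrix_coord SE)
  \<comment> \<open>The sum on the left is 2/h times the normalised moment of \<open>A i\<close>
    times the conjugate of \<open>A j\<close>. It must cancel \<open>\<delta> i j\<close>, because
    the pairing equals a multiple of \<open>Y i * cnj (Y j)\<close>, which is 0.\<close>
  have key: "complex_of_real (R $ Inl i $ Inl j) + complex_of_real (R $ Inr i $ Inr j) + \<i> * (complex_of_real (R $ Inr i $ Inl j) - complex_of_real (R $ Inl i $ Inr j)) = (if i = j then 1 else 0)" for i j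
  proof -
    let ?m = "\<lambda>k l z. complex_of_real (z $ l) * (complex_of_real (z $ k) * ?g z)"
    have eq: "(\<lambda>z. (A i z * cnj (A j z) - \<delta> i j) * ?g z) =
       (\<lambda>z. (?m (Inl i) (Inl j) z + ?m (Inr i) (Inr j) z) + (\<i> * (?m (Inr i) (Inl j) z) + (- \<i>) * (?m (Inl i) (Inr j) z)) + (- \<delta> i j) * ?g z)"
      unfolding A_def by (rule ext) (simp add: algebra_simps)
    have S: "schwartz (\<lambda>z. (A i z * cnj (A j z) - \<delta> i j) * ?g z)"
      unfolding eq by (intro schwartz_add schwartz_scale Scc g)
    let ?e = "\<lambda>k l z. complex_of_real ((N *v z) $ l) * (complex_of_real ((N *v z) $ k) * E z)"
    have s1: "schwartz (\<lambda>z. ?e (Inl i) (Inl j) z + ?e (Inr i) (Inr j) z)" by (intro schwartz_add SEc)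
    have s2: "schwartz (\<lambda>z. \<i> * ?e (Inr i) (Inl j) z)" "schwartz (\<lambda>z. (- \<i>) * ?e (Inl i) (Inr j) z)"
      by (intro schwartz_scale SEc)+
    have "(\<lambda>z. gauss (1 / h) (D *v z) * ((A i (N *v z) * cnj (A j (N *v z)) - \<delta> i j) * ?g (N *v z))) =
       (\<lambda>z. (?e (Inl i) (Inl j) z + ?e (Inr i) (Inr j) z) + (\<i> * (?e (Inr i) (Inl j) z) + (- \<i>) * (?e (Inl i) (Inr j) z)) + (- \<delta> i j) * E z)"
      unfolding A_def E_def by (rule ext) (simp add: algebra_simps)
    then have "Lam (\<lambda>z. gauss (1 / h) (D *v z) * ((A i (N *v z) * cnj (A j (N *v z)) - \<delta> i j) * ?g (N *v z))) =
       ((complex_of_real (h / 2 * R $ Inl i $ Inl j) * Lam E + complex_of_real (h / 2 * R $ Inr i $ Inr j) * Lam E)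
       + (\<i> * (complex_of_real (h / 2 * R $ Inr i $ Inl j) * Lam E) + (- \<i>) * (complex_of_real (h / 2 * R $ Inl i $ Inr j) * Lam E)) + (- \<delta> i j) * Lam E)"
      by (simp only: tempered_add[OF Lam schwartz_add[OF s1 schwartz_add[OF s2]] schwartz_scale[OF SE]]
          tempered_add[OF Lam s1 schwartz_add[OF s2]] tempered_add[OF Lam s2] tempered_add[OF Lam SEc SEc]
          tempered_scale[OF Lam SEc] tempered_scale[OF Lam SE] mom2)
    also have "\<dots> = complex_of_real (h / 2) * (complex_of_real (R $ Inl i $ Inl j) + complex_of_real (R $ Inr i $ Inr j) + \<i> * (complex_of_real (R $ Inr i $ Inl j) - complex_of_real (R $ Inl i $ Inr j)) - (if i = j then 1 else 0)) * Lam E"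
      by (simp add: \<delta>_def algebra_simps)
    finally have "C * (complex_of_real (h / 2) * (complex_of_real (R $ Inl i $ Inl j) + complex_of_real (R $ Inr i $ Inr j) + \<i> * (complex_of_real (R $ Inr i $ Inl j) - complex_of_real (R $ Inl i $ Inr j)) - (if i = j then 1 else 0)) * Lam E) = k0 * (Y i * cnj (Y j))"
      using wigner_product[OF T S\<phi>1 S\<phi>1 r(2) kern(3)] val[OF S] unfolding Y_def by simp
    then have "complex_of_real (R $ Inl i $ Inl j) + complex_of_real (R $ Inr i $ Inr j) + \<i> * (complex_of_real (R $ Inr i $ Inl j) - complex_of_real (R $ Inl i $ Inr j)) - (if i = j then 1 else 0) = 0"
      unfolding Y0 using C0 Lam0 h by simp
    then show ?thesis by simp
  qed
  \<comment> \<open>The real part yields the off-diagonal blocks of R J + J R, the imaginary part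
    the diagonal ones.\<close>
  have R1: "R $ Inl i $ Inl j + R $ Inr i $ Inr j = (if i = j then 1 else 0)" for i j
    using arg_cong[OF key[of i j], of Re] by (simp split: if_splits)
  have R2: "R $ Inr i $ Inl j = R $ Inl i $ Inr j" for i j
    using arg_cong[OF key[of i j], of Im] by (simp split: if_splits)
  have RJ: "(R ** Jmat) $ k $ Inl j = - R $ k $ Inr j" "(R ** Jmat) $ k $ Inr j = R $ k $ Inl j" for k j
    by (simp_all add: matrix_matrix_mult_def sum_UNIV_sum Jmat_def if_distrib[of "\<lambda>c. _ * c"] cong: if_cong)
  have JR: "(Jmat ** R) $ Inl i $ l = R $ Inr i $ l" "(Jmat ** R) $ Inr i $ l = - R $ Inl i $ l" for i l
    by (simp_all add: matrix_matrix_mult_def sum_UNIV_sum Jmat_def if_distrib[of "\<lambda>c. c * _"] cong: if_cong)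
  have R1': "- R $ Inr i $ Inr j - R $ Inl i $ Inl j = - (if i = j then 1 else 0)" for i j
    using R1[of i j] by linarith
  let ?J = "Jmat :: real^('n+'n)^('n+'n)"
  have Jn: "?J $ Inl i $ Inl j = 0" "?J $ Inr i $ Inr j = 0" "?J $ Inl i $ Inr j = (if i = j then 1 else 0)"
      "?J $ Inr i $ Inl j = - (if i = j then 1 else 0)" for i j
    by (simp_all add: Jmat_def)
  show "R ** Jmat + Jmat ** R = Jmat"
    unfolding mat_sum_eq_iff vector_add_component RJ JR Jn
    by (intro allI conjI) (use R1 R1' R2 in \<open>simp_all only: add.commute diff_conv_add_uminus add.right_inverse add.left_inverse\<close>)
qed

section \<open>Rigidity\<close>

lemma matrix_scaleR_left: "(c *\<^sub>R A) ** B = c *\<^sub>R (A ** B)" for A :: "real^'m^'k" and B :: "real^'l^'m"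
  by (simp add: matrix_matrix_mult_def vec_eq_iff sum_distrib_left mult_ac)

lemma matrix_scaleR_right: "A ** (c *\<^sub>R B) = c *\<^sub>R (A ** B)" for A :: "real^'m^'k" and B :: "real^'l^'m"
  by (simp add: matrix_matrix_mult_def vec_eq_iff sum_distrib_left mult_ac)

lemma matrix_uminus_left: "(- A) ** B = - (A ** B)" for A :: "real^'m^'k" and B :: "real^'l^'m"
  by (simp add: matrix_matrix_mult_def vec_eq_iff sum_negf)

lemma matrix_uminus_right: "A ** (- B) = - (A ** B)" for A :: "real^'m^'k" and B :: "real^'l^'m"
  by (simp add: matrix_matrix_mult_def vec_eq_iff sum_negf)

lemma matrix_add_left: "(A + B) ** C = A ** C + B ** C" for A B :: "real^'m^'k" and C :: "real^'l^'m"
  by (simp add: matrix_matrix_mult_def vec_eq_iff sum.distrib distrib_right)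

lemma matrix_add_right: "A ** (B + C) = A ** B + A ** C" for A :: "real^'m^'k" and B C :: "real^'l^'m"
  by (simp add: matrix_matrix_mult_def vec_eq_iff sum.distrib distrib_left)

lemma transpose_Jmat: "transpose Jmat = - Jmat"
  by (simp add: mat_sum_eq_iff transpose_def Jmat_def)

text \<open>The inverse of R is V = F + 1 with F = \<open>transpose M ** G ** M\<close>. Multiplying
  R J + J R = J by V on both sides gives J V + V J = V J V; inserting V = F + 1, everything cancels
  except F J F = J. Conjugation by N frees G from M.\<close>

lemma constraint_symplectic:
  fixes J G M N :: "real^'m::finite^'m"
  assumes N: "N ** M = mat 1" "M ** N = mat 1" and Q: "invertible (G + transpose N ** N)"
    and R: "R = N ** matrix_inv (G + transpose N ** N) ** transpose N" and RJ: "R ** J + J ** R = J"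
  shows "G ** (M ** J ** transpose M) ** G = transpose N ** J ** N"
proof -
  let ?Q = "G + transpose N ** N" and ?F = "transpose M ** G ** M"
  have tN: "transpose M ** transpose N = mat 1" "transpose N ** transpose M = mat 1"
    using N by (metis matrix_transpose_mul transpose_mat)+
  define V where "V = transpose M ** ?Q ** M"
  have "transpose M ** (transpose N ** N) ** M = (transpose M ** transpose N) ** (N ** M)"
    by (simp only: matrix_mul_assoc)
  then have V: "V = ?F + mat 1"
    unfolding V_def matrix_add_right matrix_add_left tN N by simp
  have "R ** V = N ** matrix_inv ?Q ** (transpose N ** transpose M) ** ?Q ** M"
    unfolding R V_def by (simp only: matrix_mul_assoc)
  also have "\<dots> = N ** (matrix_inv ?Q ** ?Q) ** M"
    unfolding tN by (simp only: matrix_mul_rid matrix_mul_assoc)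
  also have "\<dots> = mat 1" unfolding matrix_inverse_left[OF Q] by (simp only: matrix_mul_rid N)
  finally have RV: "R ** V = mat 1" .
  then have VR: "V ** R = mat 1" by (simp add: matrix_left_right_inverse)
  have "V ** (R ** J + J ** R) ** V = (V ** R) ** J ** V + V ** J ** (R ** V)"
    by (simp only: matrix_add_right matrix_add_left matrix_mul_assoc)
  then have "V ** J ** V = J ** V + V ** J"
    unfolding RJ RV VR by (simp only: matrix_mul_lid matrix_mul_rid)
  then have FJF: "?F ** J ** ?F = J"
    unfolding V matrix_add_right matrix_add_left matrix_mul_lid matrix_mul_rid by (simp add: algebra_simps)
  have "transpose N ** (?F ** J ** ?F) ** N = (transpose N ** transpose M) ** G ** M ** J ** transpose M ** G ** (M ** N)"
    by (simp only: matrix_mul_assoc)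
  then show ?thesis unfolding FJF tN N by (simp only: matrix_mul_lid matrix_mul_rid matrix_mul_assoc)
qed

lemma diag_mult:
  fixes A :: "real^'n::finite^'n"
  shows "((\<chi> i j. if i = j then d i else 0) ** A) $ i $ j = d i * A $ i $ j"
    and "(A ** (\<chi> i j. if i = j then d i else 0)) $ i $ j = A $ i $ j * d j"
  by (simp_all add: matrix_matrix_mult_def if_distrib[of "\<lambda>c. c * _"] if_distrib[of "\<lambda>c. _ * c"] cong: if_cong)

text \<open>Testing with diagonal matrices and with one shear shows that the blocks are scalar.\<close>

lemma blocks_scalar:
  fixes a b :: "real^'n::finite^'n"
  assumes a: "\<And>L::real^'n^'n. invertible L \<Longrightarrow> (transpose L ** L) ** a ** (transpose L ** L) = a"
    and b: "\<And>L::real^'n^'n. invertible L \<Longrightarrow> (transpose L ** L) ** b = b ** (transpose L ** L)"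
  shows "a = 0" and "\<exists>c. b = mat c"
proof -
  let ?D = "\<lambda>l. (\<chi> i j. if i = j then l i else 0) :: real^'n^'n"
  have DD: "transpose (?D l) ** ?D l = ?D (\<lambda>i. l i * l i)" for l
  proof -
    have "transpose (?D l) = ?D l" by (simp add: transpose_def vec_eq_iff)
    then show ?thesis by (simp add: vec_eq_iff diag_mult)
  qed
  have Dinv: "invertible (?D l)" if "\<And>i. l i \<noteq> 0" for l
  proof -
    have "det (?D l) = (\<Prod>i\<in>UNIV. l i)" by (subst det_diagonal) simp_all
    then show ?thesis using that by (simp add: invertible_det_nz)
  qed
  \<comment> \<open>L = 2 I multiplies a by 16.\<close>
  have "(?D (\<lambda>i. 2 * 2) ** a ** ?D (\<lambda>i. 2 * 2)) $ i $ j = a $ i $ j" for i j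
    using a[OF Dinv[of "\<lambda>i. 2"]] unfolding DD by (simp only:)
  then have "a $ i $ j = 0" for i j by (simp add: diag_mult)
  then show "a = 0" by (simp add: vec_eq_iff)
  have off: "b $ i $ j = 0" if "i \<noteq> j" for i j
  proof -
    \<comment> \<open>Doubling only the coordinate i gives 4 b_ij = b_ij off the diagonal.\<close>
    let ?l = "\<lambda>m. if m = i then 2 else 1 :: real"
    have "(?D (\<lambda>m. ?l m * ?l m) ** b) $ i $ j = (b ** ?D (\<lambda>m. ?l m * ?l m)) $ i $ j"
      using b[OF Dinv[of ?l]] unfolding DD by simp
    then show ?thesis using that by (simp add: diag_mult)
  qed
  have bd: "b = ?D (\<lambda>i. b $ i $ i)" by (simp add: vec_eq_iff off)
  have eq: "b $ k $ k = b $ l $ l" if kl: "k \<noteq> l" for k l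
  proof -
    \<comment> \<open>For this shear, X = \<open>transpose ?S ** ?S\<close> has the entry 1 at (k,
      l); comparing that entry in X b = b X equates two diagonal entries of b.\<close>
    let ?S = "(\<chi> i j. if i = k \<and> j = l \<or> i = j then 1 else 0) :: real^'n^'n"
    have Sx: "?S *v x = (\<chi> i. if i = k then x $ k + x $ l else x $ i)" for x
    proof -
      have "(\<Sum>j\<in>UNIV. (if i = k \<and> j = l \<or> i = j then 1 else 0) * x $ j) = (\<Sum>j\<in>UNIV. (if j = i then x $ j else 0) + (if i = k then (if j = l then x $ j else 0) else 0))" for i
        using kl by (intro sum.cong) auto
      then show ?thesis by (simp add: vec_eq_iff matrix_vector_mult_def sum.distrib)
    qed
    have "x = 0" if "?S *v x = 0" for x
    proof -
      have x0: "x $ i = 0" if "i \<noteq> k" for i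
        using \<open>?S *v x = 0\<close> that unfolding Sx vec_eq_iff by (auto dest: spec[of _ i])
      moreover have "x $ k + x $ l = 0"
        using \<open>?S *v x = 0\<close> unfolding Sx vec_eq_iff by (auto dest: spec[of _ k])
      ultimately have "x $ i = 0" for i using kl by (cases "i = k") auto
      then show "x = 0" by (simp add: vec_eq_iff)
    qed
    then have S: "invertible ?S" by (simp only: invertible_left_inverse matrix_left_invertible_ker) blast
    let ?X = "transpose ?S ** ?S"
    have "?S $ m $ k * ?S $ m $ l = (if m = k then 1 else 0)" for m
      using kl by auto
    then have X: "?X $ k $ l = 1" by (simp only: matrix_matrix_mult_def transpose_def vec_lambda_beta) simp
    have "(?X ** ?D (\<lambda>i. b $ i $ i)) $ k $ l = (?D (\<lambda>i. b $ i $ i) ** ?X) $ k $ l"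
      using b[OF S] bd by simp
    then show ?thesis unfolding diag_mult X by simp
  qed
  have "b = mat (b $ i $ i)" for i
  proof -
    have "b $ m $ j = (if m = j then b $ i $ i else 0)" for m j
      using off[of m j] eq[of m i] by (cases "m = i") auto
    then show ?thesis unfolding vec_eq_iff mat_def vec_lambda_beta by blast
  qed
  then show "\<exists>c. b = mat c" by blast
qed

text \<open>The right-hand side of \<open>inv\<close> does not involve L, so by the case L = I it
  equals P, and the hypothesis becomes the invariance of P under all the block matrices. In blocks
  this reads X p11 X = p11, X p12 = p12 X and X p22 X = p22, the situation of
  \<open>blocks_scalar\<close>.\<close>

lemma rigidity:
  fixes M N :: "real^('n::finite + 'n)^('n + 'n)"
  assumes N: "N ** M = mat 1" "M ** N = mat 1"
    and inv: "\<And>L::real^'n^'n. invertible L \<Longrightarrow> blk (transpose L ** L) (matrix_inv (transpose L ** L)) ** (M ** Jmat ** transpose M)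
       ** blk (transpose L ** L) (matrix_inv (transpose L ** L)) = transpose N ** Jmat ** N"
  shows "symplectic M \<or> antisymplectic M"
proof -
  define P where "P = M ** Jmat ** transpose M"
  let ?W = "transpose N ** Jmat ** N"
  define p11 p12 p22 where "p11 = (\<chi> i j. P $ Inl i $ Inl j)" and "p12 = (\<chi> i j. P $ Inl i $ Inr j)"
    and "p22 = (\<chi> i j. P $ Inr i $ Inr j)"
  have m1: "matrix_inv (mat 1 :: real^'n^'n) = mat 1"
    using matrix_inverse_left[of "mat 1 :: real^'n^'n"] by (simp add: invertible_def)
  have b1: "blk (mat 1) (mat 1) = (mat 1 :: real^('n + 'n)^('n + 'n))"
    by (simp add: mat_sum_eq_iff mat_def)
  have PW: "P = ?W"
    using inv[of "mat 1"] unfolding P_def[symmetric] by (simp add: transpose_mat m1 b1 invertible_def)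
  have GPG: "blk X Y ** P ** blk X Y = P" if "invertible L" "X = transpose L ** L" "Y = matrix_inv X" for L X Y :: "real^'n^'n"
    using inv[OF that(1)] unfolding P_def[symmetric] that(2,3) PW[symmetric] .
  have blkP: "(blk X Y ** P ** blk X' Y') $ Inl i $ Inl j = (X ** p11 ** X') $ i $ j"
    "(blk X Y ** P ** blk X' Y') $ Inl i $ Inr j = (X ** p12 ** Y') $ i $ j"
    "(blk X Y ** P ** blk X' Y') $ Inr i $ Inr j = (Y ** p22 ** Y') $ i $ j" for X Y X' Y' :: "real^'n^'n" and i j
    by (simp_all add: matrix_matrix_mult_def sum_UNIV_sum p11_def p12_def p22_def)
  have blocks: "X ** p11 ** X = p11 \<and> X ** p12 = p12 ** X \<and> X ** p22 ** X = p22"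
    if L: "invertible L" and X: "X = transpose L ** L" for L X :: "real^'n^'n"
  proof -
    define Y where "Y = matrix_inv X"
    have iX: "invertible X" unfolding X using L by (intro invertible_mult transpose_invertible)
    have YX: "Y ** X = mat 1" "X ** Y = mat 1" unfolding Y_def by (rule matrix_inverse[OF iX])+
    note G = GPG[OF L X Y_def]
    have "X ** p11 ** X = p11" unfolding vec_eq_iff blkP(1)[where X=X and Y=Y and X'=X and Y'=Y, symmetric] G by (simp add: p11_def)
    moreover have e: "X ** p12 ** Y = p12" unfolding vec_eq_iff blkP(2)[where X=X and Y=Y and X'=X and Y'=Y, symmetric] G by (simp add: p12_def)
    moreover have e2: "Y ** p22 ** Y = p22" unfolding vec_eq_iff blkP(3)[where X=X and Y=Y and X'=X and Y'=Y, symmetric] G by (simp add: p22_def)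
    moreover have "X ** p12 = p12 ** X"
    proof -
      have "p12 ** X = X ** p12 ** (Y ** X)" using e by (simp only: matrix_mul_assoc)
      then show ?thesis unfolding YX by (simp only: matrix_mul_rid)
    qed
    moreover have "X ** p22 ** X = p22"
    proof -
      have "X ** p22 ** X = X ** (Y ** p22 ** Y) ** X" unfolding e2 ..
      also have "\<dots> = (X ** Y) ** p22 ** (Y ** X)" by (simp only: matrix_mul_assoc)
      finally show ?thesis unfolding YX by (simp only: matrix_mul_lid matrix_mul_rid)
    qed
    ultimately show ?thesis by blast
  qed
  have p11: "p11 = 0" by (rule blocks_scalar(1)[where b=p12]) (use blocks in blast)+
  have p22: "p22 = 0" by (rule blocks_scalar(1)[where b=p12]) (use blocks in blast)+
  obtain c where p12: "p12 = mat c" using blocks_scalar(2)[of p11 p12] blocks by blast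
  \<comment> \<open>The lower left block of P is obtained from p12 by antisymmetry.\<close>
  have tP: "transpose P = - P"
    unfolding P_def matrix_transpose_mul transpose_transpose transpose_Jmat
    by (simp only: matrix_uminus_left matrix_uminus_right matrix_mul_assoc)
  have P: "P = c *\<^sub>R Jmat"
  proof -
    have "P $ Inl i $ Inl j = 0" "P $ Inr i $ Inr j = 0" "P $ Inl i $ Inr j = (if i = j then c else 0)" for i j
      using p11 p22 p12 by (simp_all add: p11_def p22_def p12_def vec_eq_iff mat_def)
    moreover have "P $ Inr i $ Inl j = - P $ Inl j $ Inr i" for i j
    proof -
      have "transpose P $ Inl j $ Inr i = (- P) $ Inl j $ Inr i" by (simp only: tP)
      then show ?thesis by (simp add: transpose_def)
    qed
    ultimately show ?thesis by (simp add: mat_sum_eq_iff Jmat_def)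
  qed
  define A where "A = transpose M ** Jmat ** M"
  have tN: "transpose M ** transpose N = mat 1"
    using N(1) N(2) by (metis matrix_transpose_mul transpose_mat)
  \<comment> \<open>A first relation between c and A, from equating the two expressions for
    P.\<close>
  have cA: "c *\<^sub>R A = Jmat"
  proof -
    have "c *\<^sub>R A = transpose M ** P ** M" unfolding A_def P by (simp only: matrix_scaleR_left matrix_scaleR_right)
    also have "\<dots> = (transpose M ** transpose N) ** Jmat ** (N ** M)" unfolding PW by (simp only: matrix_mul_assoc)
    finally show ?thesis unfolding tN N by (simp only: matrix_mul_lid matrix_mul_rid)
  qed
  have J0: "(Jmat :: real^('n + 'n)^('n + 'n)) \<noteq> 0"
  proof
    assume "(Jmat :: real^('n + 'n)^('n + 'n)) = 0"
    then have "(Jmat :: real^('n + 'n)^('n + 'n)) $ Inl i $ Inr i = 0" for i by simp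
    then show False by (simp add: Jmat_def)
  qed
  have c0: "c \<noteq> 0" using cA J0 by auto
  \<comment> \<open>P = c J exhibits a right inverse of M. Read as a left inverse it gives the
    second relation A = c J, and both together give c^2 = 1.\<close>
  have "M ** ((- 1 / c) *\<^sub>R (Jmat ** transpose M ** Jmat)) = (- 1 / c) *\<^sub>R (P ** Jmat)"
    unfolding P_def by (simp only: matrix_scaleR_right matrix_mul_assoc)
  also have "\<dots> = mat 1" unfolding P matrix_scaleR_left Jmat_square using c0 by simp
  finally have "((- 1 / c) *\<^sub>R (Jmat ** transpose M ** Jmat)) ** M = mat 1"
    by (simp only: matrix_left_right_inverse)
  then have "(- 1 / c) *\<^sub>R (Jmat ** A) = mat 1"
    unfolding A_def by (simp only: matrix_scaleR_left matrix_mul_assoc)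
  then have "c *\<^sub>R ((- 1 / c) *\<^sub>R (Jmat ** A)) = c *\<^sub>R mat 1" by (simp only:)
  then have "- (Jmat ** A) = c *\<^sub>R mat 1" using c0 by simp
  then have "Jmat ** (- (Jmat ** A)) = Jmat ** (c *\<^sub>R mat 1)" by (simp only:)
  then have "- ((Jmat ** Jmat) ** A) = c *\<^sub>R Jmat"
    by (simp only: matrix_uminus_right matrix_scaleR_right matrix_mul_rid matrix_mul_assoc)
  then have A: "A = c *\<^sub>R Jmat" unfolding Jmat_square matrix_uminus_left matrix_mul_lid by simp
  have "(c * c - 1) *\<^sub>R (Jmat :: real^('n + 'n)^('n + 'n)) = 0"
    using cA unfolding A by (simp add: scaleR_diff_left)
  then have "c * c = 1" using J0 by simp
  then have "c = 1 \<or> c = -1" by (metis power2_eq_1_iff power2_eq_square)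
  then show ?thesis
    using A unfolding symplectic_def antisymplectic_def A_def by auto
qed

theorem theorem1:
  fixes h :: real and M :: "real^('n::finite + 'n)^('n + 'n)"
  assumes "h > 0" and "invertible M"
  shows "(antisymplectic M \<longrightarrow>
            (\<forall>Sh \<psi>. Sh \<in> metaplectic h \<and> mp_covers h Sh (Cmat ** M) \<and> tempered \<psi> \<longrightarrow>
               (\<forall>a. schwartz a \<longrightarrow>
                  dist_comp M (wigner h \<psi>) a = wigner h (mp_inv_dist Sh (dist_conj \<psi>)) a)))
       \<and> ((\<forall>\<psi>. schwartz \<psi> \<longrightarrow>
             (\<exists>\<psi>'. tempered \<psi>' \<and>
                (\<forall>a. schwartz a \<longrightarrow> dist_comp M (wigner h (fun_dist \<psi>)) a = wigner h \<psi>' a)))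
          \<longrightarrow> symplectic M \<or> antisymplectic M)"
proof (intro conjI impI allI)
  fix Sh and \<psi> :: "(real^'n \<Rightarrow> complex) \<Rightarrow> complex" and a :: "real^('n + 'n) \<Rightarrow> complex"
  assume "antisymplectic M" "Sh \<in> metaplectic h \<and> mp_covers h Sh (Cmat ** M) \<and> tempered \<psi>" "schwartz a"
  then show "dist_comp M (wigner h \<psi>) a = wigner h (mp_inv_dist Sh (dist_conj \<psi>)) a"
    using wigner_antisymplectic[OF assms] by blast
next
  assume W: "\<forall>\<psi>. schwartz \<psi> \<longrightarrow> (\<exists>\<psi>'. tempered \<psi>' \<and>
      (\<forall>a. schwartz a \<longrightarrow> dist_comp M (wigner h (fun_dist \<psi>)) a = wigner h \<psi>' a))"
  let ?N = "matrix_inv M"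
  show "symplectic M \<or> antisymplectic M"
  proof (rule rigidity[OF matrix_inverse[OF assms(2)]])
    fix L :: "real^'n^'n" assume L: "invertible L"
    let ?B = "matrix_inv (transpose L)" and ?X = "transpose L ** L"
    let ?D = "blk L ?B"
    have tL: "invertible (transpose L)" using L by (rule transpose_invertible)
    have iX: "invertible ?X" using L tL by (rule invertible_mult[rotated])
    \<comment> \<open>The hypothesis is applied to the Gaussian states; their shape L is arbitrary,
      as \<open>rigidity\<close> demands.\<close>
    obtain T where T: "tempered T"
      "\<And>a. schwartz a \<Longrightarrow> dist_comp M (wigner h (fun_dist (psi_gauss h L))) a = wigner h T a"
      using W schwartz_psi_gauss[OF assms(1) L] by blast
    \<comment> \<open>The lower block of the Gaussian form is \<open>transpose ?B ** ?B\<close>,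
      which has to be recognised as the inverse of \<open>?X\<close>.\<close>
    have "transpose ?B ** L = mat 1" 
      using arg_cong[OF matrix_inverse_right[OF tL], of transpose] by (simp only: matrix_transpose_mul transpose_transpose transpose_mat)
    moreover have "transpose ?B ** ?B ** ?X = transpose ?B ** (?B ** transpose L) ** L"
      by (simp only: matrix_mul_assoc)
    ultimately have BX: "transpose ?B ** ?B ** ?X = mat 1"
      unfolding matrix_inverse_left[OF tL] by (simp only: matrix_mul_rid)
    have "transpose ?B ** ?B = transpose ?B ** ?B ** (?X ** matrix_inv ?X)"
      unfolding matrix_inverse_right[OF iX] by (simp only: matrix_mul_rid)
    also have "\<dots> = (transpose ?B ** ?B ** ?X) ** matrix_inv ?X" by (simp only: matrix_mul_assoc)
    finally have BB: "transpose ?B ** ?B = matrix_inv ?X" unfolding BX by (simp only: matrix_mul_lid)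
    have G: "transpose ?D ** ?D = blk ?X (matrix_inv ?X)"
      unfolding transpose_blk blk_mult BB ..
    note con = gaussian_constraint[OF assms L T]
    show "blk ?X (matrix_inv ?X) ** (M ** Jmat ** transpose M) ** blk ?X (matrix_inv ?X) = transpose ?N ** Jmat ** ?N"
      by (rule constraint_symplectic[OF matrix_inverse[OF assms(2)] con(1)[unfolded G] refl con(3)[unfolded G]])
  qed
qed

end
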